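(* Suppose that the standing assumptions on $b,f,g$ stated in the context hold and that $f_{uu},b_{uu}$ are independent of $u$. Let $\bar u(\cdot)\in L^2$ be an optimal control, i.e. a minimizer of $J$ over $L^2$, with corresponding state $\bar x(\cdot)$ and adjoint $\bar p(\cdot)$. If the second-order coercivity condition (see context) holds at $\bar u(\cdot)$ with constant $\alpha>0$ and the initial control $u^0(\cdot)$ is sufficiently close to $\bar u(\cdot)$ in $L^2$, then the following statements hold: (i) Newton's method (see context) started at $u^0(\cdot)$ generates a sequence $\{u^k(\cdot)\}$ that converges quadratically to $\bar u(\cdot)$ in $L^2$. (ii) A radius $r_4$ that guarantees this convergence (i.e. it suffices that $\|u^0-\bar u\|_2\le r_4$) is given by $$r_4=\frac{\sqrt{C_4^2(1+\|\bar u\|_1)^2+C_4\sqrt T\,\alpha}-C_4(1+\|\bar u\|_1)}{C_4\sqrt T},$$ where $C_4$ is the explicit constant given in the context. (iii) The gradients $\{J'(u^k(\cdot))\}$ converge quadratically to zero in $L^2$.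
   Context: Setting. Fix $T>0$, $n,m\in\mathbb{N}$, $x_0\in\mathbb{R}^n$ and maps $b:[0,T]\times\mathbb{R}^n\times\mathbb{R}^m\to\mathbb{R}^n$, $f:[0,T]\times\mathbb{R}^n\times\mathbb{R}^m\to\mathbb{R}$, $g:\mathbb{R}^n\to\mathbb{R}$. $|\cdot|$ is the Euclidean norm (for matrices and higher-order arrays, that of the entries). For $\beta\in[1,\infty]$, $L^\beta=L^\beta(0,T;\mathbb{R}^m)$ with norm $\|\cdot\|_\beta$. Derivatives. $b_x,b_u$ are Jacobians ($n\times n$, $n\times m$); gradients $f_x,f_u,g_x,H_x,H_u$ are column vectors; $H_{xu}$ is the derivative of $H_x$ with respect to $u$ (an $n\times m$ matrix), $H_{ux}=H_{xu}^\top$; $\varphi_{(x,u)^2}$ is the full second derivative (Hessian) of $\varphi$ in $(x,u)$, and $\varphi_{(x,u)^2}(y,v)^2$ denotes its quadratic form evaluated at the vector $(y,v)$. Standing assumptions. $b,f,g$ are measurable; for every $t$, $b(t,\cdot,\cdot)$ and $f(t,\cdot,\cdot)$ are twice differentiable, and $g$ is twice differentiable; there is a constant $L>0$, independent of $t$, such that for all $t\in[0,T]$, $x,\bar x\in\mathbb{R}^n$, $u,\bar u\in\mathbb{R}^m$: $|b(t,x,u)|\le L(|x|+|u|+1)$, $|b_x(t,x,u)|+|b_u(t,x,u)|\le L$, $|b_{(x,u)^2}(t,x,u)|\le L$, $|b_{(x,u)^2}(t,x,u)-b_{(x,u)^2}(t,\bar x,\bar u)|\le L(|x-\bar x|+|u-\bar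 u|)$; $|f(t,x,u)|\le L(|x|^2+|u|^2+1)$, $|f_x(t,x,u)|+|f_u(t,x,u)|\le L(|x|+|u|+1)$, $|f_{(x,u)^2}(t,x,u)|\le L$, $|f_{(x,u)^2}(t,x,u)-f_{(x,u)^2}(t,\bar x,\bar u)|\le L(|x-\bar x|+|u-\bar u|)$; $|g(x)|\le L(|x|^2+1)$, $|g_x(x)|\le L(|x|+1)$, $|g_{xx}(x)|\le L$, $|g_{xx}(x)-g_{xx}(\bar x)|\le L|x-\bar x|$. State, cost, adjoint. For $u(\cdot)\in L^2$, the state $x(\cdot)$ is the unique solution of $\dot x(t)=b(t,x(t),u(t))$, $x(0)=x_0$; the cost is $J(u(\cdot))=\int_0^Tf(t,x(t),u(t))\,dt+g(x(T))$; the adjoint $p(\cdot)$ is the unique solution of $\dot p(t)=-b_x(t,x(t),u(t))^\top p(t)-f_x(t,x(t),u(t))$, $p(T)=g_x(x(T))$. The Hamiltonian is $H(t,x,u,p)=b(t,x,u)^\top p+f(t,x,u)$. The gradient (Riesz representative in $L^2$ of the Fr\'echet derivative of $J$) is $J'(u(\cdot))(t)=H_u(t,x(t),u(t),p(t))$. Second-order coercivity condition at $\bar u(\cdot)$ with constant $\alpha>0$: for every $v(\cdot)\in L^2$, $\int_0^TH_{(x,u)^2}(t,\bar x(t),\bar u(t),\bar p(t))(y(t),v(t))^2dt+y(T)^\top g_{xx}(\bar x(T))y(T)\ge\alpha\|v\|_2^2$, where $\dot y(t)=b_x(t,\bar x(t),\bar u(t))y(t)+b_u(t,\bar x(t),\bar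 u(t))v(t)$, $y(0)=0$. Newton's method. Given $u^k(\cdot)$, compute its state $x^k(\cdot)$ and adjoint $p^k(\cdot)$; if $J'(u^k(\cdot))=H_u(\cdot,x^k,u^k,p^k)=0$, stop. Otherwise let $v^k(\cdot)$ be the solution of: minimize over $v(\cdot)\in L^2$ $\frac12\int_0^T\{2\langle H_u(t,x^k(t),u^k(t),p^k(t)),v(t)\rangle+H_{(x,u)^2}(t,x^k(t),u^k(t),p^k(t))(y(t),v(t))^2\}dt+\frac12\langle g_{xx}(x^k(T))y(T),y(T)\rangle$ subject to $\dot y(t)=b_x(t,x^k(t),u^k(t))y(t)+b_u(t,x^k(t),u^k(t))v(t)$, $y(0)=0$. If $v^k(\cdot)=0$, stop; otherwise set $u^{k+1}(\cdot)=u^k(\cdot)+v^k(\cdot)$ and repeat. If the method stops at $u^k$, the sequence is understood to be constant from then on. Quadratic convergence of a sequence $z^k\to z$ in a normed space means $z^k\to z$ and there is $C>0$ with $\|z^{k+1}-z\|\le C\|z^k-z\|^2$ for all $k$. Constants. $C_x=\max\{e^{LT}(|x_0|+LT),\,Le^{LT}\}$, $K_p=Le^{LT}(1+C_x)(T+1)$, $C_p=\max\{K_p,\,Le^{LT}[C_x+(C_xT+1)(1+K_p)]\}$, $C_H=\max\{L(C_p+C_x+C_pC_x),\,L(1+C_p)\}$, $C_1=\max\{C_x,C_p,C_H\}$; $C_y=Le^{LT}[(C_1+Le^{LT}+C_1LTe^{LT})T+1]$, $K_\psi=e^{LT}[LC_y+C_1(C_yT+1)]$, $C_\psi=\max\{K_\psi,\,e^{LT}[LC_y(C_1T+1)+LK_\psi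 T(C_1T+1)+C_1(C_yT^2+2C_yT+T+1)]\}$, $C_2=\max\{C_y,C_\psi\}$; $C_4=T^{1/2}\{C_2[L(C_1T+2)+C_1(T+2)]+C_1\}$. *)

theory Defs
  imports "HOL-Analysis.Analysis"
begin

section \<open>Derivatives\<close>

definition gradient :: "('a::euclidean_space \<Rightarrow> real) \<Rightarrow> 'a \<Rightarrow> 'a" where
  "gradient \<phi> z = (THE D. GDERIV \<phi> z :> D)"

text \<open>\<open>second_deriv \<phi> z h k\<close> is the second derivative of \<open>\<phi>\<close> at \<open>z\<close>, as a bilinear map evaluated at
  \<open>(h, k)\<close>. Since the space is finite dimensional, differentiability of \<open>z \<mapsto> D\<phi>(z)\<close> is
  the same as differentiability of \<open>z \<mapsto> D\<phi>(z) h\<close> for every direction \<open>h\<close>.\<close>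

definition twice_differentiable ::
    "('a::euclidean_space \<Rightarrow> 'b::real_normed_vector) \<Rightarrow> bool" where
  "twice_differentiable \<phi> \<longleftrightarrow>
     (\<forall>z. \<phi> differentiable (at z)) \<and>
     (\<forall>h z. (\<lambda>w. frechet_derivative \<phi> (at w) h) differentiable (at z))"

definition second_deriv ::
    "('a::euclidean_space \<Rightarrow> 'b::real_normed_vector) \<Rightarrow> 'a \<Rightarrow> 'a \<Rightarrow> 'a \<Rightarrow> 'b" where
  "second_deriv \<phi> z h k =
     frechet_derivative (\<lambda>w. frechet_derivative \<phi> (at w) k) (at z) h"

text \<open>The Euclidean norm of the array of entries of a bilinear map. For vector-valued maps the
  inner norm already sums the squares over the components.\<close>

definition array_norm :: "('a::euclidean_space \<Rightarrow> 'a \<Rightarrow> 'b::real_normed_vector) \<Rightarrow> real" where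
  "array_norm A = sqrt (\<Sum>i\<in>Basis. \<Sum>j\<in>Basis. (norm (A i j))\<^sup>2)"


section \<open>Lebesgue spaces on \<open>[0, T]\<close>\<close>

text \<open>Elements are functions rather than classes, and their values outside \<open>[0, T]\<close> are
  irrelevant; equality in the space is equality almost everywhere on \<open>[0, T]\<close>.\<close>

definition Lp_space :: "real \<Rightarrow> real \<Rightarrow> (real \<Rightarrow> 'a::euclidean_space) set" where
  "Lp_space \<beta> T = {v. v \<in> borel_measurable (lebesgue_on {0..T}) \<and>
                       integrable (lebesgue_on {0..T}) (\<lambda>t. norm (v t) powr \<beta>)}"

definition Lp_norm :: "real \<Rightarrow> real \<Rightarrow> (real \<Rightarrow> 'a::euclidean_space) \<Rightarrow> real" where
  "Lp_norm \<beta> T v = (LINT t|lebesgue_on {0..T}. norm (v t) powr \<beta>) powr (1 / \<beta>)"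

definition quadratically_converges_L2 ::
    "real \<Rightarrow> (nat \<Rightarrow> real \<Rightarrow> 'a::euclidean_space) \<Rightarrow> (real \<Rightarrow> 'a) \<Rightarrow> bool" where
  "quadratically_converges_L2 T z w \<longleftrightarrow>
     (\<forall>k. z k \<in> Lp_space 2 T) \<and> w \<in> Lp_space 2 T \<and>
     (\<lambda>k. Lp_norm 2 T (\<lambda>t. z k t - w t)) \<longlonglongrightarrow> 0 \<and>
     (\<exists>C>0. \<forall>k. Lp_norm 2 T (\<lambda>t. z (Suc k) t - w t)
                  \<le> C * (Lp_norm 2 T (\<lambda>t. z k t - w t))\<^sup>2)"


section \<open>State, cost and adjoint\<close>

text \<open>Differential equations with \<open>L\<^sup>2\<close> data are understood in the sense of Caratheodory:
  a solution is absolutely continuous on \<open>[0, T]\<close> and satisfies the equation almost everywhere,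
  that is, it is an indefinite integral of the right-hand side.\<close>

definition solves_ode_on ::
    "real \<Rightarrow> (real \<Rightarrow> 'a::euclidean_space \<Rightarrow> 'a) \<Rightarrow> (real \<Rightarrow> 'a) \<Rightarrow> bool" where
  "solves_ode_on T F x \<longleftrightarrow>
     integrable (lebesgue_on {0..T}) (\<lambda>s. F s (x s)) \<and>
     (\<forall>t\<in>{0..T}. x t = x 0 + (LINT s|lebesgue_on {0..t}. F s (x s)))"

text \<open>Below, \<open>extensional {0..T}\<close> fixes the irrelevant values outside \<open>[0, T]\<close>, so that
  solutions are unique as functions.\<close>

definition state ::
    "real \<Rightarrow> real^'n \<Rightarrow> (real \<Rightarrow> real^'n \<Rightarrow> real^'m \<Rightarrow> real^'n) \<Rightarrow> (real \<Rightarrow> real^'m) \<Rightarrow>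
     real \<Rightarrow> real^'n" where
  "state T x0 b u = (THE x. x \<in> extensional {0..T} \<and>
     solves_ode_on T (\<lambda>t \<xi>. b t \<xi> (u t)) x \<and> x 0 = x0)"

definition cost ::
    "real \<Rightarrow> real^'n \<Rightarrow> (real \<Rightarrow> real^'n \<Rightarrow> real^'m \<Rightarrow> real^'n) \<Rightarrow>
     (real \<Rightarrow> real^'n \<Rightarrow> real^'m \<Rightarrow> real) \<Rightarrow> (real^'n \<Rightarrow> real) \<Rightarrow> (real \<Rightarrow> real^'m) \<Rightarrow> real" where
  "cost T x0 b f g u =
     (LINT t|lebesgue_on {0..T}. f t (state T x0 b u t) (u t)) + g (state T x0 b u T)"

definition adjoint_state ::
    "real \<Rightarrow> real^'n \<Rightarrow> (real \<Rightarrow> real^'n \<Rightarrow> real^'m \<Rightarrow> real^'n) \<Rightarrow>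
     (real \<Rightarrow> real^'n \<Rightarrow> real^'m \<Rightarrow> real) \<Rightarrow> (real^'n \<Rightarrow> real) \<Rightarrow> (real \<Rightarrow> real^'m) \<Rightarrow>
     real \<Rightarrow> real^'n" where
  "adjoint_state T x0 b f g u = (let x = state T x0 b u in
     THE p. p \<in> extensional {0..T} \<and>
       solves_ode_on T (\<lambda>t \<pi>. - (transpose (jacobian (\<lambda>\<xi>. b t \<xi> (u t)) (at (x t))) *v \<pi>)
                              - gradient (\<lambda>\<xi>. f t \<xi> (u t)) (x t)) p \<and>
       p T = gradient g (x T))"

definition linearized_state ::
    "real \<Rightarrow> real^'n \<Rightarrow> (real \<Rightarrow> real^'n \<Rightarrow> real^'m \<Rightarrow> real^'n) \<Rightarrow> (real \<Rightarrow> real^'m) \<Rightarrow>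
     (real \<Rightarrow> real^'m) \<Rightarrow> real \<Rightarrow> real^'n" where
  "linearized_state T x0 b u v = (let x = state T x0 b u in
     THE y. y \<in> extensional {0..T} \<and>
       solves_ode_on T (\<lambda>t \<eta>. jacobian (\<lambda>\<xi>. b t \<xi> (u t)) (at (x t)) *v \<eta>
                             + jacobian (\<lambda>\<upsilon>. b t (x t) \<upsilon>) (at (u t)) *v v t) y \<and>
       y 0 = 0)"

definition hamiltonian ::
    "(real \<Rightarrow> real^'n \<Rightarrow> real^'m \<Rightarrow> real^'n) \<Rightarrow> (real \<Rightarrow> real^'n \<Rightarrow> real^'m \<Rightarrow> real) \<Rightarrow>
     real \<Rightarrow> real^'n \<Rightarrow> real^'m \<Rightarrow> real^'n \<Rightarrow> real" where
  "hamiltonian b f t x u p = b t x u \<bullet> p + f t x u"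

definition hamiltonian_u ::
    "real \<Rightarrow> real^'n \<Rightarrow> (real \<Rightarrow> real^'n \<Rightarrow> real^'m \<Rightarrow> real^'n) \<Rightarrow>
     (real \<Rightarrow> real^'n \<Rightarrow> real^'m \<Rightarrow> real) \<Rightarrow> (real^'n \<Rightarrow> real) \<Rightarrow> (real \<Rightarrow> real^'m) \<Rightarrow>
     real \<Rightarrow> real^'m" where
  "hamiltonian_u T x0 b f g u t =
     gradient (\<lambda>\<upsilon>. hamiltonian b f t (state T x0 b u t) \<upsilon> (adjoint_state T x0 b f g u t)) (u t)"

text \<open>The integrated quadratic form of the Hessian of the Hamiltonian in the joint variable
  \<open>(x, u)\<close>, plus the terminal term, evaluated at \<open>(y, v)\<close> with \<open>y\<close> the linearized state for \<open>v\<close>.\<close>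

definition second_order_form ::
    "real \<Rightarrow> real^'n \<Rightarrow> (real \<Rightarrow> real^'n \<Rightarrow> real^'m \<Rightarrow> real^'n) \<Rightarrow>
     (real \<Rightarrow> real^'n \<Rightarrow> real^'m \<Rightarrow> real) \<Rightarrow> (real^'n \<Rightarrow> real) \<Rightarrow> (real \<Rightarrow> real^'m) \<Rightarrow>
     (real \<Rightarrow> real^'m) \<Rightarrow> real" where
  "second_order_form T x0 b f g u v =
     (let x = state T x0 b u; p = adjoint_state T x0 b f g u; y = linearized_state T x0 b u v in
      (LINT t|lebesgue_on {0..T}.
         second_deriv (\<lambda>(\<xi>, \<upsilon>). hamiltonian b f t \<xi> \<upsilon> (p t)) (x t, u t) (y t, v t) (y t, v t))
      + second_deriv g (x T) (y T) (y T))"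

definition second_order_coercive ::
    "real \<Rightarrow> real^'n \<Rightarrow> (real \<Rightarrow> real^'n \<Rightarrow> real^'m \<Rightarrow> real^'n) \<Rightarrow>
     (real \<Rightarrow> real^'n \<Rightarrow> real^'m \<Rightarrow> real) \<Rightarrow> (real^'n \<Rightarrow> real) \<Rightarrow> (real \<Rightarrow> real^'m) \<Rightarrow>
     real \<Rightarrow> bool" where
  "second_order_coercive T x0 b f g u \<alpha> \<longleftrightarrow>
     (\<forall>v\<in>Lp_space 2 T. second_order_form T x0 b f g u v \<ge> \<alpha> * (Lp_norm 2 T v)\<^sup>2)"

definition optimal_control ::
    "real \<Rightarrow> real^'n \<Rightarrow> (real \<Rightarrow> real^'n \<Rightarrow> real^'m \<Rightarrow> real^'n) \<Rightarrow>
     (real \<Rightarrow> real^'n \<Rightarrow> real^'m \<Rightarrow> real) \<Rightarrow> (real^'n \<Rightarrow> real) \<Rightarrow> (real \<Rightarrow> real^'m) \<Rightarrow> bool" where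
  "optimal_control T x0 b f g u \<longleftrightarrow>
     u \<in> Lp_space 2 T \<and> (\<forall>w\<in>Lp_space 2 T. cost T x0 b f g u \<le> cost T x0 b f g w)"

text \<open>The gradient of a functional on \<open>L\<^sup>2\<close> is the Riesz representative of its Frechet
  derivative. It is determined up to equality almost everywhere on \<open>[0, T]\<close>; for \<open>cost\<close> it is
  represented by \<open>hamiltonian_u\<close>.\<close>

definition has_L2_gradient ::
    "real \<Rightarrow> ((real \<Rightarrow> 'a::euclidean_space) \<Rightarrow> real) \<Rightarrow> (real \<Rightarrow> 'a) \<Rightarrow> (real \<Rightarrow> 'a) \<Rightarrow> bool" where
  "has_L2_gradient T \<Phi> u G \<longleftrightarrow>
     G \<in> Lp_space 2 T \<and>
     (\<forall>\<epsilon>>0. \<exists>\<delta>>0. \<forall>h\<in>Lp_space 2 T. Lp_norm 2 T h \<le> \<delta> \<longrightarrow>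
        \<bar>\<Phi> (\<lambda>t. u t + h t) - \<Phi> u - (LINT t|lebesgue_on {0..T}. G t \<bullet> h t)\<bar>
          \<le> \<epsilon> * Lp_norm 2 T h)"

definition cost_gradient ::
    "real \<Rightarrow> real^'n \<Rightarrow> (real \<Rightarrow> real^'n \<Rightarrow> real^'m \<Rightarrow> real^'n) \<Rightarrow>
     (real \<Rightarrow> real^'n \<Rightarrow> real^'m \<Rightarrow> real) \<Rightarrow> (real^'n \<Rightarrow> real) \<Rightarrow> (real \<Rightarrow> real^'m) \<Rightarrow>
     real \<Rightarrow> real^'m" where
  "cost_gradient T x0 b f g u = (SOME G. has_L2_gradient T (cost T x0 b f g) u G)"


section \<open>Standing assumptions\<close>

definition standing_assumptions ::
    "real \<Rightarrow> real \<Rightarrow> (real \<Rightarrow> real^'n \<Rightarrow> real^'m \<Rightarrow> real^'n) \<Rightarrow>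
     (real \<Rightarrow> real^'n \<Rightarrow> real^'m \<Rightarrow> real) \<Rightarrow> (real^'n \<Rightarrow> real) \<Rightarrow> bool" where
  "standing_assumptions T L b f g \<longleftrightarrow>
     L > 0 \<and>
     (\<lambda>(t, x, u). b t x u) \<in> borel_measurable (lebesgue_on ({0..T} \<times> UNIV)) \<and>
     (\<lambda>(t, x, u). f t x u) \<in> borel_measurable (lebesgue_on ({0..T} \<times> UNIV)) \<and>
     g \<in> borel_measurable lebesgue \<and>
     (\<forall>t\<in>{0..T}. twice_differentiable (\<lambda>(x, u). b t x u)) \<and>
     (\<forall>t\<in>{0..T}. twice_differentiable (\<lambda>(x, u). f t x u)) \<and>
     twice_differentiable g \<and>
     (\<forall>t\<in>{0..T}. \<forall>x u. norm (b t x u) \<le> L * (norm x + norm u + 1)) \<and>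
     (\<forall>t\<in>{0..T}. \<forall>x u.
        norm (jacobian (\<lambda>\<xi>. b t \<xi> u) (at x)) + norm (jacobian (\<lambda>\<upsilon>. b t x \<upsilon>) (at u)) \<le> L) \<and>
     (\<forall>t\<in>{0..T}. \<forall>x u. array_norm (second_deriv (\<lambda>(\<xi>, \<upsilon>). b t \<xi> \<upsilon>) (x, u)) \<le> L) \<and>
     (\<forall>t\<in>{0..T}. \<forall>x x' u u'.
        array_norm (\<lambda>h k. second_deriv (\<lambda>(\<xi>, \<upsilon>). b t \<xi> \<upsilon>) (x, u) h k
                        - second_deriv (\<lambda>(\<xi>, \<upsilon>). b t \<xi> \<upsilon>) (x', u') h k)
          \<le> L * (norm (x - x') + norm (u - u'))) \<and>
     (\<forall>t\<in>{0..T}. \<forall>x u. \<bar>f t x u\<bar> \<le> L * ((norm x)\<^sup>2 + (norm u)\<^sup>2 + 1)) \<and>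
     (\<forall>t\<in>{0..T}. \<forall>x u.
        norm (gradient (\<lambda>\<xi>. f t \<xi> u) x) + norm (gradient (\<lambda>\<upsilon>. f t x \<upsilon>) u)
          \<le> L * (norm x + norm u + 1)) \<and>
     (\<forall>t\<in>{0..T}. \<forall>x u. array_norm (second_deriv (\<lambda>(\<xi>, \<upsilon>). f t \<xi> \<upsilon>) (x, u)) \<le> L) \<and>
     (\<forall>t\<in>{0..T}. \<forall>x x' u u'.
        array_norm (\<lambda>h k. second_deriv (\<lambda>(\<xi>, \<upsilon>). f t \<xi> \<upsilon>) (x, u) h k
                        - second_deriv (\<lambda>(\<xi>, \<upsilon>). f t \<xi> \<upsilon>) (x', u') h k)
          \<le> L * (norm (x - x') + norm (u - u'))) \<and>
     (\<forall>x. \<bar>g x\<bar> \<le> L * ((norm x)\<^sup>2 + 1)) \<and>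
     (\<forall>x. norm (gradient g x) \<le> L * (norm x + 1)) \<and>
     (\<forall>x. array_norm (second_deriv g x) \<le> L) \<and>
     (\<forall>x x'. array_norm (\<lambda>h k. second_deriv g x h k - second_deriv g x' h k)
                \<le> L * norm (x - x'))"

definition uu_derivative_independent_of_u ::
    "real \<Rightarrow> (real \<Rightarrow> real^'n \<Rightarrow> real^'m \<Rightarrow> 'b::real_normed_vector) \<Rightarrow> bool" where
  "uu_derivative_independent_of_u T \<phi> \<longleftrightarrow>
     (\<forall>t\<in>{0..T}. \<forall>x u u'. second_deriv (\<lambda>\<upsilon>. \<phi> t x \<upsilon>) u = second_deriv (\<lambda>\<upsilon>. \<phi> t x \<upsilon>) u')"


section \<open>Newton's iteration\<close>

definition newton_objective ::
    "real \<Rightarrow> real^'n \<Rightarrow> (real \<Rightarrow> real^'n \<Rightarrow> real^'m \<Rightarrow> real^'n) \<Rightarrow>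
     (real \<Rightarrow> real^'n \<Rightarrow> real^'m \<Rightarrow> real) \<Rightarrow> (real^'n \<Rightarrow> real) \<Rightarrow> (real \<Rightarrow> real^'m) \<Rightarrow>
     (real \<Rightarrow> real^'m) \<Rightarrow> real" where
  "newton_objective T x0 b f g u v =
     (let x = state T x0 b u; p = adjoint_state T x0 b f g u; y = linearized_state T x0 b u v in
      1 / 2 * (LINT t|lebesgue_on {0..T}.
         2 * (hamiltonian_u T x0 b f g u t \<bullet> v t)
         + second_deriv (\<lambda>(\<xi>, \<upsilon>). hamiltonian b f t \<xi> \<upsilon> (p t)) (x t, u t) (y t, v t) (y t, v t))
      + 1 / 2 * second_deriv g (x T) (y T) (y T))"

text \<open>\<open>v\<close> is the solution of the quadratic subproblem at \<open>u\<close>: a minimizer, unique as an element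
  of \<open>L\<^sup>2\<close>.\<close>

definition newton_direction ::
    "real \<Rightarrow> real^'n \<Rightarrow> (real \<Rightarrow> real^'n \<Rightarrow> real^'m \<Rightarrow> real^'n) \<Rightarrow>
     (real \<Rightarrow> real^'n \<Rightarrow> real^'m \<Rightarrow> real) \<Rightarrow> (real^'n \<Rightarrow> real) \<Rightarrow> (real \<Rightarrow> real^'m) \<Rightarrow>
     (real \<Rightarrow> real^'m) \<Rightarrow> bool" where
  "newton_direction T x0 b f g u v \<longleftrightarrow>
     v \<in> Lp_space 2 T \<and>
     (\<forall>w\<in>Lp_space 2 T. newton_objective T x0 b f g u v \<le> newton_objective T x0 b f g u w \<and>
        (newton_objective T x0 b f g u w = newton_objective T x0 b f g u v \<longrightarrow>
           (AE t in lebesgue_on {0..T}. w t = v t)))"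

text \<open>Both stopping tests depend only on the current iterate, so once the iteration stops the
  sequence is constant from then on.\<close>

definition newton_sequence ::
    "real \<Rightarrow> real^'n \<Rightarrow> (real \<Rightarrow> real^'n \<Rightarrow> real^'m \<Rightarrow> real^'n) \<Rightarrow>
     (real \<Rightarrow> real^'n \<Rightarrow> real^'m \<Rightarrow> real) \<Rightarrow> (real^'n \<Rightarrow> real) \<Rightarrow> (real \<Rightarrow> real^'m) \<Rightarrow>
     (nat \<Rightarrow> real \<Rightarrow> real^'m) \<Rightarrow> bool" where
  "newton_sequence T x0 b f g u0 us \<longleftrightarrow>
     us 0 = u0 \<and>
     (\<forall>k. if AE t in lebesgue_on {0..T}. hamiltonian_u T x0 b f g (us k) t = 0
          then us (Suc k) = us k
          else \<exists>v. newton_direction T x0 b f g (us k) v \<and>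
                   us (Suc k) = (if AE t in lebesgue_on {0..T}. v t = 0 then us k
                                 else (\<lambda>t. us k t + v t)))"


section \<open>Constants\<close>

text \<open>The last argument is the norm of the initial state.\<close>

definition C_x :: "real \<Rightarrow> real \<Rightarrow> real \<Rightarrow> real" where
  "C_x T L \<rho> = max (exp (L * T) * (\<rho> + L * T)) (L * exp (L * T))"

definition K_p :: "real \<Rightarrow> real \<Rightarrow> real \<Rightarrow> real" where
  "K_p T L \<rho> = L * exp (L * T) * (1 + C_x T L \<rho>) * (T + 1)"

definition C_p :: "real \<Rightarrow> real \<Rightarrow> real \<Rightarrow> real" where
  "C_p T L \<rho> = max (K_p T L \<rho>)
     (L * exp (L * T) * (C_x T L \<rho> + (C_x T L \<rho> * T + 1) * (1 + K_p T L \<rho>)))"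

definition C_H :: "real \<Rightarrow> real \<Rightarrow> real \<Rightarrow> real" where
  "C_H T L \<rho> = max (L * (C_p T L \<rho> + C_x T L \<rho> + C_p T L \<rho> * C_x T L \<rho>))
     (L * (1 + C_p T L \<rho>))"

definition C_1 :: "real \<Rightarrow> real \<Rightarrow> real \<Rightarrow> real" where
  "C_1 T L \<rho> = Max {C_x T L \<rho>, C_p T L \<rho>, C_H T L \<rho>}"

definition C_y :: "real \<Rightarrow> real \<Rightarrow> real \<Rightarrow> real" where
  "C_y T L \<rho> = L * exp (L * T) *
     ((C_1 T L \<rho> + L * exp (L * T) + C_1 T L \<rho> * L * T * exp (L * T)) * T + 1)"

definition K_psi :: "real \<Rightarrow> real \<Rightarrow> real \<Rightarrow> real" where
  "K_psi T L \<rho> = exp (L * T) * (L * C_y T L \<rho> + C_1 T L \<rho> * (C_y T L \<rho> * T + 1))"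

definition C_psi :: "real \<Rightarrow> real \<Rightarrow> real \<Rightarrow> real" where
  "C_psi T L \<rho> = max (K_psi T L \<rho>)
     (exp (L * T) * (L * C_y T L \<rho> * (C_1 T L \<rho> * T + 1)
        + L * K_psi T L \<rho> * T * (C_1 T L \<rho> * T + 1)
        + C_1 T L \<rho> * (C_y T L \<rho> * T\<^sup>2 + 2 * C_y T L \<rho> * T + T + 1)))"

definition C_2 :: "real \<Rightarrow> real \<Rightarrow> real \<Rightarrow> real" where
  "C_2 T L \<rho> = max (C_y T L \<rho>) (C_psi T L \<rho>)"

definition C_4 :: "real \<Rightarrow> real \<Rightarrow> real \<Rightarrow> real" where
  "C_4 T L \<rho> = sqrt T *
     (C_2 T L \<rho> * (L * (C_1 T L \<rho> * T + 2) + C_1 T L \<rho> * (T + 2)) + C_1 T L \<rho>)"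

definition r_4 :: "real \<Rightarrow> real \<Rightarrow> real \<Rightarrow> real \<Rightarrow> (real \<Rightarrow> real^'m) \<Rightarrow> real" where
  "r_4 T L \<rho> \<alpha> u = (let C4 = C_4 T L \<rho> in
     (sqrt (C4\<^sup>2 * (1 + Lp_norm 1 T u)\<^sup>2 + C4 * sqrt T * \<alpha>) - C4 * (1 + Lp_norm 1 T u))
       / (C4 * sqrt T))"

end

theory Submission
  imports Defs
begin

text \<open>Let \<open>DJ\<close> be the derivative of the cost, tested against a control, and let \<open>B u\<close> be the symmetric
  bilinear form of the coercivity condition, taken at an arbitrary control \<open>u\<close>. Gronwall's inequality
  for the state, the adjoint and the linearized state shows that
  \<open>B u v w - B ubar v w\<close> is at most \<open>C\<^sub>4 (1 + norm\<^sub>1 ubar)\<close> times the product of the \<open>L\<^sup>2\<close> norms of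
  \<open>u - ubar\<close>, \<open>v\<close> and \<open>w\<close>; this is where \<open>f\<^sub>u\<^sub>u\<close> and \<open>b\<^sub>u\<^sub>u\<close> must not depend on \<open>u\<close>. Hence \<open>B u\<close> stays
  coercive near \<open>ubar\<close> and the Newton direction \<open>v\<close> exists and solves \<open>DJ u + B u v = 0\<close>. A third order
  expansion of the cost shows that \<open>B\<close> is the derivative of \<open>DJ\<close> along lines, so that by the mean value
  inequality \<open>DJ u - DJ ubar - B u (u - ubar)\<close> is quadratically small. Up to sign this is \<open>B u\<close> applied
  to the error \<open>u + v - ubar\<close> of the next iterate, which coercivity bounds by the square of the old error.
  The radius \<open>r\<^sub>4\<close> is the positive root of \<open>2 C\<^sub>4 (1 + norm\<^sub>1 ubar) r + C\<^sub>4 \<surd>T r\<^sup>2 = \<alpha>\<close>, for which the resulting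
  contraction factor is less than one.\<close>

section \<open>Integrals and primitives on an interval\<close>

text \<open>The obstacle is the norm: a Taylor remainder that is cubic in the pointwise control
  increment \<open>h t\<close> is not controlled by the \<open>L2\<close> norm of \<open>h\<close>,
  so a functional of this kind is in general not twice differentiable on \<open>L2\<close>. If the
  second derivatives in the control alone do not depend on the control, every term of the remainder
  carries a factor from the state increment, which Gronwall's inequality bounds uniformly in time,
  and at most two pointwise factors of \<open>h\<close> are left to integrate. The factor
  \<open>1 + nrm1\<close> of the base control has another origin: \<open>f_x\<close> and
  \<open>g_x\<close> grow linearly, so the bound for the adjoint, and with it that for the Hessian
  of the Hamiltonian, grows with the control. Reading off the derivative of \<open>DJ\<close> from
  expansions of the cost at two base points avoids linearizing the adjoint equation. The radius
  comes from coercivity and the Lipschitz estimate for \<open>B\<close>; the constants of the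
  expansions serve to identify derivatives and may be crude.\<close>

abbreviation leb :: "real \<Rightarrow> real measure" where
  "leb T \<equiv> lebesgue_on {0..T}"

lemma finite_measure_leb: "finite_measure (leb T)"
  by (intro finite_measure_lebesgue_on) simp

lemma measure_leb: "0 \<le> T \<Longrightarrow> measure (leb T) {0..T} = T"
  by (simp add: measure_restrict_space)

lemma integrable_const_leb [simp]: "integrable (leb T) (\<lambda>t. c)"
  using finite_measure.integrable_const[OF finite_measure_leb] by blast

lemma integrable_lebesgue_on_subset:
  fixes h :: "real \<Rightarrow> 'a::euclidean_space"
  assumes "integrable (lebesgue_on A) h" "S \<subseteq> A" "S \<in> sets lebesgue" "A \<in> sets lebesgue"
  shows "integrable (lebesgue_on S) h"
proof -
  have "integrable lebesgue (\<lambda>x. if x \<in> A then h x else 0)"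
    using Lebesgue_Measure.integrable_restrict_UNIV[OF assms(4)] assms(1) by blast
  then have "integrable lebesgue (\<lambda>x. indicat_real S x *\<^sub>R (if x \<in> A then h x else 0))"
    using assms by (intro integrable_mult_indicator) auto
  also have "(\<lambda>x. indicat_real S x *\<^sub>R (if x \<in> A then h x else 0)) = (\<lambda>x. if x \<in> S then h x else 0)"
    using assms(2) by (auto simp: fun_eq_iff indicator_def)
  finally show ?thesis using Lebesgue_Measure.integrable_restrict_UNIV[OF assms(3)] by blast
qed

lemma integral_lebesgue_on_mono_set:
  fixes h :: "real \<Rightarrow> real"
  assumes "integrable (lebesgue_on A) h" "S \<subseteq> A" "S \<in> sets lebesgue" "A \<in> sets lebesgue"
    "\<And>t. t \<in> A \<Longrightarrow> 0 \<le> h t"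
  shows "(LINT t|lebesgue_on S. h t) \<le> (LINT t|lebesgue_on A. h t)"
  using assms by (intro integral_mono_lebesgue_on_AE) (auto intro!: AE_I2)

lemma continuous_measurable_leb:
  "continuous_on {0..T} x \<Longrightarrow> x \<in> borel_measurable (leb T)"
  by (rule continuous_imp_measurable_on_sets_lebesgue) auto

lemma integrable_leb_continuous:
  fixes x :: "real \<Rightarrow> 'a::euclidean_space"
  assumes "continuous_on {0..T} x" shows "integrable (leb T) x"
proof -
  have "bounded (x ` {0..T})"
    using assms compact_continuous_image compact_imp_bounded by blast
  then obtain B where B: "\<And>t. t \<in> {0..T} \<Longrightarrow> norm (x t) \<le> B" unfolding bounded_iff by (metis imageI)
  show ?thesis
    by (rule finite_measure.integrable_const_bound[OF finite_measure_leb, of _ B])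
      (use B assms in \<open>auto intro!: AE_I2 continuous_measurable_leb\<close>)
qed

lemma integral_split_leb:
  fixes h :: "real \<Rightarrow> 'a::euclidean_space"
  assumes h: "integrable (leb T) h" and st: "0 \<le> s" "s \<le> t" "t \<le> T"
  shows "(LINT r|leb t. h r) = (LINT r|leb s. h r) + (LINT r|lebesgue_on {s..t}. h r)"
proof -
  have i: "integrable (lebesgue_on S) h" if "S \<subseteq> {0..T}" "S \<in> sets lebesgue" for S
    using integrable_lebesgue_on_subset[OF h that] by simp
  have "h integrable_on {0..t}"
    using st by (intro integrable_on_lebesgue_on i) auto
  then show ?thesis
    using st by (simp add: lebesgue_integral_eq_integral i Henstock_Kurzweil_Integration.integral_combine)
qed

text \<open>Absolute continuity with the density as an explicit argument.
  \<open>solves_ode_on\<close> ties the density to the solution; here a difference of solutions of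
  different equations is again an instance, and such differences are what Gronwall's inequality is
  applied to.\<close>

definition primitive_on :: "real \<Rightarrow> (real \<Rightarrow> 'a::euclidean_space) \<Rightarrow> (real \<Rightarrow> 'a) \<Rightarrow> bool" where
  "primitive_on T \<phi> d \<longleftrightarrow> integrable (leb T) \<phi> \<and> (\<forall>t\<in>{0..T}. d t = d 0 + (LINT s|leb t. \<phi> s))"

lemma primitive_onD:
  assumes "primitive_on T \<phi> d"
  shows "integrable (leb T) \<phi>" "t \<in> {0..T} \<Longrightarrow> d t = d 0 + (LINT s|leb t. \<phi> s)"
  using assms unfolding primitive_on_def by blast+

lemma solves_ode_on_primitive: "solves_ode_on T F x \<longleftrightarrow> primitive_on T (\<lambda>s. F s (x s)) x"
  unfolding solves_ode_on_def primitive_on_def by simp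

lemma primitive_on_increment:
  assumes "primitive_on T \<phi> d" "0 \<le> s" "s \<le> t" "t \<le> T"
  shows "d t - d s = (LINT r|lebesgue_on {s..t}. \<phi> r)"
proof -
  have "d t = d 0 + (LINT r|leb t. \<phi> r)" "d s = d 0 + (LINT r|leb s. \<phi> r)"
    using assms by (auto intro!: primitive_onD)
  then show ?thesis
    using integral_split_leb[OF primitive_onD(1)[OF assms(1)] assms(2-)] by simp
qed

lemma primitive_on_continuous:
  assumes "primitive_on T \<phi> d" shows "continuous_on {0..T} d"
proof -
  have "continuous_on {0..T} (\<lambda>t. d 0 + (LINT s|leb t. \<phi> s))"
    using assms by (intro continuous_intros indefinite_integral_continuous_real primitive_onD)
  then show ?thesis
    by (rule continuous_on_eq) (rule primitive_onD(2)[OF assms, symmetric])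
qed

lemma primitive_on_cong:
  assumes "primitive_on T \<phi> d" "\<And>t. t \<in> {0..T} \<Longrightarrow> \<phi> t = \<psi> t" "\<And>t. t \<in> {0..T} \<Longrightarrow> d t = e t" "0 \<le> T"
  shows "primitive_on T \<psi> e"
proof -
  have "integrable (leb T) \<psi> \<longleftrightarrow> integrable (leb T) \<phi>"
    using assms by (intro Bochner_Integration.integrable_cong) auto
  moreover have "(LINT s|leb t. \<psi> s) = (LINT s|leb t. \<phi> s)" if "t \<in> {0..T}" for t
    using assms that by (intro Bochner_Integration.integral_cong) auto
  moreover have "e t = e 0 + (LINT s|leb t. \<phi> s)" if "t \<in> {0..T}" for t
    using primitive_onD(2)[OF assms(1) that] assms(3)[OF that] assms(3)[of 0] assms(4) by simp
  ultimately show ?thesis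
    using primitive_onD(1)[OF assms(1)] unfolding primitive_on_def by metis
qed

lemma integrable_leb_subset:
  fixes h :: "real \<Rightarrow> 'a::euclidean_space"
  shows "integrable (leb T) h \<Longrightarrow> t \<le> T \<Longrightarrow> integrable (leb t) h"
  by (rule integrable_lebesgue_on_subset) auto

lemma primitive_on_add:
  assumes "primitive_on T \<phi> d" "primitive_on T \<psi> e"
  shows "primitive_on T (\<lambda>t. \<phi> t + \<psi> t) (\<lambda>t. d t + e t)"
  unfolding primitive_on_def
proof (intro conjI ballI)
  show "integrable (leb T) (\<lambda>t. \<phi> t + \<psi> t)" using assms by (auto dest: primitive_onD(1))
  fix t assume t: "t \<in> {0..T}"
  have "integrable (leb t) \<phi>" "integrable (leb t) \<psi>"
    using t integrable_leb_subset[OF primitive_onD(1)[OF assms(1)], of t]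
      integrable_leb_subset[OF primitive_onD(1)[OF assms(2)], of t] by auto
  with primitive_onD(2)[OF assms(1) t] primitive_onD(2)[OF assms(2) t]
  show "d t + e t = d 0 + e 0 + (LINT s|leb t. \<phi> s + \<psi> s)"
    by simp
qed

lemma primitive_on_scale:
  assumes "primitive_on T \<phi> d"
  shows "primitive_on T (\<lambda>t. c *\<^sub>R \<phi> t) (\<lambda>t. c *\<^sub>R d t)"
  unfolding primitive_on_def
proof (intro conjI ballI)
  show "integrable (leb T) (\<lambda>t. c *\<^sub>R \<phi> t)" using assms by (auto dest: primitive_onD(1))
  fix t assume "t \<in> {0..T}"
  then have "d t = d 0 + (LINT s|leb t. \<phi> s)" by (rule primitive_onD(2)[OF assms])
  then have "c *\<^sub>R d t = c *\<^sub>R (d 0 + (LINT s|leb t. \<phi> s))" by (rule arg_cong)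
  then show "c *\<^sub>R d t = c *\<^sub>R d 0 + (LINT s|leb t. c *\<^sub>R \<phi> s)"
    by (simp add: scaleR_add_right)
qed

lemma primitive_on_diff:
  assumes "primitive_on T \<phi> d" "primitive_on T \<psi> e"
  shows "primitive_on T (\<lambda>t. \<phi> t - \<psi> t) (\<lambda>t. d t - e t)"
  using primitive_on_add[OF assms(1) primitive_on_scale[OF assms(2), of "-1"]] by simp

text \<open>The densities are merely integrable, so the product rule for differentiable functions is
  not at hand. Instead \<open>F\<close>, the product minus the integral of its formal derivative, is
  compared with the integral \<open>G\<close> of \<open>norm (\<phi> t) + norm (\<psi> t)\<close>:
  on short intervals the increment of \<open>F\<close> is at most \<open>\<epsilon>\<close> times
  that of \<open>G\<close>, and telescoping over a uniform partition forces
  \<open>F T = F 0\<close>.\<close>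

lemma primitive_on_by_parts:
  fixes p x :: "real \<Rightarrow> 'a::euclidean_space"
  assumes p: "primitive_on T \<phi> p" and x: "primitive_on T \<psi> x" and T: "0 < T"
  shows "integrable (leb T) (\<lambda>t. \<phi> t \<bullet> x t)" "integrable (leb T) (\<lambda>t. p t \<bullet> \<psi> t)"
    and "(LINT t|leb T. \<phi> t \<bullet> x t) + (LINT t|leb T. p t \<bullet> \<psi> t) = p T \<bullet> x T - p 0 \<bullet> x 0"
proof -
  have cp: "continuous_on {0..T} p" and cx: "continuous_on {0..T} x"
    using p x primitive_on_continuous by blast+
  have i\<phi>: "integrable (leb T) \<phi>" and i\<psi>: "integrable (leb T) \<psi>"
    using p x by (auto dest: primitive_onD(1))
  have *: "integrable (leb T) (\<lambda>t. k t \<bullet> z t)"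
    if k: "integrable (leb T) k" and z: "continuous_on {0..T} z" for k z :: "real \<Rightarrow> 'a"
  proof -
    have "bounded (z ` {0..T})"
      using z compact_continuous_image compact_imp_bounded by blast
    then obtain B where B: "\<And>t. t \<in> {0..T} \<Longrightarrow> norm (z t) \<le> B" unfolding bounded_iff by (metis imageI)
    have [measurable]: "k \<in> borel_measurable (leb T)" "z \<in> borel_measurable (leb T)"
      using k z by (auto intro: continuous_measurable_leb)
    have le: "norm (k t \<bullet> z t) \<le> norm (B * norm (k t))" if "t \<in> {0..T}" for t
      using Cauchy_Schwarz_ineq2[of "k t" "z t"] mult_left_mono[OF B[OF that], of "norm (k t)"]
      by (simp add: mult.commute abs_mult) (smt (verit) mult_right_mono norm_ge_zero)
    show ?thesis
    proof (rule Bochner_Integration.integrable_bound)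
      show "integrable (leb T) (\<lambda>t. B * norm (k t))" using k by simp
      show "AE t in leb T. norm (k t \<bullet> z t) \<le> norm (B * norm (k t))"
        by (rule AE_I2) (use le in simp)
    qed measurable
  qed
  show 1: "integrable (leb T) (\<lambda>t. \<phi> t \<bullet> x t)" by (rule *[OF i\<phi> cx])
  have "integrable (leb T) (\<lambda>t. \<psi> t \<bullet> p t)" by (rule *[OF i\<psi> cp])
  then show 2: "integrable (leb T) (\<lambda>t. p t \<bullet> \<psi> t)" by (simp add: inner_commute)
  define h where "h = (\<lambda>t. \<phi> t \<bullet> x t + p t \<bullet> \<psi> t)"
  have ih: "integrable (leb T) h" using 1 2 by (simp add: h_def)
  define k where "k = (\<lambda>t. norm (\<phi> t) + norm (\<psi> t))"
  have ik: "integrable (leb T) k" using i\<phi> i\<psi> by (simp add: k_def)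
  define F where "F = (\<lambda>t. p t \<bullet> x t - (LINT s|leb t. h s))"
  define G where "G = (\<lambda>t. LINT s|leb t. k s)"
  have sub: "integrable (lebesgue_on {s..t}) q" if "integrable (leb T) q" "0 \<le> s" "t \<le> T"
    for q :: "real \<Rightarrow> 'b::euclidean_space" and s t
    using that by (intro integrable_lebesgue_on_subset[OF that(1)]) auto
  have main: "norm (F T - F 0) \<le> \<epsilon> * (LINT t|leb T. k t)" if \<epsilon>: "\<epsilon> > 0" for \<epsilon>
  proof -
    have "uniformly_continuous_on {0..T} p" "uniformly_continuous_on {0..T} x"
      using cp cx by (auto intro!: compact_uniformly_continuous)
    then obtain d1 d2 where d: "d1 > 0" "d2 > 0"
      and d1: "\<And>s t. s \<in> {0..T} \<Longrightarrow> t \<in> {0..T} \<Longrightarrow> dist s t < d1 \<Longrightarrow> dist (p s) (p t) < \<epsilon>"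
      and d2: "\<And>s t. s \<in> {0..T} \<Longrightarrow> t \<in> {0..T} \<Longrightarrow> dist s t < d2 \<Longrightarrow> dist (x s) (x t) < \<epsilon>"
      using \<epsilon> unfolding uniformly_continuous_on_def by metis
    have inc: "norm (F t - F s) \<le> \<epsilon> * (G t - G s)"
      if st: "0 \<le> s" "s \<le> t" "t \<le> T" and small: "t - s < min d1 d2" for s t
    proof -
      let ?M = "lebesgue_on {s..t}"
      have i: "integrable ?M \<phi>" "integrable ?M \<psi>" "integrable ?M h" "integrable ?M k"
        using i\<phi> i\<psi> ih ik st by (auto intro!: sub)
      \<comment> \<open>Freezing \<open>x\<close> at the right end and \<open>p\<close> at the left
        end makes the increment of the product exact, without a product of two increments.\<close>
      have "p t \<bullet> x t - p s \<bullet> x s = (p t - p s) \<bullet> x t + p s \<bullet> (x t - x s)"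
        by (simp add: inner_diff_left inner_diff_right)
      also have "\<dots> = (LINT r|?M. \<phi> r) \<bullet> x t + p s \<bullet> (LINT r|?M. \<psi> r)"
        using p x st by (simp add: primitive_on_increment)
      also have "\<dots> = (LINT r|?M. \<phi> r \<bullet> x t + p s \<bullet> \<psi> r)"
        using i by simp
      finally have "F t - F s = (LINT r|?M. (\<phi> r \<bullet> x t + p s \<bullet> \<psi> r) - h r)"
        using i integral_split_leb[OF ih st] by (simp add: F_def)
      also have "norm \<dots> \<le> (LINT r|?M. \<epsilon> * k r)"
      proof (rule Bochner_Integration.integral_norm_bound_integral)
        fix r assume "r \<in> space ?M"
        then have r: "r \<in> {s..t}" by simp
        then have "norm (x t - x r) \<le> \<epsilon>" "norm (p s - p r) \<le> \<epsilon>"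
          using d1[of s r] d2[of t r] st small by (auto simp: dist_norm)
        then have "\<bar>\<phi> r \<bullet> (x t - x r)\<bar> \<le> norm (\<phi> r) * \<epsilon>" "\<bar>(p s - p r) \<bullet> \<psi> r\<bar> \<le> \<epsilon> * norm (\<psi> r)"
          using Cauchy_Schwarz_ineq2[of "\<phi> r" "x t - x r"] Cauchy_Schwarz_ineq2[of "p s - p r" "\<psi> r"]
          by (meson mult_left_mono mult_right_mono norm_ge_zero order_trans)+
        then show "norm ((\<phi> r \<bullet> x t + p s \<bullet> \<psi> r) - h r) \<le> \<epsilon> * k r"
          by (simp add: h_def k_def algebra_simps)
      qed (use i in auto)
      also have "\<dots> = \<epsilon> * (G t - G s)"
        using integral_split_leb[OF ik st] by (simp add: G_def)
      finally show ?thesis .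
    qed
    obtain n :: nat where n: "T / min d1 d2 < real n" using reals_Archimedean2 by blast
    have "0 < T / min d1 d2" using T d by simp
    then have n0: "0 < real n" using n by linarith
    have nT: "T / real n < min d1 d2"
      using n n0 d by (simp add: pos_divide_less_eq mult.commute del: min_less_iff_conj)
    define \<tau> where "\<tau> = (\<lambda>i::nat. real i * (T / real n))"
    have step: "norm (F (\<tau> (Suc i)) - F (\<tau> i)) \<le> \<epsilon> * (G (\<tau> (Suc i)) - G (\<tau> i))" if "i < n" for i
    proof (rule inc)
      show "0 \<le> \<tau> i" "\<tau> i \<le> \<tau> (Suc i)" using T n0 by (auto simp: \<tau>_def intro!: divide_right_mono mult_right_mono)
      have "real (Suc i) * (T / real n) \<le> real n * (T / real n)"
        using that T n0 by (intro mult_right_mono) auto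
      then show "\<tau> (Suc i) \<le> T" using n0 by (simp add: \<tau>_def)
      have "\<tau> (Suc i) - \<tau> i = T / real n" unfolding \<tau>_def of_nat_Suc distrib_right by simp
      then show "\<tau> (Suc i) - \<tau> i < min d1 d2" using nT by simp
    qed
    have "F (\<tau> n) - F (\<tau> 0) = (\<Sum>i<n. F (\<tau> (Suc i)) - F (\<tau> i))"
      by (rule sum_lessThan_telescope[of "\<lambda>i. F (\<tau> i)" n, symmetric])
    also have "norm \<dots> \<le> (\<Sum>i<n. \<epsilon> * (G (\<tau> (Suc i)) - G (\<tau> i)))"
      by (rule sum_norm_le) (use step in auto)
    also have "\<dots> = \<epsilon> * (G (\<tau> n) - G (\<tau> 0))"
      by (simp only: sum_distrib_left[symmetric] sum_lessThan_telescope[of "\<lambda>i. G (\<tau> i)" n])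
    finally have "norm (F T - F 0) \<le> \<epsilon> * (G T - G 0)" using n0 by (simp add: \<tau>_def)
    moreover have "G 0 = 0" unfolding G_def by (rule integral_eq_zero_null_sets) simp
    ultimately show ?thesis by (simp add: G_def)
  qed
  have "norm (F T - F 0) \<le> 0 + e" if "e > 0" for e
  proof -
    define I where "I = (LINT t|leb T. k t)"
    have "0 \<le> I" unfolding I_def by (rule integral_nonneg_AE) (simp add: k_def)
    \<comment> \<open>The denominator \<open>1 + I\<close> covers the case that \<open>I\<close> is
      zero.\<close>
    then have "norm (F T - F 0) \<le> (e / (1 + I)) * I" using main[of "e / (1 + I)"] that by (simp add: I_def)
    also have "\<dots> \<le> e" using that \<open>0 \<le> I\<close> by (simp add: field_simps)
    finally show ?thesis by simp
  qed
  then have "norm (F T - F 0) \<le> 0" by (rule field_le_epsilon)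
  moreover have "(LINT s|leb 0. h s) = 0" by (rule integral_eq_zero_null_sets) simp
  ultimately have "p T \<bullet> x T - p 0 \<bullet> x 0 = (LINT s|leb T. h s)" by (simp add: F_def)
  then show "(LINT t|leb T. \<phi> t \<bullet> x t) + (LINT t|leb T. p t \<bullet> \<psi> t) = p T \<bullet> x T - p 0 \<bullet> x 0"
    using Bochner_Integration.integral_add[OF 1 2] by (simp add: h_def)
qed

section \<open>Gronwall's inequality and Caratheodory differential equations\<close>

text \<open>The sets \<open>S t = [0, t]\<close> and \<open>S t = [t, T]\<close> serve initial and terminal value problems.\<close>

definition exp_kernel :: "real \<Rightarrow> real \<Rightarrow> (real \<Rightarrow> real set) \<Rightarrow> (real \<Rightarrow> real) \<Rightarrow> bool" where
  "exp_kernel T L S \<omega> \<longleftrightarrow> continuous_on {0..T} \<omega> \<and>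
     (\<forall>t\<in>{0..T}. 1 \<le> \<omega> t \<and> S t \<subseteq> {0..T} \<and> S t \<in> sets lebesgue \<and>
        (LINT s|lebesgue_on (S t). L * \<omega> s) = \<omega> t - 1)"

lemma exp_kernelD:
  assumes "exp_kernel T L S \<omega>"
  shows "continuous_on {0..T} \<omega>"
    and "t \<in> {0..T} \<Longrightarrow> 1 \<le> \<omega> t"
    and "t \<in> {0..T} \<Longrightarrow> S t \<subseteq> {0..T}"
    and "t \<in> {0..T} \<Longrightarrow> S t \<in> sets lebesgue"
    and "t \<in> {0..T} \<Longrightarrow> (LINT s|lebesgue_on (S t). L * \<omega> s) = \<omega> t - 1"
  using assms by (auto simp: exp_kernel_def)

lemma LINT_eq_FTC:
  fixes W w :: "real \<Rightarrow> real"
  assumes "a \<le> b" "\<And>s. s \<in> {a..b} \<Longrightarrow> (W has_vector_derivative w s) (at s within {a..b})"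
    "continuous_on {a..b} w"
  shows "(LINT s|lebesgue_on {a..b}. w s) = W b - W a"
proof -
  have "(w has_integral (W b - W a)) {a..b}"
    using assms by (intro fundamental_theorem_of_calculus) auto
  moreover have "integrable (lebesgue_on {a..b}) w"
    using assms(3) by (intro absolutely_integrable_imp_integrable absolutely_integrable_continuous_real) auto
  ultimately show ?thesis
    by (simp add: lebesgue_integral_eq_integral integral_unique)
qed

lemma exp_kernel_forward:
  assumes "0 \<le> L" shows "exp_kernel T L (\<lambda>t. {0..t}) (\<lambda>t. exp (L * t))"
  unfolding exp_kernel_def
proof (intro conjI ballI)
  show "continuous_on {0..T} (\<lambda>t. exp (L * t))" by (intro continuous_intros)
  fix t assume t: "t \<in> {0..T}"
  show "1 \<le> exp (L * t)" using t assms by simp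
  show "{0..t} \<subseteq> {0..T}" "{0..t} \<in> sets lebesgue" using t by auto
  have "(LINT s|lebesgue_on {0..t}. L * exp (L * s)) = exp (L * t) - exp (L * 0)"
    by (rule LINT_eq_FTC)
      (use t in \<open>auto intro!: continuous_intros derivative_eq_intros simp: has_real_derivative_iff_has_vector_derivative[symmetric]\<close>)
  then show "(LINT s|leb t. L * exp (L * s)) = exp (L * t) - 1" by simp
qed

lemma exp_kernel_backward:
  assumes "0 \<le> L" shows "exp_kernel T L (\<lambda>t. {t..T}) (\<lambda>t. exp (L * (T - t)))"
  unfolding exp_kernel_def
proof (intro conjI ballI)
  show "continuous_on {0..T} (\<lambda>t. exp (L * (T - t)))" by (intro continuous_intros)
  fix t assume t: "t \<in> {0..T}"
  show "1 \<le> exp (L * (T - t))" using t assms by simp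
  show "{t..T} \<subseteq> {0..T}" "{t..T} \<in> sets lebesgue" using t by auto
  have "(LINT s|lebesgue_on {t..T}. L * exp (L * (T - s))) = - exp (L * (T - T)) - - exp (L * (T - t))"
    by (rule LINT_eq_FTC)
      (use t in \<open>auto intro!: continuous_intros derivative_eq_intros simp: has_real_derivative_iff_has_vector_derivative[symmetric]\<close>)
  then show "(LINT s|lebesgue_on {t..T}. L * exp (L * (T - s))) = exp (L * (T - t)) - 1" by simp
qed

text \<open>The maximum \<open>M\<close> of \<open>\<phi> / \<omega>\<close> satisfies \<open>M \<omega> \<le> a + M (\<omega> - 1)\<close> where it is attained.\<close>

lemma gronwall_kernel:
  fixes \<phi> :: "real \<Rightarrow> real"
  assumes ker: "exp_kernel T L S \<omega>" and T: "0 \<le> T" and L: "0 \<le> L"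
    and cont: "continuous_on {0..T} \<phi>"
    and le: "\<And>t. t \<in> {0..T} \<Longrightarrow> \<phi> t \<le> a + (LINT s|lebesgue_on (S t). L * \<phi> s)"
    and t: "t \<in> {0..T}"
  shows "\<phi> t \<le> a * \<omega> t"
proof -
  note k = exp_kernelD[OF ker]
  have pos: "0 < \<omega> s" if "s \<in> {0..T}" for s using k(2)[OF that] by simp
  have "continuous_on {0..T} (\<lambda>s. \<phi> s / \<omega> s)"
    using pos by (intro continuous_intros cont k) fastforce
  then obtain m where m: "m \<in> {0..T}" "\<And>s. s \<in> {0..T} \<Longrightarrow> \<phi> s / \<omega> s \<le> \<phi> m / \<omega> m"
    using continuous_attains_sup[of "{0..T}" "\<lambda>s. \<phi> s / \<omega> s"] T by auto
  define M where "M = \<phi> m / \<omega> m"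
  have M: "\<phi> s \<le> M * \<omega> s" if "s \<in> {0..T}" for s
    using m(2)[OF that] pos[OF that] by (simp add: M_def pos_divide_le_eq)
  have i: "integrable (lebesgue_on (S m)) q" if "continuous_on {0..T} q" for q :: "real \<Rightarrow> real"
    using m(1) k by (intro integrable_lebesgue_on_subset[OF integrable_leb_continuous[OF that]]) auto
  have "(LINT s|lebesgue_on (S m). L * \<phi> s) \<le> (LINT s|lebesgue_on (S m). M * (L * \<omega> s))"
  proof (rule Bochner_Integration.integral_mono)
    fix s assume "s \<in> space (lebesgue_on (S m))"
    then have "s \<in> {0..T}" using k(3)[OF m(1)] by auto
    from mult_left_mono[OF M[OF this] L] show "L * \<phi> s \<le> M * (L * \<omega> s)" by (simp add: mult_ac)
  qed (intro i continuous_intros cont k)+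
  also have "\<dots> = M * (\<omega> m - 1)" using k(5)[OF m(1)] by simp
  finally have "\<phi> m \<le> a + M * (\<omega> m - 1)" using le[OF m(1)] by linarith
  moreover have "\<phi> m = M * \<omega> m" using pos[OF m(1)] by (simp add: M_def)
  ultimately have "M \<le> a" by (simp add: algebra_simps)
  then show ?thesis using M[OF t] pos[OF t] by (meson mult_right_mono less_imp_le order_trans)
qed

text \<open>Only the norm of the integral over \<open>S t\<close> enters, so the sign with which it
  occurs in a terminal value problem is immaterial and one argument serves both directions. The
  inhomogeneity \<open>k\<close> is integrated over the whole interval to get a constant independent
  of \<open>t\<close>.\<close>

lemma gronwall_aux:
  fixes d \<phi> :: "real \<Rightarrow> 'a::euclidean_space"
  assumes ker: "exp_kernel T L S \<omega>" and T: "0 \<le> T" and L: "0 \<le> L"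
    and d: "continuous_on {0..T} d" and \<phi>: "integrable (leb T) \<phi>" and k: "integrable (leb T) k"
    and le: "\<And>t. t \<in> {0..T} \<Longrightarrow> norm (\<phi> t) \<le> L * norm (d t) + k t"
    and k0: "\<And>t. t \<in> {0..T} \<Longrightarrow> 0 \<le> k t"
    and eq: "\<And>t. t \<in> {0..T} \<Longrightarrow> norm (d t - z) = norm (LINT s|lebesgue_on (S t). \<phi> s)"
    and w: "\<And>t. t \<in> {0..T} \<Longrightarrow> \<omega> t \<le> exp (L * T)"
    and t: "t \<in> {0..T}"
  shows "norm (d t) \<le> exp (L * T) * (norm z + (LINT t|leb T. k t))"
proof -
  note K = exp_kernelD[OF ker]
  have k1: "0 \<le> (LINT t|leb T. k t)"
    by (rule integral_nonneg_AE) (rule AE_I2, use k0 in simp)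
  have "norm (d t) \<le> (norm z + (LINT t|leb T. k t)) * \<omega> t"
  proof (rule gronwall_kernel[OF ker T L _ _ t])
    show "continuous_on {0..T} (\<lambda>t. norm (d t))" by (intro continuous_intros d)
    fix t assume t: "t \<in> {0..T}"
    let ?M = "lebesgue_on (S t)"
    have i: "integrable ?M \<phi>" "integrable ?M k" "integrable ?M (\<lambda>s. L * norm (d s))"
      using K(3,4)[OF t] \<phi> k
      by (auto intro!: integrable_lebesgue_on_subset[of "{0..T}"] integrable_leb_continuous continuous_intros d)
    have "norm (d t) \<le> norm z + norm (d t - z)" by norm
    also have "norm (d t - z) = norm (LINT s|?M. \<phi> s)" by (rule eq[OF t])
    also have "\<dots> \<le> (LINT s|?M. L * norm (d s) + k s)"
    proof (rule Bochner_Integration.integral_norm_bound_integral)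
      fix s assume "s \<in> space ?M"
      then have "s \<in> {0..T}" using K(3)[OF t] by auto
      then show "norm (\<phi> s) \<le> L * norm (d s) + k s" by (rule le)
    qed (use i in auto)
    also have "\<dots> = (LINT s|?M. L * norm (d s)) + (LINT s|?M. k s)"
      by (rule Bochner_Integration.integral_add) (use i in auto)
    also have "(LINT s|?M. k s) \<le> (LINT t|leb T. k t)"
      by (rule integral_lebesgue_on_mono_set) (use k K(3,4)[OF t] k0 in auto)
    finally show "norm (d t) \<le> norm z + (LINT t|leb T. k t) + (LINT s|?M. L * norm (d s))"
      by simp
  qed
  also have "\<dots> \<le> (norm z + (LINT t|leb T. k t)) * exp (L * T)"
    by (intro mult_left_mono w t) (use k1 in simp)
  finally show ?thesis by (simp add: mult.commute)
qed

lemma gronwall_forward: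
  fixes d \<phi> :: "real \<Rightarrow> 'a::euclidean_space"
  assumes d: "primitive_on T \<phi> d" and T: "0 \<le> T" and L: "0 \<le> L" and k: "integrable (leb T) k"
    and le: "\<And>t. t \<in> {0..T} \<Longrightarrow> norm (\<phi> t) \<le> L * norm (d t) + k t"
    and k0: "\<And>t. t \<in> {0..T} \<Longrightarrow> 0 \<le> k t"
    and t: "t \<in> {0..T}"
  shows "norm (d t) \<le> exp (L * T) * (norm (d 0) + (LINT t|leb T. k t))"
proof (rule gronwall_aux[OF exp_kernel_forward[OF L] T L _ _ k le k0 _ _ t])
  show "continuous_on {0..T} d" using d by (rule primitive_on_continuous)
  show "integrable (leb T) \<phi>" using d by (rule primitive_onD)
  fix t assume t: "t \<in> {0..T}"
  show "norm (d t - d 0) = norm (LINT s|leb t. \<phi> s)" using primitive_onD(2)[OF d t] by simp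
  show "exp (L * t) \<le> exp (L * T)" using t L by (auto intro: mult_left_mono)
qed auto

lemma gronwall_backward:
  fixes d \<phi> :: "real \<Rightarrow> 'a::euclidean_space"
  assumes d: "primitive_on T \<phi> d" and T: "0 \<le> T" and L: "0 \<le> L" and k: "integrable (leb T) k"
    and le: "\<And>t. t \<in> {0..T} \<Longrightarrow> norm (\<phi> t) \<le> L * norm (d t) + k t"
    and k0: "\<And>t. t \<in> {0..T} \<Longrightarrow> 0 \<le> k t"
    and t: "t \<in> {0..T}"
  shows "norm (d t) \<le> exp (L * T) * (norm (d T) + (LINT t|leb T. k t))"
proof (rule gronwall_aux[OF exp_kernel_backward[OF L] T L _ _ k le k0 _ _ t])
  show "continuous_on {0..T} d" using d by (rule primitive_on_continuous)
  show "integrable (leb T) \<phi>" using d by (rule primitive_onD)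
  fix t assume t: "t \<in> {0..T}"
  show "norm (d t - d T) = norm (LINT s|lebesgue_on {t..T}. \<phi> s)"
    using primitive_on_increment[OF d, of t T] t by (metis atLeastAtMost_iff norm_minus_commute order_refl)
  show "exp (L * (T - t)) \<le> exp (L * T)" using t L by (auto intro: mult_left_mono)
qed auto

text \<open>Bielecki's weighted norm: a solution is sought as \<open>\<omega>\<close> times a
  bounded continuous function. As \<open>\<omega>\<close> is the kernel for the doubled rate
  \<open>2 * L\<close>, the integral operator contracts by the factor 1/2 on the whole interval, and
  no local solutions have to be glued. The sign \<open>\<sigma>\<close> is 1 for initial and -1 for
  terminal value problems.\<close>

lemma volterra_exists:
  fixes F :: "real \<Rightarrow> 'a::euclidean_space \<Rightarrow> 'a"
  assumes ker: "exp_kernel T (2 * L) S \<omega>" and T: "0 \<le> T" and L: "0 \<le> L" and \<sigma>: "\<bar>\<sigma>\<bar> = 1"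
    and cont: "\<And>h::real \<Rightarrow> 'a. integrable (leb T) h \<Longrightarrow>
      continuous_on {0..T} (\<lambda>t. LINT s|lebesgue_on (S t). h s)"
    and int: "\<And>x. continuous_on {0..T} x \<Longrightarrow> integrable (leb T) (\<lambda>s. F s (x s))"
    and lip: "\<And>s \<xi> \<eta>. s \<in> {0..T} \<Longrightarrow> norm (F s \<xi> - F s \<eta>) \<le> L * norm (\<xi> - \<eta>)"
  shows "\<exists>x. continuous_on {0..T} x \<and>
    (\<forall>t\<in>{0..T}. x t = a + \<sigma> *\<^sub>R (LINT s|lebesgue_on (S t). F s (x s)))"
proof -
  note K = exp_kernelD[OF ker]
  \<comment> \<open>Clamping the time to \<open>[0, T]\<close> extends continuous functions on the
    interval to bounded continuous functions on the line, which form a Banach space.\<close>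
  define \<tau> where "\<tau> = (\<lambda>t. max 0 (min T t))"
  have \<tau>: "\<tau> t \<in> {0..T}" for t using T by (auto simp: \<tau>_def)
  have \<tau>_id: "\<tau> t = t" if "t \<in> {0..T}" for t using that by (auto simp: \<tau>_def)
  define X where "X = (\<lambda>(z::real \<Rightarrow>\<^sub>C 'a) s. \<omega> s *\<^sub>R apply_bcontfun z s)"
  have cX: "continuous_on {0..T} (X z)" for z
    unfolding X_def by (intro continuous_intros K continuous_on_subset[OF continuous_on_apply_bcontfun]) auto
  define I where "I = (\<lambda>z t. LINT s|lebesgue_on (S t). F s (X z s))"
  define P where "P = (\<lambda>z t. (1 / \<omega> t) *\<^sub>R (a + \<sigma> *\<^sub>R I z t))"
  have \<omega>0: "\<omega> t > 0" if "t \<in> {0..T}" for t using K(2)[OF that] by simp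
  have cP: "continuous_on {0..T} (P z)" for z
    unfolding P_def I_def using \<omega>0 by (intro continuous_intros K cont int cX) fastforce
  have ct: "continuous_on UNIV \<tau>" unfolding \<tau>_def by (intro continuous_intros)
  have cPt: "continuous_on UNIV (\<lambda>t. P z (\<tau> t))" for z
    by (rule continuous_on_compose2[OF cP ct]) (use \<tau> in auto)
  have "bounded (range (\<lambda>t. P z (\<tau> t)))" for z
  proof -
    have "bounded (P z ` {0..T})" using cP compact_continuous_image compact_imp_bounded by blast
    then show ?thesis by (rule bounded_subset) (use \<tau> in auto)
  qed
  then have bc: "(\<lambda>t. P z (\<tau> t)) \<in> bcontfun" for z
    using cPt by (simp add: bcontfun_def)
  define \<Phi> where "\<Phi> = (\<lambda>z. Bcontfun (\<lambda>t. P z (\<tau> t)))"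
  have app: "apply_bcontfun (\<Phi> z) t = P z (\<tau> t)" for z t
    unfolding \<Phi>_def using bc by (simp add: Bcontfun_inverse)
  have contr: "dist (\<Phi> z) (\<Phi> z') \<le> 1 / 2 * dist z z'" for z z'
  proof (rule dist_bound)
    fix t0
    define t where "t = \<tau> t0"
    have t: "t \<in> {0..T}" using \<tau> by (simp add: t_def)
    let ?M = "lebesgue_on (S t)"
    have i: "integrable ?M (\<lambda>s. F s (X y s))" for y
      using K(3,4)[OF t] by (intro integrable_lebesgue_on_subset[OF int[OF cX]]) auto
    have iw: "integrable ?M (\<lambda>s. dist z z' / 2 * (2 * L * \<omega> s))"
      using K(3,4)[OF t] by (intro integrable_lebesgue_on_subset[OF integrable_leb_continuous] continuous_intros) (auto intro: K(1))
    have "norm (I z t - I z' t) = norm (LINT s|?M. F s (X z s) - F s (X z' s))"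
      unfolding I_def using i by simp
    also have "\<dots> \<le> (LINT s|?M. dist z z' / 2 * (2 * L * \<omega> s))"
    proof (rule Bochner_Integration.integral_norm_bound_integral)
      fix s assume "s \<in> space ?M"
      then have s: "s \<in> {0..T}" using K(3)[OF t] by auto
      have "X z s - X z' s = \<omega> s *\<^sub>R (apply_bcontfun z s - apply_bcontfun z' s)"
        by (simp add: X_def scaleR_diff_right)
      then have "norm (X z s - X z' s) = \<omega> s * dist (apply_bcontfun z s) (apply_bcontfun z' s)"
        using \<omega>0[OF s] by (simp add: dist_norm)
      also have "\<dots> \<le> \<omega> s * dist z z'"
        using \<omega>0[OF s] by (intro mult_left_mono dist_bounded) auto
      finally have "L * norm (X z s - X z' s) \<le> L * (\<omega> s * dist z z')"
        using L by (rule mult_left_mono)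
      with lip[OF s, of "X z s" "X z' s"]
      show "norm (F s (X z s) - F s (X z' s)) \<le> dist z z' / 2 * (2 * L * \<omega> s)"
        by (simp add: mult_ac)
    qed (use i iw in auto)
    also have "\<dots> = dist z z' / 2 * (\<omega> t - 1)" using K(5)[OF t] by simp
    also have "\<dots> \<le> dist z z' / 2 * \<omega> t" by (intro mult_left_mono) auto
    finally have *: "norm (I z t - I z' t) \<le> dist z z' / 2 * \<omega> t" .
    have "P z t - P z' t = (\<sigma> / \<omega> t) *\<^sub>R (I z t - I z' t)"
      by (simp add: P_def scaleR_diff_right scaleR_add_right)
    then have "norm (P z t - P z' t) = norm (I z t - I z' t) / \<omega> t"
      using \<omega>0[OF t] \<sigma> by simp
    also have "\<dots> \<le> dist z z' / 2"
      using * \<omega>0[OF t] by (simp add: pos_divide_le_eq)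
    finally show "dist (apply_bcontfun (\<Phi> z) t0) (apply_bcontfun (\<Phi> z') t0) \<le> 1 / 2 * dist z z'"
      unfolding app t_def[symmetric] by (simp add: dist_norm)
  qed
  have "\<exists>!z. \<Phi> z = z"
    by (rule banach_fix_type[of "1/2"]) (use contr in auto)
  then obtain z where z: "\<Phi> z = z" by blast
  show ?thesis
  proof (intro exI[of _ "X z"] conjI ballI cX)
    fix t assume t: "t \<in> {0..T}"
    have "apply_bcontfun z t = P z t" using app[of z t] z \<tau>_id[OF t] by simp
    then have "X z t = a + \<sigma> *\<^sub>R I z t" using \<omega>0[OF t] by (simp add: X_def P_def)
    then show "X z t = a + \<sigma> *\<^sub>R (LINT s|lebesgue_on (S t). F s (X z s))" by (simp add: I_def)
  qed
qed

section \<open>Uniqueness and well-posedness of initial and terminal value problems\<close>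

lemma ode_difference:
  fixes x y :: "real \<Rightarrow> 'a::euclidean_space"
  assumes "0 \<le> T" "0 \<le> L"
    and lip: "\<And>s \<xi> \<eta>. s \<in> {0..T} \<Longrightarrow> norm (F s \<xi> - F s \<eta>) \<le> L * norm (\<xi> - \<eta>)"
    and x: "solves_ode_on T F x" and y: "solves_ode_on T F y" and t: "t \<in> {0..T}"
  shows "norm (x t - y t) \<le> exp (L * T) * norm (x 0 - y 0)"
    and "norm (x t - y t) \<le> exp (L * T) * norm (x T - y T)"
proof -
  have p: "primitive_on T (\<lambda>s. F s (x s) - F s (y s)) (\<lambda>s. x s - y s)"
    using x y unfolding solves_ode_on_primitive by (rule primitive_on_diff)
  have "norm (x t - y t) \<le> exp (L * T) * (norm (x 0 - y 0) + (LINT t|leb T. 0))"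
    by (rule gronwall_forward[OF p assms(1,2) _ _ _ t]) (use lip in auto)
  then show "norm (x t - y t) \<le> exp (L * T) * norm (x 0 - y 0)" by simp
  have "norm (x t - y t) \<le> exp (L * T) * (norm (x T - y T) + (LINT t|leb T. 0))"
    by (rule gronwall_backward[OF p assms(1,2) _ _ _ t]) (use lip in auto)
  then show "norm (x t - y t) \<le> exp (L * T) * norm (x T - y T)" by simp
qed

lemma solves_ode_on_restrict:
  assumes "0 \<le> T" "solves_ode_on T F x"
  shows "solves_ode_on T F (restrict x {0..T})"
  using assms unfolding solves_ode_on_primitive by (intro primitive_on_cong[OF assms(2)[unfolded solves_ode_on_primitive]]) auto

lemma
  fixes F :: "real \<Rightarrow> 'a::euclidean_space \<Rightarrow> 'a"
  assumes T: "0 \<le> T" and L: "0 \<le> L"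
    and int: "\<And>x. continuous_on {0..T} x \<Longrightarrow> integrable (leb T) (\<lambda>s. F s (x s))"
    and lip: "\<And>s \<xi> \<eta>. s \<in> {0..T} \<Longrightarrow> norm (F s \<xi> - F s \<eta>) \<le> L * norm (\<xi> - \<eta>)"
  shows ode_initial_ex1: "\<exists>!x. x \<in> extensional {0..T} \<and> solves_ode_on T F x \<and> x 0 = a"
    and ode_terminal_ex1: "\<exists>!x. x \<in> extensional {0..T} \<and> solves_ode_on T F x \<and> x T = a"
proof -
  have L2: "0 \<le> 2 * L" using L by simp
  have s0: "(LINT s|lebesgue_on {c..c}. h s) = 0" for c and h :: "real \<Rightarrow> 'a"
    by (rule integral_eq_zero_null_sets) simp
  have uniq: "x = y"
    if "x \<in> extensional {0..T}" "y \<in> extensional {0..T}" "\<And>t. t \<in> {0..T} \<Longrightarrow> norm (x t - y t) \<le> exp (L * T) * 0"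
    for x y :: "real \<Rightarrow> 'a"
    by (rule extensionalityI[OF that(1,2)]) (use that(3) in simp)
  have "\<exists>x. continuous_on {0..T} x \<and> (\<forall>t\<in>{0..T}. x t = a + 1 *\<^sub>R (LINT s|leb t. F s (x s)))"
    by (rule volterra_exists[OF exp_kernel_forward[OF L2] T L _ indefinite_integral_continuous_real int lip]) auto
  then obtain x where cx: "continuous_on {0..T} x"
    and xx: "\<And>t. t \<in> {0..T} \<Longrightarrow> x t = a + 1 *\<^sub>R (LINT s|leb t. F s (x s))" by blast
  have x0: "x 0 = a" using xx[of 0] T s0[of 0 "\<lambda>s. F s (x s)"] by simp
  have "solves_ode_on T F x"
    unfolding solves_ode_on_def x0 using int[OF cx] xx[unfolded scaleR_one] by blast
  then have sx: "solves_ode_on T F (restrict x {0..T})" by (rule solves_ode_on_restrict[OF T])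
  show "\<exists>!x. x \<in> extensional {0..T} \<and> solves_ode_on T F x \<and> x 0 = a"
  proof (rule ex1I[of _ "restrict x {0..T}"])
    show "restrict x {0..T} \<in> extensional {0..T} \<and> solves_ode_on T F (restrict x {0..T}) \<and> restrict x {0..T} 0 = a"
      using sx x0 T by simp
    fix y assume y: "y \<in> extensional {0..T} \<and> solves_ode_on T F y \<and> y 0 = a"
    show "y = restrict x {0..T}"
    proof (rule uniq)
      fix t assume t: "t \<in> {0..T}"
      from ode_difference(1)[OF T L lip _ sx t, of y] y x0 T
      show "norm (y t - restrict x {0..T} t) \<le> exp (L * T) * 0" by simp
    qed (use y in auto)
  qed
  have bwd: "continuous_on {0..T} (\<lambda>t. LINT s|lebesgue_on {t..T}. h s)" if h: "integrable (leb T) h" for h :: "real \<Rightarrow> 'a"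
  proof -
    have "continuous_on {0..T} (\<lambda>t. (LINT s|leb T. h s) - (LINT s|leb t. h s))"
      by (intro continuous_intros indefinite_integral_continuous_real h)
    then show ?thesis
    proof (rule continuous_on_eq)
      fix t assume "t \<in> {0..T}"
      then show "(LINT s|leb T. h s) - (LINT s|leb t. h s) = (LINT s|lebesgue_on {t..T}. h s)"
        using integral_split_leb[OF h, of t T] by simp
    qed
  qed
  have "\<exists>x. continuous_on {0..T} x \<and> (\<forall>t\<in>{0..T}. x t = a + (-1) *\<^sub>R (LINT s|lebesgue_on {t..T}. F s (x s)))"
    by (rule volterra_exists[OF exp_kernel_backward[OF L2] T L _ bwd int lip]) auto
  then obtain p where cp: "continuous_on {0..T} p"
    and pp: "\<And>t. t \<in> {0..T} \<Longrightarrow> p t = a + (-1) *\<^sub>R (LINT s|lebesgue_on {t..T}. F s (p s))" by blast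
  have pT: "p T = a" using pp[of T] T s0[of T "\<lambda>s. F s (p s)"] by simp
  \<comment> \<open>The integral equation anchored at \<open>T\<close> is rewritten with base point
    0, the form that \<open>solves_ode_on\<close> requires.\<close>
  have "p t = p 0 + (LINT s|leb t. F s (p s))" if t: "t \<in> {0..T}" for t
  proof -
    have "p t - p 0 = (LINT s|leb T. F s (p s)) - (LINT s|lebesgue_on {t..T}. F s (p s))"
      using pp[OF t] pp[of 0] T by simp
    then show ?thesis using integral_split_leb[OF int[OF cp], of t T] t by (simp add: algebra_simps)
  qed
  then have "solves_ode_on T F p"
    unfolding solves_ode_on_def using int[OF cp] by metis
  then have sp: "solves_ode_on T F (restrict p {0..T})" by (rule solves_ode_on_restrict[OF T])
  show "\<exists>!x. x \<in> extensional {0..T} \<and> solves_ode_on T F x \<and> x T = a"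
  proof (rule ex1I[of _ "restrict p {0..T}"])
    show "restrict p {0..T} \<in> extensional {0..T} \<and> solves_ode_on T F (restrict p {0..T}) \<and> restrict p {0..T} T = a"
      using sp pT T by simp
    fix y assume y: "y \<in> extensional {0..T} \<and> solves_ode_on T F y \<and> y T = a"
    show "y = restrict p {0..T}"
    proof (rule uniq)
      fix t assume t: "t \<in> {0..T}"
      from ode_difference(2)[OF T L lip _ sp t, of y] y pT T
      show "norm (y t - restrict p {0..T} t) \<le> exp (L * T) * 0" by simp
    qed (use y in auto)
  qed
qed

section \<open>The space \<open>L\<^sup>2\<close>\<close>

abbreviation L2 :: "real \<Rightarrow> (real \<Rightarrow> 'a::euclidean_space) set" where
  "L2 T \<equiv> Lp_space 2 T"

abbreviation nrm1 :: "real \<Rightarrow> (real \<Rightarrow> 'a::euclidean_space) \<Rightarrow> real" where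
  "nrm1 T \<equiv> Lp_norm 1 T"

abbreviation nrm2 :: "real \<Rightarrow> (real \<Rightarrow> 'a::euclidean_space) \<Rightarrow> real" where
  "nrm2 T \<equiv> Lp_norm 2 T"

lemma powr_2_norm: "norm x powr 2 = (norm x)\<^sup>2"
  by (cases "x = 0") auto

lemma L2_iff: "v \<in> L2 T \<longleftrightarrow> v \<in> borel_measurable (leb T) \<and> integrable (leb T) (\<lambda>t. (norm (v t))\<^sup>2)"
  by (simp add: Lp_space_def powr_2_norm)

lemma nrm2_eq: "nrm2 T v = sqrt (LINT t|leb T. (norm (v t))\<^sup>2)"
proof -
  have "0 \<le> (LINT t|leb T. (norm (v t))\<^sup>2)" by (rule integral_nonneg_AE) simp
  then show ?thesis by (simp add: Lp_norm_def powr_2_norm powr_half_sqrt)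
qed

lemma nrm1_eq: "nrm1 T v = (LINT t|leb T. norm (v t))"
proof -
  have "0 \<le> (LINT t|leb T. norm (v t))" by (rule integral_nonneg_AE) simp
  then show ?thesis by (simp add: Lp_norm_def)
qed

lemma nrm1_nonneg [simp]: "0 \<le> nrm1 T v"
  unfolding nrm1_eq by (rule integral_nonneg_AE) simp

lemma nrm2_nonneg [simp]: "0 \<le> nrm2 T v"
  by (simp add: Lp_norm_def)

lemma nrm2_square: "(nrm2 T v)\<^sup>2 = (LINT t|leb T. (norm (v t))\<^sup>2)"
proof -
  have "0 \<le> (LINT t|leb T. (norm (v t))\<^sup>2)" by (rule integral_nonneg_AE) simp
  then show ?thesis by (simp add: nrm2_eq)
qed

lemma L2_measurable: "v \<in> L2 T \<Longrightarrow> v \<in> borel_measurable (leb T)"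
  by (simp add: L2_iff)

lemma L2_mult_integrable:
  assumes "v \<in> L2 T" "w \<in> L2 T"
  shows "integrable (leb T) (\<lambda>t. norm (v t) * norm (w t))"
proof (rule Bochner_Integration.integrable_bound)
  show "integrable (leb T) (\<lambda>t. (norm (v t))\<^sup>2 + (norm (w t))\<^sup>2)"
    using assms by (simp add: L2_iff)
  have [measurable]: "v \<in> borel_measurable (leb T)" "w \<in> borel_measurable (leb T)"
    using assms by (auto intro: L2_measurable)
  show "(\<lambda>t. norm (v t) * norm (w t)) \<in> borel_measurable (leb T)" by measurable
  have "a * b \<le> a\<^sup>2 + b\<^sup>2" for a b :: real
    using sum_squares_bound[of a b] zero_le_power2[of a] zero_le_power2[of b] by linarith
  then show "AE t in leb T. norm (norm (v t) * norm (w t)) \<le> norm ((norm (v t))\<^sup>2 + (norm (w t))\<^sup>2)"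
    by (intro AE_I2) (simp add: abs_mult)
qed

lemma L2_zero_norm_AE:
  assumes "v \<in> L2 T" "nrm2 T v = 0"
  shows "AE t in leb T. v t = 0"
proof -
  have "(LINT t|leb T. (norm (v t))\<^sup>2) = 0"
    using nrm2_square[of T v] assms(2) by simp
  then have "AE t in leb T. (norm (v t))\<^sup>2 = 0"
    using assms by (subst (asm) integral_nonneg_eq_0_iff_AE) (auto simp: L2_iff)
  then show ?thesis by simp
qed

text \<open>With \<open>a\<close> and \<open>b\<close> the two norms, the square of
  \<open>b * norm (v t) - a * norm (w t)\<close> has a nonnegative integral. Its expansion is
  divided by \<open>a * b\<close>, which is why the degenerate case is split off.\<close>

lemma L2_Cauchy_Schwarz:
  assumes v: "v \<in> L2 T" and w: "w \<in> L2 T"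
  shows "(LINT t|leb T. norm (v t) * norm (w t)) \<le> nrm2 T v * nrm2 T w"
proof (cases "nrm2 T v = 0 \<or> nrm2 T w = 0")
  case True
  then have "AE t in leb T. norm (v t) * norm (w t) = 0"
    using L2_zero_norm_AE[OF v] L2_zero_norm_AE[OF w] by auto
  then have "(LINT t|leb T. norm (v t) * norm (w t)) = 0"
    by (rule integral_eq_zero_AE)
  then show ?thesis by simp
next
  case False
  define a where "a = nrm2 T v"
  define b where "b = nrm2 T w"
  have ab: "a > 0" "b > 0" using False by (auto simp: a_def b_def order.strict_iff_order)
  define I where "I = (LINT t|leb T. norm (v t) * norm (w t))"
  have i: "integrable (leb T) (\<lambda>t. (norm (v t))\<^sup>2)" "integrable (leb T) (\<lambda>t. (norm (w t))\<^sup>2)"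
    using v w by (auto simp: L2_iff)
  have "0 \<le> (LINT t|leb T. (b * norm (v t) - a * norm (w t))\<^sup>2)"
    by (rule integral_nonneg_AE) simp
  also have "(\<lambda>t. (b * norm (v t) - a * norm (w t))\<^sup>2) =
      (\<lambda>t. b\<^sup>2 * (norm (v t))\<^sup>2 + a\<^sup>2 * (norm (w t))\<^sup>2 - 2 * a * b * (norm (v t) * norm (w t)))"
    by (simp add: fun_eq_iff power2_diff power_mult_distrib)
  also have "(LINT t|leb T. b\<^sup>2 * (norm (v t))\<^sup>2 + a\<^sup>2 * (norm (w t))\<^sup>2 - 2 * a * b * (norm (v t) * norm (w t)))
      = b\<^sup>2 * a\<^sup>2 + a\<^sup>2 * b\<^sup>2 - 2 * a * b * I"
    unfolding I_def a_def b_def nrm2_square using i L2_mult_integrable[OF v w] by simp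
  finally have "(a * b) * I \<le> (a * b) * (a * b)" by (simp add: power2_eq_square algebra_simps)
  then show ?thesis using ab by (simp add: I_def a_def b_def)
qed

lemma L2_bound:
  assumes "w \<in> borel_measurable (leb T)" "k \<in> L2 T"
    and "\<And>t. t \<in> {0..T} \<Longrightarrow> norm (w t) \<le> norm (k t)"
  shows "w \<in> L2 T" "nrm2 T w \<le> nrm2 T k"
proof -
  have le: "(norm (w t))\<^sup>2 \<le> (norm (k t))\<^sup>2" if "t \<in> {0..T}" for t
    using assms(3)[OF that] by (simp add: power_mono)
  have "integrable (leb T) (\<lambda>t. (norm (w t))\<^sup>2)"
  proof (rule Bochner_Integration.integrable_bound)
    show "integrable (leb T) (\<lambda>t. (norm (k t))\<^sup>2)" using assms by (simp add: L2_iff)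
    show "(\<lambda>t. (norm (w t))\<^sup>2) \<in> borel_measurable (leb T)" using assms(1) by measurable
    show "AE t in leb T. norm ((norm (w t))\<^sup>2) \<le> norm ((norm (k t))\<^sup>2)"
      by (rule AE_I2) (use le in simp)
  qed
  then show "w \<in> L2 T" using assms by (simp add: L2_iff)
  then show "nrm2 T w \<le> nrm2 T k" unfolding nrm2_eq
    using assms le by (intro real_sqrt_le_mono integral_mono) (auto simp: L2_iff)
qed

lemma L2_scale:
  assumes "v \<in> L2 T" shows "(\<lambda>t. c *\<^sub>R v t) \<in> L2 T" "nrm2 T (\<lambda>t. c *\<^sub>R v t) = \<bar>c\<bar> * nrm2 T v"
proof -
  show "(\<lambda>t. c *\<^sub>R v t) \<in> L2 T"
    using assms by (auto simp: L2_iff power_mult_distrib intro!: borel_measurable_scaleR)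
  show "nrm2 T (\<lambda>t. c *\<^sub>R v t) = \<bar>c\<bar> * nrm2 T v"
    by (simp add: nrm2_eq power_mult_distrib real_sqrt_mult)
qed

lemma L2_add:
  assumes v: "v \<in> L2 T" and w: "w \<in> L2 T"
  shows "(\<lambda>t. v t + w t) \<in> L2 T" "nrm2 T (\<lambda>t. v t + w t) \<le> nrm2 T v + nrm2 T w"
proof -
  have [measurable]: "v \<in> borel_measurable (leb T)" "w \<in> borel_measurable (leb T)"
    using assms by (auto intro: L2_measurable)
  have i: "integrable (leb T) (\<lambda>t. (norm (v t))\<^sup>2 + (norm (w t))\<^sup>2 + 2 * (norm (v t) * norm (w t)))"
    using v w L2_mult_integrable[OF v w] by (simp add: L2_iff)
  have le: "(norm (v t + w t))\<^sup>2 \<le> (norm (v t))\<^sup>2 + (norm (w t))\<^sup>2 + 2 * (norm (v t) * norm (w t))" for t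
    using power_mono[OF norm_triangle_ineq[of "v t" "w t"], of 2] by (simp add: power2_sum)
  have i2: "integrable (leb T) (\<lambda>t. (norm (v t + w t))\<^sup>2)"
  proof (rule Bochner_Integration.integrable_bound[OF i])
    show "(\<lambda>t. (norm (v t + w t))\<^sup>2) \<in> borel_measurable (leb T)" by measurable
    show "AE t in leb T. norm ((norm (v t + w t))\<^sup>2)
      \<le> norm ((norm (v t))\<^sup>2 + (norm (w t))\<^sup>2 + 2 * (norm (v t) * norm (w t)))"
      by (rule AE_I2) (use le in \<open>simp add: abs_of_nonneg\<close>)
  qed
  then show "(\<lambda>t. v t + w t) \<in> L2 T" by (simp add: L2_iff)
  have "(nrm2 T (\<lambda>t. v t + w t))\<^sup>2 \<le> (LINT t|leb T. (norm (v t))\<^sup>2 + (norm (w t))\<^sup>2 + 2 * (norm (v t) * norm (w t)))"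
    unfolding nrm2_square by (rule integral_mono[OF i2 i]) (rule le)
  also have "\<dots> = (nrm2 T v)\<^sup>2 + (nrm2 T w)\<^sup>2 + 2 * (LINT t|leb T. norm (v t) * norm (w t))"
    unfolding nrm2_square using v w L2_mult_integrable[OF v w] by (simp add: L2_iff)
  also have "\<dots> \<le> (nrm2 T v + nrm2 T w)\<^sup>2"
    using L2_Cauchy_Schwarz[OF v w] by (simp add: power2_sum)
  finally show "nrm2 T (\<lambda>t. v t + w t) \<le> nrm2 T v + nrm2 T w"
    by (rule power2_le_imp_le) simp
qed

lemma L2_diff:
  assumes v: "v \<in> L2 T" and w: "w \<in> L2 T"
  shows "(\<lambda>t. v t - w t) \<in> L2 T" "nrm2 T (\<lambda>t. v t - w t) \<le> nrm2 T v + nrm2 T w"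
  using L2_add[OF v L2_scale(1)[OF w, of "-1"]] L2_scale(2)[OF w, of "-1"] by auto

lemma nrm2_commute: "nrm2 T (\<lambda>t. v t - w t) = nrm2 T (\<lambda>t. w t - v t)"
  by (simp add: nrm2_eq norm_minus_commute)

lemma nrm2_triangle:
  assumes "u \<in> L2 T" "v \<in> L2 T" "w \<in> L2 T"
  shows "nrm2 T (\<lambda>t. u t - w t) \<le> nrm2 T (\<lambda>t. u t - v t) + nrm2 T (\<lambda>t. v t - w t)"
  using L2_add(2)[OF L2_diff(1)[OF assms(1,2)] L2_diff(1)[OF assms(2,3)]] by simp

lemma nrm2_cong_AE:
  assumes "AE t in leb T. v t = w t" "v \<in> borel_measurable (leb T)" "w \<in> borel_measurable (leb T)"
  shows "nrm2 T v = nrm2 T w"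
  unfolding nrm2_eq using assms by (intro arg_cong[where f=sqrt] integral_cong_AE) auto

lemma L2_const: "(\<lambda>t. c) \<in> L2 T"
  by (simp add: L2_iff)

lemma nrm2_const: "0 \<le> T \<Longrightarrow> nrm2 T (\<lambda>t. c) = sqrt T * norm c"
  by (simp add: nrm2_eq measure_leb real_sqrt_mult)

lemma nrm2_zero [simp]: "nrm2 T (\<lambda>t. 0) = 0"
  by (simp add: nrm2_eq)

lemma L2_norm_integrable: "v \<in> L2 T \<Longrightarrow> integrable (leb T) (\<lambda>t. norm (v t))"
  using L2_mult_integrable[of v T "\<lambda>t. 1::real"] by (simp add: L2_const)

lemma nrm1_le_nrm2: "v \<in> L2 T \<Longrightarrow> 0 \<le> T \<Longrightarrow> nrm1 T v \<le> sqrt T * nrm2 T v"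
  using L2_Cauchy_Schwarz[of v T "\<lambda>t. 1::real"]
  by (simp add: L2_const nrm2_const nrm1_eq mult.commute)

lemma nrm1_triangle:
  assumes "v \<in> L2 T" "w \<in> L2 T"
  shows "nrm1 T (\<lambda>t. v t + w t) \<le> nrm1 T v + nrm1 T w"
proof -
  have "nrm1 T (\<lambda>t. v t + w t) \<le> (LINT t|leb T. norm (v t) + norm (w t))"
    unfolding nrm1_eq using assms
    by (intro integral_mono) (auto intro!: L2_norm_integrable L2_add norm_triangle_ineq)
  also have "\<dots> = nrm1 T v + nrm1 T w"
    unfolding nrm1_eq using assms by (simp add: L2_norm_integrable)
  finally show ?thesis .
qed

lemma nrm1_scale: "nrm1 T (\<lambda>t. c *\<^sub>R v t) = \<bar>c\<bar> * nrm1 T v"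
  by (simp add: nrm1_eq)

lemma L2_inner_integrable:
  assumes v: "v \<in> L2 T" and w: "w \<in> L2 T"
  shows "integrable (leb T) (\<lambda>t. v t \<bullet> w t)" "\<bar>LINT t|leb T. v t \<bullet> w t\<bar> \<le> nrm2 T v * nrm2 T w"
proof -
  have [measurable]: "v \<in> borel_measurable (leb T)" "w \<in> borel_measurable (leb T)"
    using assms by (auto intro: L2_measurable)
  show i: "integrable (leb T) (\<lambda>t. v t \<bullet> w t)"
  proof (rule Bochner_Integration.integrable_bound[OF L2_mult_integrable[OF v w]])
    show "(\<lambda>t. v t \<bullet> w t) \<in> borel_measurable (leb T)" by measurable
  qed (intro AE_I2, simp add: Cauchy_Schwarz_ineq2 abs_mult)
  have "norm (LINT t|leb T. v t \<bullet> w t) \<le> (LINT t|leb T. norm (v t) * norm (w t))"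
    by (rule Bochner_Integration.integral_norm_bound_integral[OF i L2_mult_integrable[OF v w]])
      (simp add: Cauchy_Schwarz_ineq2)
  with L2_Cauchy_Schwarz[OF v w] show "\<bar>LINT t|leb T. v t \<bullet> w t\<bar> \<le> nrm2 T v * nrm2 T w" by simp
qed

lemma nrm2_sq_inner: "(nrm2 T v)\<^sup>2 = (LINT t|leb T. v t \<bullet> v t)"
  by (simp add: nrm2_square dot_square_norm)

text \<open>Such a sequence converges absolutely almost everywhere because it does so in \<open>L\<^sup>1\<close>, and
  Fatou's lemma identifies the \<open>L\<^sup>2\<close> limit.\<close>

lemma L2_complete:
  fixes v :: "nat \<Rightarrow> real \<Rightarrow> 'a::euclidean_space"
  assumes T: "0 \<le> T" and v: "\<And>n. v n \<in> L2 T"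
    and le: "\<And>n. nrm2 T (\<lambda>t. v (Suc n) t - v n t) \<le> (1/2) ^ n"
  shows "\<exists>w\<in>L2 T. (\<lambda>n. nrm2 T (\<lambda>t. v n t - w t)) \<longlonglongrightarrow> 0"
proof -
  have [measurable]: "v n \<in> borel_measurable (leb T)" for n using v by (rule L2_measurable)
  define d where "d = (\<lambda>n t. v (Suc n) t - v n t)"
  have dL2: "d n \<in> L2 T" for n unfolding d_def by (intro L2_diff v)
  have d1: "nrm1 T (d n) \<le> sqrt T * (1/2) ^ n" for n
    using nrm1_le_nrm2[OF dL2 T, of n] mult_left_mono[OF le[of n], of "sqrt T"] T
    by (simp add: d_def)
  have "AE t in leb T. summable (\<lambda>n. norm (d n t))"
  proof -
    have [measurable]: "d n \<in> borel_measurable (leb T)" for n using dL2 by (rule L2_measurable)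
    have "(\<integral>\<^sup>+t. (\<Sum>n. ennreal (norm (d n t))) \<partial>leb T) = (\<Sum>n. \<integral>\<^sup>+t. ennreal (norm (d n t)) \<partial>leb T)"
      by (rule nn_integral_suminf) measurable
    also have "\<dots> = (\<Sum>n. ennreal (nrm1 T (d n)))"
      unfolding nrm1_eq by (intro suminf_cong nn_integral_eq_integral L2_norm_integrable dL2) auto
    also have "\<dots> \<le> (\<Sum>n. ennreal (sqrt T * (1/2) ^ n))"
      by (intro suminf_le ennreal_leI d1) auto
    also have "\<dots> = ennreal (\<Sum>n. sqrt T * (1/2) ^ n)"
      by (rule suminf_ennreal2) (use T in \<open>auto intro!: summable_mult summable_geometric\<close>)
    finally have "(\<integral>\<^sup>+t. (\<Sum>n. ennreal (norm (d n t))) \<partial>leb T) \<noteq> \<infinity>"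
      by (auto simp: top_unique)
    then have "AE t in leb T. (\<Sum>n. ennreal (norm (d n t))) \<noteq> \<infinity>"
      by (intro nn_integral_PInf_AE) auto
    then show ?thesis
    proof eventually_elim
      case (elim t)
      then show ?case by (intro summable_suminf_not_top) auto
    qed
  qed
  then have cv: "AE t in leb T. convergent (\<lambda>n. v n t)"
  proof eventually_elim
    case (elim t)
    then have "summable (\<lambda>n. d n t)" by (rule summable_norm_cancel)
    then have "convergent (\<lambda>n. v 0 t + (\<Sum>i<n. d i t))"
      unfolding summable_iff_convergent by (intro convergent_add convergent_const)
    moreover have "v 0 t + (\<Sum>i<n. d i t) = v n t" for n
      using sum_lessThan_telescope[of "\<lambda>i. v i t" n] by (simp add: d_def)
    ultimately show ?case by simp
  qed
  \<comment> \<open>Where the sequence diverges, \<open>lim\<close> takes an unspecified value;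
    these points form a null set.\<close>
  define w where "w = (\<lambda>t. lim (\<lambda>n. v n t))"
  have w[measurable]: "w \<in> borel_measurable (leb T)" unfolding w_def by measurable
  have lim: "AE t in leb T. (\<lambda>n. v n t) \<longlonglongrightarrow> w t"
    using cv by eventually_elim (simp add: w_def convergent_LIMSEQ_iff)
  \<comment> \<open>Subtracting the part of the geometric series that is still to come makes the
    induction on \<open>j\<close> close; dropping it leaves a bound uniform in
    \<open>j\<close>.\<close>
  have tail: "nrm2 T (\<lambda>t. v (n + j) t - v n t) \<le> 2 * (1/2) ^ n - 2 * (1/2) ^ (n + j)" for n j
  proof (induction j)
    case (Suc j)
    have "nrm2 T (\<lambda>t. v (n + Suc j) t - v n t)
       \<le> nrm2 T (\<lambda>t. v (Suc (n + j)) t - v (n + j) t) + nrm2 T (\<lambda>t. v (n + j) t - v n t)"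
      using nrm2_triangle[OF v[of "Suc (n+j)"] v[of "n+j"] v[of n]] by simp
    also have "\<dots> \<le> (1/2) ^ (n + j) + (2 * (1/2) ^ n - 2 * (1/2) ^ (n + j))"
      by (intro add_mono le Suc)
    finally show ?case by simp
  qed simp
  have tail2: "(\<integral>\<^sup>+t. ennreal ((norm (v n t - w t))\<^sup>2) \<partial>leb T) \<le> ennreal ((2 * (1/2) ^ n)\<^sup>2)" for n
  proof -
    have "(\<integral>\<^sup>+t. ennreal ((norm (v n t - w t))\<^sup>2) \<partial>leb T)
        = (\<integral>\<^sup>+t. liminf (\<lambda>j. ennreal ((norm (v n t - v j t))\<^sup>2)) \<partial>leb T)"
    proof (rule nn_integral_cong_AE)
      show "AE t in leb T. ennreal ((norm (v n t - w t))\<^sup>2) = liminf (\<lambda>j. ennreal ((norm (v n t - v j t))\<^sup>2))"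
        using lim
      proof eventually_elim
        case (elim t)
        then have "(\<lambda>j. ennreal ((norm (v n t - v j t))\<^sup>2)) \<longlonglongrightarrow> ennreal ((norm (v n t - w t))\<^sup>2)"
          by (intro tendsto_ennrealI tendsto_intros)
        from lim_imp_Liminf[OF trivial_limit_sequentially this] show ?case by (rule sym)
      qed
    qed
    also have "\<dots> \<le> liminf (\<lambda>j. \<integral>\<^sup>+t. ennreal ((norm (v n t - v j t))\<^sup>2) \<partial>leb T)"
      by (rule nn_integral_liminf) measurable
    also have "\<dots> \<le> ennreal ((2 * (1/2) ^ n)\<^sup>2)"
    proof (rule Liminf_le)
      show "\<forall>\<^sub>F j in sequentially. (\<integral>\<^sup>+t. ennreal ((norm (v n t - v j t))\<^sup>2) \<partial>leb T) \<le> ennreal ((2 * (1/2) ^ n)\<^sup>2)"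
      proof (rule eventually_sequentiallyI[of n])
        fix j assume "n \<le> j"
        then obtain i where j: "j = n + i" using le_Suc_ex by blast
        have m: "(\<lambda>t. v n t - v j t) \<in> L2 T" by (intro L2_diff v)
        have "0 \<le> 2 * (1/2::real) ^ (n + i)" by simp
        with tail[of n i] have "nrm2 T (\<lambda>t. v n t - v j t) \<le> 2 * (1/2) ^ n"
          unfolding j nrm2_commute[of T "v n"] by linarith
        then have "(nrm2 T (\<lambda>t. v n t - v j t))\<^sup>2 \<le> (2 * (1/2) ^ n)\<^sup>2" by (intro power_mono) auto
        then show "(\<integral>\<^sup>+t. ennreal ((norm (v n t - v j t))\<^sup>2) \<partial>leb T) \<le> ennreal ((2 * (1/2) ^ n)\<^sup>2)"
          using m by (subst nn_integral_eq_integral) (auto simp: L2_iff nrm2_square intro!: ennreal_leI)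
      qed
    qed simp
    finally show ?thesis .
  qed
  have fin: "integrable (leb T) (\<lambda>t. (norm (v n t - w t))\<^sup>2)" for n
  proof (rule integrableI_bounded)
    have "(\<integral>\<^sup>+t. ennreal (norm ((norm (v n t - w t))\<^sup>2)) \<partial>leb T) \<le> ennreal ((2 * (1/2) ^ n)\<^sup>2)"
      using tail2[of n] by simp
    also have "\<dots> < \<infinity>" by simp
    finally show "(\<integral>\<^sup>+t. ennreal (norm ((norm (v n t - w t))\<^sup>2)) \<partial>leb T) < \<infinity>" .
  qed measurable
  have dw: "(\<lambda>t. v n t - w t) \<in> L2 T" for n using fin by (simp add: L2_iff)
  have bound: "nrm2 T (\<lambda>t. v n t - w t) \<le> 2 * (1/2) ^ n" for n
  proof (rule power2_le_imp_le)
    have "ennreal ((nrm2 T (\<lambda>t. v n t - w t))\<^sup>2) \<le> ennreal ((2 * (1/2) ^ n)\<^sup>2)"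
      using tail2[of n] unfolding nrm2_square by (subst (asm) nn_integral_eq_integral[OF fin]) auto
    then show "(nrm2 T (\<lambda>t. v n t - w t))\<^sup>2 \<le> (2 * (1/2) ^ n)\<^sup>2"
      by (subst (asm) ennreal_le_iff) auto
  qed simp
  show ?thesis
  proof (intro bexI[of _ w])
    show "w \<in> L2 T" using L2_diff(1)[OF v[of 0] dw[of 0]] by simp
    have "(\<lambda>n. 2 * (1/2::real) ^ n) \<longlonglongrightarrow> 0"
      by (intro tendsto_mult_right_zero LIMSEQ_power_zero) auto
    then show "(\<lambda>n. nrm2 T (\<lambda>t. v n t - w t)) \<longlonglongrightarrow> 0"
      by (rule tendsto_sandwich[OF _ _ tendsto_const, rotated 2]) (auto intro: always_eventually bound)
  qed
qed

section \<open>Caratheodory functions\<close>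

text \<open>Preimages change only inside a null set, and every subset of a null set is Lebesgue
  measurable.\<close>

lemma borel_measurable_lebesgue_AE:
  fixes g h :: "'a::euclidean_space \<Rightarrow> 'b::topological_space"
  assumes g: "g \<in> borel_measurable lebesgue" and eq: "AE t in lebesgue. g t = h t"
  shows "h \<in> borel_measurable lebesgue"
proof (rule measurableI)
  obtain N where N: "{t. g t \<noteq> h t} \<subseteq> N" "N \<in> null_sets lebesgue"
    using eq by (auto elim!: AE_E simp: null_sets_def)
  fix A :: "'b set" assume "A \<in> sets borel"
  then have "g -` A \<inter> space lebesgue \<in> sets lebesgue" by (rule measurable_sets[OF g])
  then have 1: "g -` A - N \<in> sets lebesgue" using N(2) by auto
  have "h -` A \<inter> N \<in> null_sets lebesgue"
    by (rule null_sets_completion_subset[OF _ N(2)]) auto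
  then have "(g -` A - N) \<union> (h -` A \<inter> N) \<in> sets lebesgue" using 1 by auto
  also have "(g -` A - N) \<union> (h -` A \<inter> N) = h -` A \<inter> space lebesgue"
  proof -
    have "g t = h t" if "t \<notin> N" for t using N(1) that by blast
    then show ?thesis by auto
  qed
  finally show "h -` A \<inter> space lebesgue \<in> sets lebesgue" .
qed simp

text \<open>Joint Lebesgue measurability yields measurable sections only for almost every
  \<open>z\<close>. Such \<open>z\<close> are dense because a ball is not negligible, and continuity
  in \<open>z\<close> recovers the remaining sections as pointwise limits.\<close>

lemma caratheodory_section_measurable:
  fixes F :: "real \<Rightarrow> 'z::euclidean_space \<Rightarrow> 'y::euclidean_space"
  assumes F: "(\<lambda>(t, z). F t z) \<in> borel_measurable (lebesgue_on ({0..T} \<times> UNIV))"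
    and cont: "\<And>t. t \<in> {0..T} \<Longrightarrow> continuous_on UNIV (F t)"
  shows "(\<lambda>t. F t z) \<in> borel_measurable (leb T)"
proof (rule borel_measurable_euclidean_space[THEN iffD2], rule ballI)
  fix i :: 'y assume "i \<in> Basis"
  let ?P = "(lborel :: real measure) \<Otimes>\<^sub>M (lborel :: 'z measure)"
  define h where "h = (\<lambda>p. if p \<in> {0..T} \<times> UNIV then F (fst p) (snd p) \<bullet> i else 0)"
  have "(\<lambda>p. F (fst p) (snd p) \<bullet> i) \<in> borel_measurable (lebesgue_on ({0..T} \<times> UNIV))"
    using F by (simp add: split_def)
  moreover have "{0..T} \<times> (UNIV :: 'z set) \<in> sets lebesgue"
    by (intro sets_completionI_sets) (simp add: borel_closed closed_Times)
  ultimately have "h \<in> borel_measurable lebesgue"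
    unfolding h_def by (subst borel_measurable_if) auto
  \<comment> \<open>A Borel representative is needed because the Lebesgue sigma-algebra of the
    product is larger than the product sigma-algebra, to which the statements on sections of null
    sets apply.\<close>
  then obtain g where g: "g \<in> borel_measurable lborel" "AE p in lborel. h p = g p"
    using completion_ex_borel_measurable_real by blast
  have gP[measurable]: "g \<in> borel_measurable ?P" using g(1) unfolding lborel_prod by simp
  have "AE p in ?P. h p = g p" using g(2) unfolding lborel_prod by simp
  then obtain N where N: "{p \<in> space ?P. \<not> h p = g p} \<subseteq> N" "N \<in> null_sets ?P"
    by (auto elim!: AE_E simp: null_sets_def)
  have "AE p in ?P. p \<notin> N" using N(2) by (rule AE_not_in)
  then have "AE t in lborel. AE z in lborel. (t, z) \<notin> N" by (rule lborel_pair.AE_pair)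
  moreover have "{p \<in> space ?P. (fst p, snd p) \<notin> N} = space ?P - N" by auto
  then have "{p \<in> space ?P. (fst p, snd p) \<notin> N} \<in> sets ?P"
    by (metis N(2) null_setsD2 sets.compl_sets)
  ultimately have ae: "AE z in lborel. AE t in lborel. (t, z) \<notin> N"
    by (subst lborel_pair.AE_commute[symmetric])
  define Z where "Z = {z. (\<lambda>t. F t z \<bullet> i) \<in> borel_measurable (leb T)}"
  have "AE z in (lborel :: 'z measure). z \<in> Z"
    using ae
  proof eventually_elim
    case (elim z)
    have "(\<lambda>t. g (t, z)) \<in> borel_measurable lborel" by measurable
    then have gz: "(\<lambda>t. g (t, z)) \<in> borel_measurable lebesgue" by (simp add: measurable_completion)
    have "AE t in lborel. h (t, z) = g (t, z)"
      using elim by eventually_elim (use N(1) in \<open>auto simp: space_pair_measure\<close>)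
    then have "AE t in lebesgue. g (t, z) = h (t, z)" by (intro AE_completion) (auto elim: eventually_mono)
    with gz have "(\<lambda>t. h (t, z)) \<in> borel_measurable lebesgue"
      by (rule borel_measurable_lebesgue_AE)
    also have "(\<lambda>t. h (t, z)) = (\<lambda>t. if t \<in> {0..T} then F t z \<bullet> i else 0)"
      by (auto simp: h_def fun_eq_iff)
    finally show "z \<in> Z" unfolding Z_def by (subst (asm) borel_measurable_if) auto
  qed
  then obtain N' where N': "N' \<in> null_sets (lborel :: 'z measure)" "{z. z \<notin> Z} \<subseteq> N'"
    by (auto elim!: AE_E simp: null_sets_def)
  have dense: "\<exists>y\<in>Z. dist y z < e" if "e > 0" for e
  proof (rule ccontr)
    assume "\<not> ?thesis"
    then have "ball z e \<subseteq> N'" using N'(2) by (auto simp: dist_commute subset_iff)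
    then have "ball z e \<in> null_sets lebesgue"
      by (rule null_sets_completion_subset[OF _ null_sets_completionI[OF N'(1)]])
    then show False using open_not_negligible[of "ball z e"] that by (simp add: negligible_iff_null_sets)
  qed
  have "\<forall>n. \<exists>y. y \<in> Z \<and> dist y z < inverse (real (Suc n))"
    using dense by (metis inverse_positive_iff_positive of_nat_0_less_iff zero_less_Suc)
  from choice[OF this] obtain y where y: "\<And>n. y n \<in> Z" "\<And>n. dist (y n) z < inverse (real (Suc n))"
    by blast
  have yz: "y \<longlonglongrightarrow> z"
  proof (rule tendsto_dist_iff[THEN iffD2], rule tendsto_sandwich[OF _ _ tendsto_const LIMSEQ_inverse_real_of_nat])
    show "\<forall>\<^sub>F n in sequentially. dist (y n) z \<le> inverse (real (Suc n))"
      by (intro always_eventually allI less_imp_le y(2))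
  qed simp
  show "(\<lambda>t. F t z \<bullet> i) \<in> borel_measurable (leb T)"
  proof (rule borel_measurable_LIMSEQ_metric)
    show "(\<lambda>t. F t (y n) \<bullet> i) \<in> borel_measurable (leb T)" for n using y(1) by (simp add: Z_def)
    fix t assume "t \<in> space (leb T)"
    then have "continuous_on UNIV (F t)" using cont by simp
    then have "(\<lambda>n. F t (y n)) \<longlonglongrightarrow> F t z"
      by (rule continuous_on_tendsto_compose[OF _ yz]) auto
    then show "(\<lambda>n. F t (y n) \<bullet> i) \<longlonglongrightarrow> F t z \<bullet> i" by (intro tendsto_intros)
  qed
qed

text \<open>For a simple function in place of \<open>z\<close> the composition is pieced together
  from finitely many sections; continuity in the second argument then carries measurability to the
  limit.\<close>

lemma caratheodory_compose:
  fixes F :: "real \<Rightarrow> 'z::euclidean_space \<Rightarrow> 'y::euclidean_space"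
  assumes F: "\<And>z. (\<lambda>t. F t z) \<in> borel_measurable (leb T)"
    and cont: "\<And>t. t \<in> {0..T} \<Longrightarrow> continuous_on UNIV (F t)"
    and z: "z \<in> borel_measurable (leb T)"
  shows "(\<lambda>t. F t (z t)) \<in> borel_measurable (leb T)"
proof -
  obtain s where s: "\<And>i. simple_function (leb T) (s i)"
    and lim: "\<And>t. t \<in> space (leb T) \<Longrightarrow> (\<lambda>i. s i t) \<longlonglongrightarrow> z t"
    using borel_measurable_implies_sequence_metric[OF z, of 0] by metis
  have "(\<lambda>t. F t (s i t)) \<in> borel_measurable (leb T)" for i
  proof (rule measurable_compose_countable'[where I = "s i ` space (leb T)" and f = "\<lambda>z t. F t z"])
    show "countable (s i ` space (leb T))" using s simple_functionD(1) countable_finite by blast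
    then show "s i \<in> leb T \<rightarrow>\<^sub>M count_space (s i ` space (leb T))"
      by (subst measurable_count_space_eq_countable) (use simple_functionD(2)[OF s[of i]] in auto)
  qed (rule F)
  then show ?thesis
  proof (rule borel_measurable_LIMSEQ_metric)
    fix t assume t: "t \<in> space (leb T)"
    then have "continuous_on UNIV (F t)" using cont by simp
    then show "(\<lambda>i. F t (s i t)) \<longlonglongrightarrow> F t (z t)"
      by (rule continuous_on_tendsto_compose[OF _ lim[OF t]]) auto
  qed
qed

section \<open>Coercive quadratic functionals\<close>

text \<open>The linear term dominates near 0: the trial value \<open>- a / q\<close> with a positive
  \<open>q\<close> larger than \<open>b\<close> would make the expression negative.\<close>

lemma linear_term_zero:
  fixes a b :: real
  assumes "\<And>s. 0 \<le> s * a + s\<^sup>2 * b"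
  shows "a = 0"
proof (rule ccontr)
  assume a: "a \<noteq> 0"
  define q where "q = \<bar>b\<bar> + 1"
  have q: "q > 0" "b < q" by (auto simp: q_def)
  have "(- a / q) * a + (- a / q)\<^sup>2 * b = (a\<^sup>2 / q\<^sup>2) * (b - q)"
    using q by (simp add: field_simps power2_eq_square)
  also have "\<dots> < 0" using q a by (intro mult_pos_neg) auto
  finally show False using assms[of "- a / q"] by simp
qed

text \<open>A minimizing sequence is Cauchy by the parallelogram identity.\<close>

lemma coercive_quadratic_stationary_point:
  fixes B :: "(real \<Rightarrow> 'a::euclidean_space) \<Rightarrow> (real \<Rightarrow> 'a) \<Rightarrow> real"
  assumes T: "0 \<le> T" and c: "0 < c" and K: "0 \<le> K"
    and B_add: "\<And>v w z. v \<in> L2 T \<Longrightarrow> w \<in> L2 T \<Longrightarrow> z \<in> L2 T \<Longrightarrow> B (\<lambda>t. v t + w t) z = B v z + B w z"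
    and B_scale: "\<And>a v z. v \<in> L2 T \<Longrightarrow> z \<in> L2 T \<Longrightarrow> B (\<lambda>t. a *\<^sub>R v t) z = a * B v z"
    and B_sym: "\<And>v w. v \<in> L2 T \<Longrightarrow> w \<in> L2 T \<Longrightarrow> B v w = B w v"
    and B_bound: "\<And>v w. v \<in> L2 T \<Longrightarrow> w \<in> L2 T \<Longrightarrow> \<bar>B v w\<bar> \<le> K * nrm2 T v * nrm2 T w"
    and B_coercive: "\<And>v. v \<in> L2 T \<Longrightarrow> c * (nrm2 T v)\<^sup>2 \<le> B v v"
    and l_add: "\<And>v w. v \<in> L2 T \<Longrightarrow> w \<in> L2 T \<Longrightarrow> l (\<lambda>t. v t + w t) = l v + l w"
    and l_scale: "\<And>a v. v \<in> L2 T \<Longrightarrow> l (\<lambda>t. a *\<^sub>R v t) = a * l v"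
    and l_bound: "\<And>v. v \<in> L2 T \<Longrightarrow> \<bar>l v\<bar> \<le> K * nrm2 T v"
  shows "\<exists>v\<in>L2 T. \<forall>w\<in>L2 T. l w + B v w = 0"
proof -
  define Q where "Q = (\<lambda>v. l v + B v v / 2)"
  have B_add2: "B z (\<lambda>t. v t + w t) = B z v + B z w" if "v \<in> L2 T" "w \<in> L2 T" "z \<in> L2 T" for v w z
    using that B_add[of v w z] B_sym[of z] by (simp add: L2_add(1))
  have B_scale2: "B z (\<lambda>t. a *\<^sub>R v t) = a * B z v" if "v \<in> L2 T" "z \<in> L2 T" for v z a
    using that B_scale[of v z a] B_sym[of z] by (simp add: L2_scale(1))
  have Q_add: "Q (\<lambda>t. v t + s *\<^sub>R w t) = Q v + s * (l w + B v w) + s\<^sup>2 * (B w w / 2)"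
    if "v \<in> L2 T" "w \<in> L2 T" for v w s
    using that B_sym[of w v]
    by (simp add: Q_def l_add l_scale B_add B_add2 B_scale B_scale2 L2_add(1) L2_scale(1) power2_eq_square field_simps)
  have Q_lower: "- (K\<^sup>2 / (2 * c)) \<le> Q v" if v: "v \<in> L2 T" for v
  proof -
    have "0 \<le> (c * nrm2 T v - K)\<^sup>2 / (2 * c)" using c by simp
    also have "\<dots> = c * (nrm2 T v)\<^sup>2 / 2 - K * nrm2 T v + K\<^sup>2 / (2 * c)"
      using c by (simp add: field_simps power2_eq_square)
    finally show ?thesis using B_coercive[OF v] l_bound[OF v] by (simp add: Q_def abs_le_iff)
  qed
  define m where "m = Inf (Q ` L2 T)"
  have ne: "Q ` L2 T \<noteq> {}" using L2_const[of 0 T] by blast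
  have bb: "bdd_below (Q ` L2 T)" using Q_lower by (intro bdd_belowI) auto
  have m_le: "m \<le> Q v" if "v \<in> L2 T" for v
    unfolding m_def using bb that by (intro cInf_lower) auto
  \<comment> \<open>The tolerance is chosen such that consecutive elements differ by at most
    \<open>(1/2) ^ n\<close> in norm, as \<open>L2_complete\<close> requires.\<close>
  have "\<exists>v\<in>L2 T. Q v < m + c / 8 * (1/4) ^ n" for n
  proof -
    have "Inf (Q ` L2 T) < m + c / 8 * (1/4) ^ n" using c by (simp add: m_def)
    then show ?thesis using cInf_lessD[OF ne] by fastforce
  qed
  then obtain v where v: "\<And>n. v n \<in> L2 T" and vQ: "\<And>n. Q (v n) < m + c / 8 * (1/4) ^ n"
    by metis
  have cauchy: "nrm2 T (\<lambda>t. v (Suc n) t - v n t) \<le> (1/2) ^ n" for n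
  proof (rule power2_le_imp_le)
    define d where "d = (\<lambda>t. v (Suc n) t - v n t)"
    have d: "d \<in> L2 T" unfolding d_def by (intro L2_diff v)
    have "Q (v (Suc n)) = Q (\<lambda>t. v n t + 1 *\<^sub>R d t)" by (simp add: d_def)
    then have 1: "Q (v (Suc n)) = Q (v n) + (l d + B (v n) d) + B d d / 2"
      using Q_add[OF v[of n] d, of 1] by simp
    \<comment> \<open>At the midpoint of \<open>v n\<close> and \<open>v (Suc n)\<close> the
      functional cannot fall below its infimum. Together with 1 this leaves a quarter of
      \<open>B d d\<close>, the excess in the parallelogram identity.\<close>
    have 2: "m \<le> Q (v n) + (1/2) * (l d + B (v n) d) + (1/2)\<^sup>2 * (B d d / 2)"
      using m_le[OF L2_add(1)[OF v[of n] L2_scale(1)[OF d, of "1/2"]]] Q_add[OF v[of n] d, of "1/2"] by linarith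
    have "c / 4 * (nrm2 T d)\<^sup>2 \<le> B d d / 4" using B_coercive[OF d] by simp
    also have "\<dots> \<le> Q (v (Suc n)) + Q (v n) - 2 * m"
    proof -
      define X where "X = l d + B (v n) d"
      have "m \<le> Q (v n) + X / 2 + B d d / 8" using 2 by (simp add: X_def power2_eq_square)
      with 1 show ?thesis unfolding X_def[symmetric] by linarith
    qed
    also have "\<dots> \<le> c / 8 * (1/4) ^ Suc n + c / 8 * (1/4) ^ n" using vQ[of n] vQ[of "Suc n"] by linarith
    also have "\<dots> \<le> c / 4 * (1/4) ^ n" using c by simp
    finally have "(nrm2 T d)\<^sup>2 \<le> (1/4) ^ n" using c by simp
    also have "\<dots> = ((1/2::real) ^ n)\<^sup>2" by (simp add: power2_eq_square power_mult_distrib[symmetric])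
    finally show "(nrm2 T (\<lambda>t. v (Suc n) t - v n t))\<^sup>2 \<le> ((1/2::real) ^ n)\<^sup>2" by (simp add: d_def)
  qed simp
  obtain w where w: "w \<in> L2 T" and wlim: "(\<lambda>n. nrm2 T (\<lambda>t. v n t - w t)) \<longlonglongrightarrow> 0"
    using L2_complete[OF T v cauchy] by blast
  \<comment> \<open>Expanding \<open>Q (v n)\<close> around \<open>w\<close> bounds
    \<open>Q w\<close> by a sequence that tends to \<open>m\<close>, which takes the place of a
    continuity argument.\<close>
  have "Q w \<le> m"
  proof (rule LIMSEQ_le_const)
    define e where "e = (\<lambda>n. nrm2 T (\<lambda>t. v n t - w t))"
    have "(\<lambda>n. m + c / 8 * (1/4) ^ n + (K * e n + K * nrm2 T w * e n + K * e n * e n / 2))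
       \<longlonglongrightarrow> m + c / 8 * 0 + (K * 0 + K * nrm2 T w * 0 + K * 0 * 0 / 2)"
      using wlim unfolding e_def[symmetric] by (intro tendsto_intros LIMSEQ_power_zero) auto
    then show "(\<lambda>n. m + c / 8 * (1/4) ^ n + (K * e n + K * nrm2 T w * e n + K * e n * e n / 2)) \<longlonglongrightarrow> m"
      by simp
    show "\<exists>N. \<forall>n\<ge>N. Q w \<le> m + c / 8 * (1/4) ^ n + (K * e n + K * nrm2 T w * e n + K * e n * e n / 2)"
    proof (intro exI allI impI)
      fix n
      define d where "d = (\<lambda>t. v n t - w t)"
      have d: "d \<in> L2 T" unfolding d_def by (intro L2_diff v w)
      have "Q (v n) = Q (\<lambda>t. w t + 1 *\<^sub>R d t)" by (simp add: d_def)
      then have "Q (v n) = Q w + (l d + B w d) + B d d / 2"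
        using Q_add[OF w d, of 1] by simp
      then show "Q w \<le> m + c / 8 * (1/4) ^ n + (K * e n + K * nrm2 T w * e n + K * e n * e n / 2)"
        using vQ[of n] l_bound[OF d] B_bound[OF w d] B_bound[OF d d]
        unfolding e_def d_def[symmetric] by (simp add: abs_le_iff)
    qed
  qed
  show ?thesis
  proof (intro bexI[OF _ w] ballI)
    fix z :: "real \<Rightarrow> 'a" assume z: "z \<in> L2 T"
    show "l z + B w z = 0"
    proof (rule linear_term_zero)
      fix s
      have "Q w \<le> Q (\<lambda>t. w t + s *\<^sub>R z t)"
        using \<open>Q w \<le> m\<close> m_le[OF L2_add(1)[OF w L2_scale(1)[OF z, of s]]] by linarith
      then show "0 \<le> s * (l z + B w z) + s\<^sup>2 * (B z z / 2)" using Q_add[OF w z, of s] by linarith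
    qed
  qed
qed

section \<open>Second derivatives\<close>

lemma norm_increment_unit_interval:
  fixes \<psi> :: "real \<Rightarrow> 'b::real_normed_vector"
  assumes "\<And>s. s \<in> {0..1} \<Longrightarrow> (\<psi> has_vector_derivative \<psi>' s) (at s)"
    and "\<And>s. s \<in> {0..1} \<Longrightarrow> norm (\<psi>' s) \<le> K"
  shows "norm (\<psi> 1 - \<psi> 0) \<le> K"
proof -
  have "norm (\<psi> 1 - \<psi> 0) \<le> K * norm (1 - 0 :: real)"
  proof (rule differentiable_bound[where S="{0..1}" and f'="\<lambda>s h. h *\<^sub>R \<psi>' s"])
    fix s :: real assume s: "s \<in> {0..1}"
    show "(\<psi> has_derivative (\<lambda>h. h *\<^sub>R \<psi>' s)) (at s within {0..1})"
      using assms(1)[OF s] unfolding has_vector_derivative_def by (rule has_derivative_at_withinI)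
    show "onorm (\<lambda>h. h *\<^sub>R \<psi>' s) \<le> K"
      by (rule onorm_le) (use assms(2)[OF s] in \<open>simp add: mult_left_mono mult.commute[of K]\<close>)
  qed auto
  then show ?thesis by simp
qed

lemma has_vector_derivative_along_line:
  assumes "(F has_derivative F') (at (a + s *\<^sub>R h))"
  shows "((\<lambda>s. F (a + s *\<^sub>R h)) has_vector_derivative F' h) (at s)"
proof -
  have "((\<lambda>s. a + s *\<^sub>R h) has_derivative (\<lambda>r. r *\<^sub>R h)) (at s)"
    by (auto intro!: derivative_eq_intros)
  from has_derivative_compose[OF this assms]
  have "((\<lambda>s. F (a + s *\<^sub>R h)) has_derivative (\<lambda>r. F' (r *\<^sub>R h))) (at s)" .
  moreover have "linear F'" using assms has_derivative_linear by blast
  ultimately show ?thesis unfolding has_vector_derivative_def by (simp add: linear_scale)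
qed

text \<open>The mean value inequality for \<open>F\<close> along the segment minus the linear
  function \<open>s *\<^sub>R c\<close>. With \<open>c = 0\<close> it gives Lipschitz estimates,
  with \<open>c\<close> the derivative at \<open>a\<close> it bounds remainders.\<close>

lemma increment_bound:
  assumes "\<And>w. (F has_derivative F' w) (at w)"
    and "\<And>s. s \<in> {0..1} \<Longrightarrow> norm (F' (a + s *\<^sub>R h) h - c) \<le> K"
  shows "norm (F (a + h) - F a - c) \<le> K"
proof -
  let ?\<psi> = "\<lambda>s. F (a + s *\<^sub>R h) - s *\<^sub>R c"
  have "(?\<psi> has_vector_derivative F' (a + s *\<^sub>R h) h - c) (at s)" for s
    by (auto intro!: derivative_eq_intros has_vector_derivative_along_line assms(1))
  then have "norm (?\<psi> 1 - ?\<psi> 0) \<le> K"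
    by (rule norm_increment_unit_interval) (use assms(2) in auto)
  then show ?thesis by (simp add: algebra_simps)
qed

text \<open>The derivatives are parameters, so that the estimates do not depend on how they were
  obtained. In \<open>D2 z h k\<close> the direction of the second differentiation comes first, as
  in \<open>second_deriv\<close>.\<close>

definition twice_deriv ::
    "real \<Rightarrow> ('z::euclidean_space \<Rightarrow> 'y::real_normed_vector) \<Rightarrow> ('z \<Rightarrow> 'z \<Rightarrow> 'y) \<Rightarrow>
     ('z \<Rightarrow> 'z \<Rightarrow> 'z \<Rightarrow> 'y) \<Rightarrow> bool" where
  "twice_deriv L \<phi> D D2 \<longleftrightarrow>
     (\<forall>z. (\<phi> has_derivative D z) (at z)) \<and>
     (\<forall>z k. ((\<lambda>w. D w k) has_derivative (\<lambda>h. D2 z h k)) (at z)) \<and>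
     (\<forall>z h k. norm (D2 z h k) \<le> L * norm h * norm k)"

lemma twice_derivD:
  assumes "twice_deriv L \<phi> D D2"
  shows "(\<phi> has_derivative D z) (at z)"
    and "((\<lambda>w. D w k) has_derivative (\<lambda>h. D2 z h k)) (at z)"
    and "norm (D2 z h k) \<le> L * norm h * norm k"
  using assms by (auto simp: twice_deriv_def)

text \<open>Linearity in the inner direction is inherited from \<open>D w\<close>: both sides are
  derivatives of one function of \<open>w\<close>, and derivatives are unique.\<close>

lemma linear_second_derivative:
  assumes d1: "\<And>z. (\<phi> has_derivative D z) (at z)"
    and d2: "\<And>k. ((\<lambda>w. D w k) has_derivative (\<lambda>h. D2 h k)) (at z)"
  shows "linear (D2 h)"
proof (rule linearI)
  have lin: "linear (D w)" for w using d1 has_derivative_linear by blast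
  {
    fix k l
    have "((\<lambda>w. D w k + D w l) has_derivative (\<lambda>h. D2 h k + D2 h l)) (at z)"
      by (intro has_derivative_add d2)
    then have "((\<lambda>w. D w (k + l)) has_derivative (\<lambda>h. D2 h k + D2 h l)) (at z)"
      by (simp add: linear_add[OF lin])
    from has_derivative_unique[OF d2 this] show "D2 h (k + l) = D2 h k + D2 h l"
      by (rule fun_cong)
  next
    fix c k
    have "((\<lambda>w. c *\<^sub>R D w k) has_derivative (\<lambda>h. c *\<^sub>R D2 h k)) (at z)"
      by (intro has_derivative_scaleR_right d2)
    then have "((\<lambda>w. D w (c *\<^sub>R k)) has_derivative (\<lambda>h. c *\<^sub>R D2 h k)) (at z)"
      by (simp add: linear_scale[OF lin])
    from has_derivative_unique[OF d2 this] show "D2 h (c *\<^sub>R k) = c *\<^sub>R D2 h k"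
      by (rule fun_cong)
  }
qed

lemma twice_deriv_linear:
  assumes "twice_deriv L \<phi> D D2"
  shows "linear (D z)" "linear (\<lambda>h. D2 z h k)" "linear (D2 z h)"
  using has_derivative_linear[OF twice_derivD(1)[OF assms]] has_derivative_linear[OF twice_derivD(2)[OF assms]]
    linear_second_derivative[OF twice_derivD(1,2)[OF assms]] by auto

lemma twice_deriv_first_increment:
  assumes "twice_deriv L \<phi> D D2"
  shows "norm (D (z + h) k - D z k) \<le> L * norm h * norm k"
  using increment_bound[of "\<lambda>w. D w k" "\<lambda>w h. D2 w h k" z h 0 "L * norm h * norm k"]
    twice_derivD[OF assms] by simp

lemma twice_deriv_first_order_remainder:
  assumes "twice_deriv L \<phi> D D2" "0 \<le> L"
  shows "norm (\<phi> (z + h) - \<phi> z - D z h) \<le> L * (norm h)\<^sup>2"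
proof (rule increment_bound)
  show "(\<phi> has_derivative D w) (at w)" for w by (rule twice_derivD(1)[OF assms(1)])
  fix s :: real assume s: "s \<in> {0..1}"
  have "norm (D (z + s *\<^sub>R h) h - D z h) \<le> L * norm (s *\<^sub>R h) * norm h"
    by (rule twice_deriv_first_increment[OF assms(1)])
  also have "\<dots> \<le> L * (1 * norm h) * norm h"
    using s assms(2) by (intro mult_left_mono mult_right_mono) (auto simp: mult_left_le_one_le)
  finally show "norm (D (z + s *\<^sub>R h) h - D z h) \<le> L * (norm h)\<^sup>2" by (simp add: power2_eq_square)
qed

text \<open>Two applications of the mean value inequality, first to the function and then to its
  derivative. Factors in the unit interval are estimated by 1, because only the order of the
  remainder matters later.\<close>

lemma twice_deriv_second_order_remainder:
  assumes d: "twice_deriv L \<phi> D D2"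
    and K: "\<And>s. s \<in> {0..1} \<Longrightarrow> norm (D2 (z + s *\<^sub>R h) h h - D2 z h h) \<le> K"
  shows "norm (\<phi> (z + h) - \<phi> z - D z h - (1/2) *\<^sub>R D2 z h h) \<le> K"
proof -
  let ?\<psi> = "\<lambda>s. \<phi> (z + s *\<^sub>R h) - s *\<^sub>R D z h - (s\<^sup>2 / 2) *\<^sub>R D2 z h h"
  let ?\<psi>' = "\<lambda>s. D (z + s *\<^sub>R h) h - D z h - s *\<^sub>R D2 z h h"
  have "norm (?\<psi> 1 - ?\<psi> 0) \<le> K"
  proof (rule norm_increment_unit_interval)
    fix s :: real assume s: "s \<in> {0..1}"
    show "(?\<psi> has_vector_derivative ?\<psi>' s) (at s)"
      by (auto intro!: derivative_eq_intros has_vector_derivative_along_line twice_derivD(1)[OF d])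
    have "norm (D (z + s *\<^sub>R h) h - D z h - D2 z (s *\<^sub>R h) h) \<le> K"
    proof (rule increment_bound[where F="\<lambda>w. D w h" and F'="\<lambda>w k. D2 w k h"])
      show "((\<lambda>w. D w h) has_derivative (\<lambda>k. D2 w k h)) (at w)" for w
        by (rule twice_derivD(2)[OF d])
      fix r :: real assume r: "r \<in> {0..1}"
      have rs: "r * s \<in> {0..1}" using r s by (auto simp: mult_le_one)
      have "D2 (z + r *\<^sub>R s *\<^sub>R h) (s *\<^sub>R h) h - D2 z (s *\<^sub>R h) h
          = s *\<^sub>R (D2 (z + (r * s) *\<^sub>R h) h h - D2 z h h)"
        by (simp add: linear_scale[OF twice_deriv_linear(2)[OF d]] scaleR_diff_right)
      also have "norm \<dots> \<le> 1 * K"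
        unfolding norm_scaleR by (rule mult_mono) (use s K[OF rs] in auto)
      finally show "norm (D2 (z + r *\<^sub>R s *\<^sub>R h) (s *\<^sub>R h) h - D2 z (s *\<^sub>R h) h) \<le> K" by simp
    qed
    then show "norm (?\<psi>' s) \<le> K" by (simp add: linear_scale[OF twice_deriv_linear(2)[OF d]])
  qed
  then show ?thesis by (simp add: algebra_simps)
qed

lemma norm_diff_le_via:
  fixes a b :: "'a::real_normed_vector"
  assumes "p = q" shows "norm (a - b) \<le> norm (p - a) + norm (q - b)"
  using norm_triangle_ineq4[of "q - b" "p - a"] assms by simp

text \<open>Both orders of the mixed second difference approximate the same symmetric expression.\<close>

lemma twice_deriv_symmetric:
  assumes d: "twice_deriv L \<phi> D D2" and K: "0 \<le> K"
    and lip: "\<And>z z' h k. norm (D2 z h k - D2 z' h k) \<le> K * norm (z - z') * norm h * norm k"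
  shows "D2 z h k = D2 z k h"
proof -
  let ?\<Delta> = "\<lambda>h k. \<phi> (z + h + k) - \<phi> (z + k) - \<phi> (z + h) + \<phi> z"
  have *: "norm (?\<Delta> h k - D2 z h k) \<le> K * (norm h + norm k) * norm h * norm k" for h k
  proof -
    have "norm ((\<lambda>w. \<phi> (w + h) - \<phi> w) (z + k) - (\<lambda>w. \<phi> (w + h) - \<phi> w) z - D2 z h k)
        \<le> K * (norm h + norm k) * norm h * norm k"
    proof (rule increment_bound[where F'="\<lambda>w k. D (w + h) k - D w k"])
      fix w
      have "((\<lambda>w. \<phi> (w + h)) has_derivative (\<lambda>k. D (w + h) k)) (at w)"
      proof -
        have "((\<lambda>w. w + h) has_derivative (\<lambda>k. k)) (at w)" by (auto intro!: derivative_eq_intros)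
        from has_derivative_compose[OF this twice_derivD(1)[OF d]] show ?thesis .
      qed
      then show "((\<lambda>w. \<phi> (w + h) - \<phi> w) has_derivative (\<lambda>k. D (w + h) k - D w k)) (at w)"
        by (intro has_derivative_diff twice_derivD(1)[OF d])
      fix s :: real assume s: "s \<in> {0..1}"
      show "norm (D (z + s *\<^sub>R k + h) k - D (z + s *\<^sub>R k) k - D2 z h k)
        \<le> K * (norm h + norm k) * norm h * norm k"
      proof (rule increment_bound[where F="\<lambda>w. D w k" and F'="\<lambda>w h. D2 w h k"])
        show "((\<lambda>w. D w k) has_derivative (\<lambda>h. D2 w h k)) (at w)" for w
          by (rule twice_derivD(2)[OF d])
        fix r :: real assume r: "r \<in> {0..1}"
        have "norm (z + s *\<^sub>R k + r *\<^sub>R h - z) \<le> norm (s *\<^sub>R k) + norm (r *\<^sub>R h)"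
          using norm_triangle_ineq[of "s *\<^sub>R k" "r *\<^sub>R h"] by simp
        also have "\<dots> \<le> 1 * norm k + 1 * norm h"
          using r s unfolding norm_scaleR by (intro add_mono mult_right_mono) auto
        finally have "norm (z + s *\<^sub>R k + r *\<^sub>R h - z) \<le> norm h + norm k" by simp
        then have "K * norm (z + s *\<^sub>R k + r *\<^sub>R h - z) * norm h * norm k
            \<le> K * (norm h + norm k) * norm h * norm k"
          using K by (intro mult_right_mono mult_left_mono) auto
        with lip show "norm (D2 (z + s *\<^sub>R k + r *\<^sub>R h) h k - D2 z h k)
            \<le> K * (norm h + norm k) * norm h * norm k"
          by (rule order_trans)
      qed
    qed
    then show ?thesis by (simp add: algebra_simps)
  qed
  define C where "C = 2 * K * (norm h + norm k) * norm h * norm k"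
  \<comment> \<open>Scaling both directions by \<open>e\<close> multiplies the second derivative by
    \<open>e * e\<close>, whereas the error of the second difference is cubic in
    \<open>e\<close>.\<close>
  have "norm (D2 z h k - D2 z k h) \<le> e * C" if e: "e > 0" for e
  proof -
    have sc: "D2 z (e *\<^sub>R h) (e *\<^sub>R k) = (e * e) *\<^sub>R D2 z h k" for h k
      by (simp add: linear_scale[OF twice_deriv_linear(2)[OF d]] linear_scale[OF twice_deriv_linear(3)[OF d]])
    have "?\<Delta> (e *\<^sub>R h) (e *\<^sub>R k) = ?\<Delta> (e *\<^sub>R k) (e *\<^sub>R h)" by (simp add: algebra_simps)
    from norm_diff_le_via[OF this] have "norm (D2 z (e *\<^sub>R h) (e *\<^sub>R k) - D2 z (e *\<^sub>R k) (e *\<^sub>R h))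
      \<le> norm (?\<Delta> (e *\<^sub>R h) (e *\<^sub>R k) - D2 z (e *\<^sub>R h) (e *\<^sub>R k))
        + norm (?\<Delta> (e *\<^sub>R k) (e *\<^sub>R h) - D2 z (e *\<^sub>R k) (e *\<^sub>R h))" .
    also have "\<dots> \<le> (e * e) * (e * C)"
      using *[of "e *\<^sub>R h" "e *\<^sub>R k"] *[of "e *\<^sub>R k" "e *\<^sub>R h"] e
      by (simp add: C_def algebra_simps)
    finally have "(e * e) * norm (D2 z h k - D2 z k h) \<le> (e * e) * (e * C)"
      unfolding sc by (simp add: scaleR_diff_right[symmetric])
    then show ?thesis using e by simp
  qed
  then have "norm (D2 z h k - D2 z k h) \<le> 0 + e" if "e > 0" for e
  proof -
    have C: "0 \<le> C" using K by (simp add: C_def)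
    have "norm (D2 z h k - D2 z k h) \<le> e / (1 + C) * C"
      using \<open>\<And>e. e > 0 \<Longrightarrow> norm (D2 z h k - D2 z k h) \<le> e * C\<close>[of "e / (1 + C)"] that C by simp
    also have "\<dots> \<le> e" using that C by (simp add: field_simps)
    finally show ?thesis by simp
  qed
  then have "norm (D2 z h k - D2 z k h) \<le> 0" by (rule field_le_epsilon)
  then show ?thesis by simp
qed

text \<open>The second conjunct expresses that the second derivative in \<open>u\<close> does not depend on \<open>u\<close>.\<close>

definition lipschitz_block ::
    "real \<Rightarrow> ('x::euclidean_space \<times> 'u::euclidean_space \<Rightarrow> 'x \<times> 'u \<Rightarrow> 'x \<times> 'u \<Rightarrow> 'y::real_normed_vector) \<Rightarrow> bool" where
  "lipschitz_block L D2 \<longleftrightarrow>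
     (\<forall>z z' h k. norm (D2 z h k - D2 z' h k)
        \<le> L * (norm (fst z - fst z') + norm (snd z - snd z')) * norm h * norm k) \<and>
     (\<forall>x u u' h k. D2 (x, u) (0, h) (0, k) = D2 (x, u') (0, h) (0, k))"

lemma lipschitz_blockD:
  assumes "lipschitz_block L D2"
  shows "norm (D2 z h k - D2 z' h k) \<le> L * (norm (fst z - fst z') + norm (snd z - snd z')) * norm h * norm k"
    and "norm (D2 z (0, h2) (0, k2) - D2 z' (0, h2) (0, k2)) \<le> L * norm (fst z - fst z') * norm h2 * norm k2"
proof -
  show 1: "norm (D2 z h k - D2 z' h k) \<le> L * (norm (fst z - fst z') + norm (snd z - snd z')) * norm h * norm k"
    for z z' h k using assms unfolding lipschitz_block_def by blast
  \<comment> \<open>In this block the control component of the base point can be exchanged freely,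
    so that only the distance of the states remains.\<close>
  have "D2 z (0, h2) (0, k2) = D2 (fst z, snd z') (0, h2) (0, k2)"
    using assms unfolding lipschitz_block_def by (metis prod.collapse)
  then show "norm (D2 z (0, h2) (0, k2) - D2 z' (0, h2) (0, k2)) \<le> L * norm (fst z - fst z') * norm h2 * norm k2"
    using 1[of "(fst z, snd z')" "(0, h2)" "(0, k2)" z'] by (simp add: norm_Pair)
qed

lemma norm_fst_snd_le: "norm (fst h) \<le> norm h" "norm (snd h) \<le> norm h"
  by (metis norm_fst_le prod.collapse, metis norm_snd_le prod.collapse)

lemma norm_le_fst_snd: "norm h \<le> norm (fst h) + norm (snd h)"
  by (metis norm_Pair_le prod.collapse)

lemma lipschitz_block_norm:
  assumes lip: "lipschitz_block L D2" and L: "0 \<le> L"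
  shows "norm (D2 z h k - D2 z' h k) \<le> 2 * L * norm (z - z') * norm h * norm k"
proof -
  have "norm (fst z - fst z') + norm (snd z - snd z') \<le> 2 * norm (z - z')"
    using norm_fst_snd_le[of "z - z'"] by simp
  then have "L * (norm (fst z - fst z') + norm (snd z - snd z')) * norm h * norm k
      \<le> L * (2 * norm (z - z')) * norm h * norm k"
    using L by (intro mult_right_mono mult_left_mono) auto
  from order_trans[OF lipschitz_blockD(1)[OF lip] this] show ?thesis by (simp add: mult_ac)
qed

lemma twice_deriv_block_symmetric:
  assumes d: "twice_deriv L \<phi> D D2" and lip: "lipschitz_block L D2" and L: "0 \<le> L"
  shows "D2 z h k = D2 z k h"
  by (rule twice_deriv_symmetric[OF d _ lipschitz_block_norm[OF lip L]]) (use L in simp)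

lemma bilinear_split_pair:
  fixes A :: "'x::real_vector \<times> 'u::real_vector \<Rightarrow> 'x \<times> 'u \<Rightarrow> 'y::real_vector"
  assumes "\<And>k. linear (\<lambda>h. A h k)" "\<And>h. linear (A h)"
  shows "A h k = A (fst h, 0) (fst k, 0) + A (fst h, 0) (0, snd k) + A (0, snd h) (fst k, 0) + A (0, snd h) (0, snd k)"
proof -
  have "h = (fst h, 0) + (0, snd h)" "k = (fst k, 0) + (0, snd k)" by (auto simp: prod_eq_iff)
  then have "A h k = A ((fst h, 0) + (0, snd h)) ((fst k, 0) + (0, snd k))" by metis
  then show ?thesis
    by (simp only: linear_add[OF assms(1)] linear_add[OF assms(2)] ac_simps)
qed

text \<open>Since the second block does not depend on the second variable, every term of the remainder
  carries a factor \<open>norm (fst h)\<close>.\<close>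

lemma twice_deriv_block_remainder:
  assumes d: "twice_deriv L \<phi> D D2" and lip: "lipschitz_block L D2" and L: "0 \<le> L"
  shows "norm (\<phi> (z + h) - \<phi> z - D z h - (1/2) *\<^sub>R D2 z h h) \<le> 7 * L * norm (fst h) * (norm h)\<^sup>2"
proof (rule twice_deriv_second_order_remainder[OF d])
  fix s :: real assume s: "s \<in> {0..1}"
  define z' where "z' = z + s *\<^sub>R h"
  define A where "A = (\<lambda>h k. D2 z' h k - D2 z h k)"
  define X where "X = norm (fst h)"
  define N where "N = norm h"
  have XN: "0 \<le> X" "X \<le> N" "norm (snd h) \<le> N" "0 \<le> N"
    using norm_fst_snd_le[of h] by (auto simp: X_def N_def)
  have l1: "linear (\<lambda>h. A h k)" and l2: "linear (A h)" for h k
    unfolding A_def by (intro linear_compose_sub twice_deriv_linear[OF d])+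
  have s1: "\<bar>s\<bar> * r \<le> r" if "0 \<le> r" for r :: real
    using s that by (simp add: mult_left_le_one_le)
  have fz: "norm (fst z' - fst z) \<le> X" "norm (snd z' - snd z) \<le> N"
    using s1[of "norm (fst h)"] s1[of "norm (snd h)"] XN by (auto simp: z'_def X_def)
  have A1: "norm (A p q) \<le> L * (2 * N) * norm p * norm q" for p q
  proof -
    have "norm (A p q) \<le> L * (norm (fst z' - fst z) + norm (snd z' - snd z)) * norm p * norm q"
      unfolding A_def by (rule lipschitz_blockD(1)[OF lip])
    also have "\<dots> \<le> L * (2 * N) * norm p * norm q"
      using fz XN L by (intro mult_right_mono mult_left_mono) auto
    finally show ?thesis .
  qed
  have A2: "norm (A p q) \<le> L * (2 * N) * (X * N)" if "norm p * norm q \<le> X * N" for p q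
  proof -
    have "norm (A p q) \<le> L * (2 * N) * (norm p * norm q)" using A1[of p q] by (simp only: mult.assoc)
    also have "\<dots> \<le> L * (2 * N) * (X * N)" by (rule mult_left_mono[OF that]) (use XN L in simp)
    finally show ?thesis .
  qed
  have a: "norm (A (fst h, 0) (fst h, 0)) \<le> L * (2 * N) * (X * N)"
    by (rule A2) (use XN in \<open>simp add: norm_Pair X_def[symmetric] mult_left_mono\<close>)
  have b: "norm (A (fst h, 0) (0, snd h)) \<le> L * (2 * N) * (X * N)"
    by (rule A2) (use XN in \<open>simp add: norm_Pair X_def[symmetric] mult_left_mono\<close>)
  have c: "norm (A (0, snd h) (fst h, 0)) \<le> L * (2 * N) * (X * N)"
    by (rule A2) (use XN in \<open>simp add: norm_Pair X_def[symmetric] mult_left_mono mult.commute[of _ X]\<close>)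
  have e: "norm (A (0, snd h) (0, snd h)) \<le> L * X * N * N"
  proof -
    have "norm (A (0, snd h) (0, snd h)) \<le> L * norm (fst z' - fst z) * norm (snd h) * norm (snd h)"
      unfolding A_def by (rule lipschitz_blockD(2)[OF lip])
    also have "\<dots> \<le> L * X * N * N"
      using fz XN L by (intro mult_mono mult_nonneg_nonneg) auto
    finally show ?thesis .
  qed
  have "norm (A h h) \<le> norm (A (fst h, 0) (fst h, 0)) + norm (A (fst h, 0) (0, snd h))
      + norm (A (0, snd h) (fst h, 0)) + norm (A (0, snd h) (0, snd h))"
    unfolding bilinear_split_pair[of A h h, OF l1 l2] by norm
  \<comment> \<open>The three blocks that involve a state direction contribute 2 each, the pure
    control block contributes 1.\<close>
  also have "\<dots> \<le> 7 * L * X * N\<^sup>2"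
    using a b c e by (simp add: power2_eq_square algebra_simps)
  finally show "norm (D2 (z + s *\<^sub>R h) h h - D2 z h h) \<le> 7 * L * norm (fst h) * (norm h)\<^sup>2"
    by (simp add: A_def z'_def X_def N_def)
qed

text \<open>The vector that represents a linear functional. As an explicit finite sum it makes
  gradients measurable in time.\<close>

definition riesz :: "('a::euclidean_space \<Rightarrow> real) \<Rightarrow> 'a" where
  "riesz l = (\<Sum>i\<in>Basis. l i *\<^sub>R i)"

lemma riesz_inner: assumes "linear l" shows "riesz l \<bullet> h = l h"
proof -
  have "l h = l (\<Sum>i\<in>Basis. (h \<bullet> i) *\<^sub>R i)" by (simp add: euclidean_representation)
  also have "\<dots> = (\<Sum>i\<in>Basis. (h \<bullet> i) *\<^sub>R l i)"
    by (simp only: linear_sum[OF assms] linear_scale[OF assms])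
  also have "\<dots> = riesz l \<bullet> h"
    unfolding riesz_def inner_sum_left by (intro sum.cong) (simp_all add: inner_commute mult.commute)
  finally show ?thesis by simp
qed

lemma riesz_unique:
  assumes "\<And>h. d \<bullet> h = l h" shows "riesz l = d"
  unfolding riesz_def using euclidean_representation[of d] by (simp add: assms)

lemma riesz_measurable:
  "(\<And>i. i \<in> Basis \<Longrightarrow> (\<lambda>t. l t i) \<in> borel_measurable M) \<Longrightarrow> (\<lambda>t. riesz (l t)) \<in> borel_measurable M"
  unfolding riesz_def by (intro borel_measurable_sum borel_measurable_scaleR) auto

lemma gradient_eq_riesz:
  assumes "(\<phi> has_derivative D) (at z)" shows "gradient \<phi> z = riesz D"
  unfolding gradient_def
proof (rule the_equality)
  have lin: "linear D" using assms has_derivative_linear by blast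
  have "(\<lambda>h. h \<bullet> riesz D) = D" by (simp add: fun_eq_iff inner_commute[of _ "riesz D"] riesz_inner[OF lin])
  then show "GDERIV \<phi> z :> riesz D" using assms by (simp add: gderiv_def)
  fix d assume "GDERIV \<phi> z :> d"
  then have "(\<lambda>h. h \<bullet> d) = D" using assms has_derivative_unique by (auto simp: gderiv_def)
  then show "d = riesz D" by (intro riesz_unique[symmetric]) (auto simp: inner_commute fun_eq_iff)
qed

text \<open>The Cauchy-Schwarz inequality over pairs of basis vectors: an operator norm is at most
  the corresponding Frobenius norm.\<close>

lemma norm_bilinear_le_array_norm:
  fixes A :: "'a::euclidean_space \<Rightarrow> 'a \<Rightarrow> 'b::real_normed_vector"
  assumes "\<And>k. linear (\<lambda>h. A h k)" "\<And>h. linear (A h)"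
  shows "norm (A h k) \<le> array_norm A * norm h * norm k"
proof -
  have n: "(norm w)\<^sup>2 = (\<Sum>i\<in>Basis. (w \<bullet> i)\<^sup>2)" for w :: 'a
    unfolding power2_norm_eq_inner by (subst euclidean_inner) (simp add: power2_eq_square)
  have "A h k = A (\<Sum>i\<in>Basis. (h \<bullet> i) *\<^sub>R i) k" by (simp add: euclidean_representation)
  also have "\<dots> = (\<Sum>i\<in>Basis. (h \<bullet> i) *\<^sub>R A i k)"
    by (simp only: linear_sum[OF assms(1)] linear_scale[OF assms(1)])
  also have "\<dots> = (\<Sum>i\<in>Basis. (h \<bullet> i) *\<^sub>R A i (\<Sum>j\<in>Basis. (k \<bullet> j) *\<^sub>R j))"
    by (simp add: euclidean_representation)
  also have "\<dots> = (\<Sum>i\<in>Basis. \<Sum>j\<in>Basis. ((h \<bullet> i) * (k \<bullet> j)) *\<^sub>R A i j)"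
    by (simp only: linear_sum[OF assms(2)] linear_scale[OF assms(2)] scaleR_sum_right scaleR_scaleR)
  also have "\<dots> = (\<Sum>(i, j)\<in>Basis \<times> Basis. ((h \<bullet> i) * (k \<bullet> j)) *\<^sub>R A i j)"
    by (simp add: sum.cartesian_product)
  also have "norm \<dots> \<le> (\<Sum>(i, j)\<in>Basis \<times> Basis. \<bar>(h \<bullet> i) * (k \<bullet> j)\<bar> * norm (A i j))"
    by (rule order_trans[OF norm_sum]) (simp add: split_def)
  also have "\<dots> \<le> sqrt ((\<Sum>(i, j)\<in>Basis \<times> Basis. ((h \<bullet> i) * (k \<bullet> j))\<^sup>2) * (\<Sum>(i, j)\<in>Basis \<times> Basis. (norm (A i j))\<^sup>2))"
    using Cauchy_Schwarz_ineq_sum[of "\<lambda>(i, j). \<bar>(h \<bullet> i) * (k \<bullet> j)\<bar>" "\<lambda>(i, j). norm (A i j)" "Basis \<times> Basis"]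
    by (intro real_le_rsqrt) (simp add: split_def)
  also have "(\<Sum>(i, j)\<in>Basis \<times> Basis. ((h \<bullet> i) * (k \<bullet> j))\<^sup>2) = (norm h)\<^sup>2 * (norm k)\<^sup>2"
    unfolding sum.cartesian_product[symmetric] power_mult_distrib n sum_product ..
  finally show ?thesis
    by (simp add: array_norm_def real_sqrt_mult sum.cartesian_product mult_ac)
qed

lemma twice_differentiable_twice_deriv:
  fixes \<phi> :: "'z::euclidean_space \<Rightarrow> 'y::real_normed_vector"
  assumes td: "twice_differentiable \<phi>" and L: "\<And>z. array_norm (second_deriv \<phi> z) \<le> L"
  shows "twice_deriv L \<phi> (\<lambda>z. frechet_derivative \<phi> (at z)) (second_deriv \<phi>)"
proof -
  let ?D = "\<lambda>z. frechet_derivative \<phi> (at z)"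
  have d1: "(\<phi> has_derivative ?D z) (at z)" for z
    using td by (simp add: twice_differentiable_def frechet_derivative_works[symmetric])
  have d2: "((\<lambda>w. ?D w k) has_derivative (\<lambda>h. second_deriv \<phi> z h k)) (at z)" for z k
    using td unfolding second_deriv_def
    by (simp add: twice_differentiable_def frechet_derivative_works[symmetric])
  have lin1: "linear (\<lambda>h. second_deriv \<phi> z h k)" for z k using d2 has_derivative_linear by blast
  have lin2: "linear (second_deriv \<phi> z h)" for z h by (rule linear_second_derivative[OF d1 d2])
  have "norm (second_deriv \<phi> z h k) \<le> L * norm h * norm k" for z h k
  proof -
    have "norm (second_deriv \<phi> z h k) \<le> array_norm (second_deriv \<phi> z) * norm h * norm k"
      by (rule norm_bilinear_le_array_norm[OF lin1 lin2])
    also have "\<dots> \<le> L * norm h * norm k"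
      by (intro mult_right_mono L) auto
    finally show ?thesis .
  qed
  then show ?thesis unfolding twice_deriv_def using d1 d2 by blast
qed

lemma second_deriv_lipschitz:
  assumes d: "twice_deriv L \<phi> D D2"
    and K: "array_norm (\<lambda>h k. D2 z h k - D2 z' h k) \<le> K"
  shows "norm (D2 z h k - D2 z' h k) \<le> K * norm h * norm k"
proof -
  have "norm (D2 z h k - D2 z' h k) \<le> array_norm (\<lambda>h k. D2 z h k - D2 z' h k) * norm h * norm k"
    by (rule norm_bilinear_le_array_norm)
      (intro linear_compose_sub twice_deriv_linear[OF d])+
  also have "\<dots> \<le> K * norm h * norm k" by (intro mult_right_mono K) auto
  finally show ?thesis .
qed

section \<open>Partial derivatives, Jacobians and transposes\<close>

lemma has_derivative_partial:
  assumes "(\<phi> has_derivative D) (at (x, u))"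
  shows "((\<lambda>\<xi>. \<phi> (\<xi>, u)) has_derivative (\<lambda>\<eta>. D (\<eta>, 0))) (at x)"
    and "((\<lambda>\<upsilon>. \<phi> (x, \<upsilon>)) has_derivative (\<lambda>\<eta>. D (0, \<eta>))) (at u)"
proof -
  have "((\<lambda>\<xi>. (\<xi>, u)) has_derivative (\<lambda>\<eta>. (\<eta>, 0))) (at x)"
    "((\<lambda>\<upsilon>. (x, \<upsilon>)) has_derivative (\<lambda>\<eta>. (0, \<eta>))) (at u)"
    by (auto intro!: derivative_eq_intros)
  from has_derivative_compose[OF this(1) assms] has_derivative_compose[OF this(2) assms]
  show "((\<lambda>\<xi>. \<phi> (\<xi>, u)) has_derivative (\<lambda>\<eta>. D (\<eta>, 0))) (at x)"
    "((\<lambda>\<upsilon>. \<phi> (x, \<upsilon>)) has_derivative (\<lambda>\<eta>. D (0, \<eta>))) (at u)" by auto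
qed

lemma second_deriv_eq:
  assumes "\<And>z. (\<phi> has_derivative D z) (at z)"
    and "((\<lambda>w. D w k) has_derivative D2) (at z)"
  shows "second_deriv \<phi> z h k = D2 h"
proof -
  have "frechet_derivative \<phi> (at w) = D w" for w using assms(1) by (metis frechet_derivative_at)
  then show ?thesis
    unfolding second_deriv_def using frechet_derivative_at[OF assms(2)] by simp
qed

lemma second_deriv_partial:
  assumes "twice_deriv L \<phi> D D2"
  shows "second_deriv (\<lambda>\<upsilon>. \<phi> (x, \<upsilon>)) u h k = D2 (x, u) (0, h) (0, k)"
  by (rule second_deriv_eq[where D="\<lambda>\<upsilon> k. D (x, \<upsilon>) (0, k)"])
    (auto intro: has_derivative_partial(2) twice_derivD[OF assms]
       has_derivative_partial(2)[OF twice_derivD(2)[OF assms]])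

lemma jacobian_mult:
  fixes D :: "real^'n \<Rightarrow> real^'m"
  assumes "(\<phi> has_derivative D) (at x)" shows "jacobian \<phi> (at x) *v h = D h"
proof -
  have "frechet_derivative \<phi> (at x) = D" using assms by (metis frechet_derivative_at)
  moreover have "linear D" using assms has_derivative_linear by blast
  ultimately show ?thesis
    unfolding jacobian_def using matrix_vector_mul(2)[of D, THEN fun_cong, of h] by simp
qed

lemma norm_matrix_vector_le: "norm (A *v x) \<le> norm A * norm (x :: real^'n)" for A :: "real^'n^'m"
proof -
  have "norm (A *v x) = L2_set (\<lambda>i. norm (A $ i \<bullet> x)) UNIV"
    by (simp add: norm_vec_def matrix_mult_dot)
  also have "\<dots> \<le> L2_set (\<lambda>i. norm x * norm (A $ i)) UNIV"
    by (rule L2_set_mono) (auto simp: Cauchy_Schwarz_ineq2 mult.commute[of "norm x"])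
  also have "\<dots> = norm x * norm A"
    by (simp add: norm_vec_def L2_set_right_distrib)
  finally show ?thesis by (simp add: mult.commute)
qed

lemma transpose_mult_eq_riesz: "transpose A *v p = riesz (\<lambda>h. (A *v h) \<bullet> p)"
  for A :: "real^'n^'m" and p :: "real^'m"
  by (rule riesz_unique[symmetric]) (metis dot_lmul_matrix inner_commute vector_transpose_matrix)

section \<open>The control system\<close>

lemma integrable_leb_bound:
  fixes F :: "real \<Rightarrow> 'a::euclidean_space"
  assumes "F \<in> borel_measurable (leb T)" "integrable (leb T) k" "\<And>t. t \<in> {0..T} \<Longrightarrow> norm (F t) \<le> k t"
  shows "integrable (leb T) F" "norm (LINT t|leb T. F t) \<le> (LINT t|leb T. k t)"
proof -
  show i: "integrable (leb T) F"
  proof (rule Bochner_Integration.integrable_bound[OF assms(2,1)], rule AE_I2)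
    fix t assume "t \<in> space (leb T)"
    then have "norm (F t) \<le> k t" using assms(3) by simp
    then show "norm (F t) \<le> norm (k t)" by simp
  qed
  show "norm (LINT t|leb T. F t) \<le> (LINT t|leb T. k t)"
    by (rule Bochner_Integration.integral_norm_bound_integral[OF i assms(2)]) (use assms(3) in simp)
qed

lemma LIMSEQ_inverse_bound:
  fixes x :: "nat \<Rightarrow> 'a::real_normed_vector"
  assumes "\<And>n. norm (x n - c) \<le> C * inverse (real (Suc n))"
  shows "x \<longlonglongrightarrow> c"
proof (rule LIM_zero_cancel, rule Lim_null_comparison)
  show "\<forall>\<^sub>F n in sequentially. norm (x n - c) \<le> C * inverse (real (Suc n))"
    using assms by (intro always_eventually allI)
  show "(\<lambda>n. C * inverse (real (Suc n))) \<longlonglongrightarrow> 0"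
    by (rule tendsto_mult_right_zero[OF LIMSEQ_inverse_real_of_nat])
qed

lemma quotient_remainder_bound:
  fixes d l :: "'a::real_normed_vector"
  assumes "0 < e" "norm (d - e *\<^sub>R l) \<le> C * (e * e)"
  shows "norm ((1 / e) *\<^sub>R d - l) \<le> C * e"
proof -
  have "(1 / e) *\<^sub>R d - l = (1 / e) *\<^sub>R (d - e *\<^sub>R l)" using assms(1) by (simp add: scaleR_diff_right)
  then have "norm ((1 / e) *\<^sub>R d - l) = norm (d - e *\<^sub>R l) / e" using assms(1) by simp
  also have "\<dots> \<le> C * e" using assms by (simp add: pos_divide_le_eq mult.assoc)
  finally show ?thesis .
qed

text \<open>Expanding the direction in the basis gives continuity jointly in base point and
  direction, so that \<open>caratheodory_compose\<close> can treat the pair as one variable.\<close>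

lemma twice_deriv_continuous:
  fixes \<phi> :: "'z::euclidean_space \<Rightarrow> 'y::real_normed_vector"
  assumes d: "twice_deriv L \<phi> D D2"
  shows "continuous_on UNIV \<phi>" "continuous_on UNIV (\<lambda>p. D (fst p) (snd p))"
proof -
  have c: "continuous_on UNIV F" if "\<And>z. (F has_derivative F' z) (at z)" for F :: "'z \<Rightarrow> 'y" and F'
    by (rule has_derivative_continuous_on) (use that has_derivative_at_withinI in blast)
  show "continuous_on UNIV \<phi>" by (rule c[OF twice_derivD(1)[OF d]])
  have cD: "continuous_on UNIV (\<lambda>z. D z i)" for i by (rule c[OF twice_derivD(2)[OF d]])
  have c': "continuous_on UNIV (\<lambda>p. \<Sum>i\<in>Basis. (snd p \<bullet> i) *\<^sub>R D (fst p) i)"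
    by (intro continuous_intros continuous_on_compose2[OF cD]) auto
  have eq: "D z h = (\<Sum>i\<in>Basis. (h \<bullet> i) *\<^sub>R D z i)" for z h
  proof -
    have "D z (\<Sum>i\<in>Basis. (h \<bullet> i) *\<^sub>R i) = (\<Sum>i\<in>Basis. (h \<bullet> i) *\<^sub>R D z i)"
      by (simp only: linear_sum[OF twice_deriv_linear(1)[OF d]] linear_scale[OF twice_deriv_linear(1)[OF d]])
    then show ?thesis by (simp add: euclidean_representation)
  qed
  have e: "(\<lambda>p. D (fst p) (snd p)) = (\<lambda>p. \<Sum>i\<in>Basis. (snd p \<bullet> i) *\<^sub>R D (fst p) i)"
    by (rule ext) (rule eq)
  show "continuous_on UNIV (\<lambda>p. D (fst p) (snd p))" by (subst e) (rule c')
qed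

lemma twice_deriv_continuous2:
  fixes D2 :: "'z::euclidean_space \<Rightarrow> 'z \<Rightarrow> 'z \<Rightarrow> 'y::real_normed_vector"
  assumes d: "twice_deriv L \<phi> D D2"
    and lip: "\<And>z z' h k. norm (D2 z h k - D2 z' h k) \<le> K * norm (z - z') * norm h * norm k"
  shows "continuous_on UNIV (\<lambda>p. D2 (fst p) (fst (snd p)) (snd (snd p)))"
proof -
  note l = twice_deriv_linear[OF d]
  have c: "continuous_on UNIV (\<lambda>z. D2 z i j)" for i j
  proof (rule continuous_on_sequentiallyI)
    fix u a assume u: "\<forall>n. u n \<in> (UNIV :: 'z set)" "u \<longlonglongrightarrow> (a :: 'z)"
    have "(\<lambda>n. norm (u n - a)) \<longlonglongrightarrow> 0"
      using u(2) by (simp add: LIM_zero_iff tendsto_norm_zero_iff)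
    then have "(\<lambda>n. K * norm (u n - a) * norm i * norm j) \<longlonglongrightarrow> 0"
      by (intro tendsto_mult_left_zero tendsto_mult_right_zero)
    then show "(\<lambda>n. D2 (u n) i j) \<longlonglongrightarrow> D2 a i j"
      by (rule LIM_zero_cancel[OF Lim_null_comparison[OF always_eventually[OF allI[OF lip]]]])
  qed
  have c': "continuous_on UNIV (\<lambda>p. \<Sum>i\<in>Basis. \<Sum>j\<in>Basis. ((fst (snd p) \<bullet> i) * (snd (snd p) \<bullet> j)) *\<^sub>R D2 (fst p) i j)"
    by (intro continuous_intros continuous_on_compose2[OF c]) auto
  have eq: "D2 z h k = (\<Sum>i\<in>Basis. \<Sum>j\<in>Basis. ((h \<bullet> i) * (k \<bullet> j)) *\<^sub>R D2 z i j)" for z h k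
  proof -
    have "D2 z (\<Sum>i\<in>Basis. (h \<bullet> i) *\<^sub>R i) (\<Sum>j\<in>Basis. (k \<bullet> j) *\<^sub>R j)
        = (\<Sum>i\<in>Basis. \<Sum>j\<in>Basis. ((h \<bullet> i) * (k \<bullet> j)) *\<^sub>R D2 z i j)"
      by (simp only: linear_sum[OF l(2)] linear_scale[OF l(2)] linear_sum[OF l(3)] linear_scale[OF l(3)]
          scaleR_sum_right scaleR_scaleR) (rule trans[OF sum.swap], simp only: mult.commute)
    then show ?thesis by (simp add: euclidean_representation)
  qed
  have e: "(\<lambda>p. D2 (fst p) (fst (snd p)) (snd (snd p))) = (\<lambda>p. \<Sum>i\<in>Basis. \<Sum>j\<in>Basis.
      ((fst (snd p) \<bullet> i) * (snd (snd p) \<bullet> j)) *\<^sub>R D2 (fst p) i j)"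
    by (rule ext) (rule eq)
  show ?thesis by (subst e) (rule c')
qed

text \<open>Derivatives are measurable in time as limits of difference quotients.\<close>

lemma
  fixes \<phi> :: "real \<Rightarrow> 'z::euclidean_space \<Rightarrow> 'y::euclidean_space"
  assumes L: "0 \<le> L" and d: "\<And>t. t \<in> {0..T} \<Longrightarrow> twice_deriv L (\<phi> t) (D t) (D2 t)"
    and meas: "\<And>z. (\<lambda>t. \<phi> t z) \<in> borel_measurable (leb T)"
  shows twice_deriv_measurable: "z \<in> borel_measurable (leb T) \<Longrightarrow> (\<lambda>t. \<phi> t (z t)) \<in> borel_measurable (leb T)"
    and twice_deriv_measurable1: "z \<in> borel_measurable (leb T) \<Longrightarrow> h \<in> borel_measurable (leb T) \<Longrightarrow>
      (\<lambda>t. D t (z t) (h t)) \<in> borel_measurable (leb T)"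
proof -
  show "z \<in> borel_measurable (leb T) \<Longrightarrow> (\<lambda>t. \<phi> t (z t)) \<in> borel_measurable (leb T)"
    by (rule caratheodory_compose[OF meas]) (use twice_deriv_continuous(1) d in blast)+
  assume z: "z \<in> borel_measurable (leb T)" and h: "h \<in> borel_measurable (leb T)"
  have "(\<lambda>t. D t w k) \<in> borel_measurable (leb T)" for w k
  proof (rule borel_measurable_LIMSEQ_metric)
    let ?e = "\<lambda>n. inverse (real (Suc n))"
    show "(\<lambda>t. (1 / ?e n) *\<^sub>R (\<phi> t (w + ?e n *\<^sub>R k) - \<phi> t w)) \<in> borel_measurable (leb T)" for n
      using meas by (intro borel_measurable_scaleR borel_measurable_diff) auto
    fix t assume "t \<in> space (leb T)"
    then have dt: "twice_deriv L (\<phi> t) (D t) (D2 t)" using d by simp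
    show "(\<lambda>n. (1 / ?e n) *\<^sub>R (\<phi> t (w + ?e n *\<^sub>R k) - \<phi> t w)) \<longlonglongrightarrow> D t w k"
    proof (rule LIMSEQ_inverse_bound, rule quotient_remainder_bound)
      fix n
      show "norm (\<phi> t (w + ?e n *\<^sub>R k) - \<phi> t w - ?e n *\<^sub>R D t w k) \<le> L * (norm k)\<^sup>2 * (?e n * ?e n)"
        using twice_deriv_first_order_remainder[OF dt L, of w "?e n *\<^sub>R k"]
        by (simp add: linear_scale[OF twice_deriv_linear(1)[OF dt]] power2_eq_square mult_ac del: of_nat_Suc)
    qed simp
  qed
  then have "(\<lambda>t. D t (fst p) (snd p)) \<in> borel_measurable (leb T)" for p by blast
  from caratheodory_compose[where F="\<lambda>t p. D t (fst p) (snd p)" and z="\<lambda>t. (z t, h t)", OF this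
      twice_deriv_continuous(2)[OF d] borel_measurable_Pair[OF z h]]
  show "(\<lambda>t. D t (z t) (h t)) \<in> borel_measurable (leb T)" by simp
qed

text \<open>The Lipschitz bound on \<open>D2\<close> gives the rate of convergence of the difference
  quotients, and also the continuity in the base point that \<open>caratheodory_compose\<close>
  needs.\<close>

lemma twice_deriv_measurable2:
  fixes \<phi> :: "real \<Rightarrow> 'z::euclidean_space \<Rightarrow> 'y::euclidean_space"
  assumes L: "0 \<le> L" and d: "\<And>t. t \<in> {0..T} \<Longrightarrow> twice_deriv L (\<phi> t) (D t) (D2 t)"
    and meas: "\<And>z. (\<lambda>t. \<phi> t z) \<in> borel_measurable (leb T)"
    and lip: "\<And>t z z' h k. t \<in> {0..T} \<Longrightarrow> norm (D2 t z h k - D2 t z' h k) \<le> K * norm (z - z') * norm h * norm k"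
    and K: "0 \<le> K"
    and z: "z \<in> borel_measurable (leb T)" and h: "h \<in> borel_measurable (leb T)" and k: "k \<in> borel_measurable (leb T)"
  shows "(\<lambda>t. D2 t (z t) (h t) (k t)) \<in> borel_measurable (leb T)"
proof -
  have "(\<lambda>t. D2 t w a c) \<in> borel_measurable (leb T)" for w a c
  proof (rule borel_measurable_LIMSEQ_metric)
    let ?e = "\<lambda>n. inverse (real (Suc n))"
    show "(\<lambda>t. (1 / ?e n) *\<^sub>R (D t (w + ?e n *\<^sub>R a) c - D t w c)) \<in> borel_measurable (leb T)" for n
      by (intro borel_measurable_scaleR borel_measurable_diff twice_deriv_measurable1[OF L d meas]) auto
    fix t assume "t \<in> space (leb T)"
    then have t: "t \<in> {0..T}" by simp
    note dt = d[OF t]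
    show "(\<lambda>n. (1 / ?e n) *\<^sub>R (D t (w + ?e n *\<^sub>R a) c - D t w c)) \<longlonglongrightarrow> D2 t w a c"
    proof (rule LIMSEQ_inverse_bound, rule quotient_remainder_bound)
      fix n
      define e where "e = ?e n"
      have e: "0 < e" by (simp add: e_def)
      have "norm (D t (w + e *\<^sub>R a) c - D t w c - D2 t w (e *\<^sub>R a) c) \<le> K * norm (e *\<^sub>R a) * norm (e *\<^sub>R a) * norm c"
      proof (rule increment_bound[where F="\<lambda>w. D t w c" and F'="\<lambda>w h. D2 t w h c"])
        show "((\<lambda>w. D t w c) has_derivative (\<lambda>h. D2 t w h c)) (at w)" for w
          by (rule twice_derivD(2)[OF dt])
        fix s :: real assume s: "s \<in> {0..1}"
        have "norm (D2 t (w + s *\<^sub>R e *\<^sub>R a) (e *\<^sub>R a) c - D2 t w (e *\<^sub>R a) c)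
           \<le> K * norm (w + s *\<^sub>R e *\<^sub>R a - w) * norm (e *\<^sub>R a) * norm c" by (rule lip[OF t])
        also have "\<dots> \<le> K * norm (e *\<^sub>R a) * norm (e *\<^sub>R a) * norm c"
          using s K by (intro mult_right_mono mult_left_mono) (auto simp: abs_mult mult.assoc intro!: mult_left_le_one_le)
        finally show "norm (D2 t (w + s *\<^sub>R e *\<^sub>R a) (e *\<^sub>R a) c - D2 t w (e *\<^sub>R a) c)
           \<le> K * norm (e *\<^sub>R a) * norm (e *\<^sub>R a) * norm c" .
      qed
      then show "norm (D t (w + ?e n *\<^sub>R a) c - D t w c - ?e n *\<^sub>R D2 t w a c) \<le> (K * norm a * norm a * norm c) * (?e n * ?e n)"
        unfolding e_def[symmetric] using e
        by (simp add: linear_scale[OF twice_deriv_linear(2)[OF dt]] mult_ac)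
    qed simp
  qed
  then have "(\<lambda>t. D2 t (fst p) (fst (snd p)) (snd (snd p))) \<in> borel_measurable (leb T)" for p by blast
  from caratheodory_compose[where F="\<lambda>t p. D2 t (fst p) (fst (snd p)) (snd (snd p))" and z="\<lambda>t. (z t, h t, k t)", OF this
      twice_deriv_continuous2[OF d lip] borel_measurable_Pair[OF z borel_measurable_Pair[OF h k]]]
  show ?thesis by simp
qed

lemma linear_pair_left: "linear (\<lambda>\<eta>. (\<eta>, 0))" and linear_pair_right: "linear (\<lambda>\<eta>. (0, \<eta>))"
  by (auto intro!: linearI)

lemma inner_le: "\<bar>x \<bullet> y\<bar> \<le> c * norm y" if "norm x \<le> c"
  using Cauchy_Schwarz_ineq2[of x y] mult_right_mono[OF that, of "norm y"] by simp

lemma norm_le_of_inner: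
  fixes v :: "'a::euclidean_space"
  assumes "\<And>h. \<bar>v \<bullet> h\<bar> \<le> K * norm h" "0 \<le> K" shows "norm v \<le> K"
proof (cases "norm v = 0")
  case False
  have "norm v * norm v \<le> K * norm v"
    using assms(1)[of v] by (simp add: dot_square_norm power2_eq_square)
  then show ?thesis using False by simp
qed (use assms in simp)

lemma square_difference_bound:
  fixes A :: "'z::real_normed_vector \<Rightarrow> 'z \<Rightarrow> real"
  assumes l: "\<And>k. linear (\<lambda>h. A h k)" "\<And>h. linear (A h)"
    and bd: "\<And>h k. \<bar>A h k\<bar> \<le> q * norm h * norm k" and eq: "h = w + e"
  shows "\<bar>A h h - A w w\<bar> \<le> q * norm e * (norm h + norm w)"
proof -
  have "A h h = A w h + A e h" by (subst (1) eq) (rule linear_add[OF l(1)])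
  moreover have "A w h = A w w + A w e" unfolding eq by (rule linear_add[OF l(2)])
  ultimately show ?thesis using bd[of e h] bd[of w e] by (simp add: algebra_simps)
qed

lemma linear_pair_bound:
  fixes D :: "'a::real_normed_vector \<times> 'b::real_normed_vector \<Rightarrow> 'c::real_normed_vector"
  assumes lin: "linear D" and 1: "\<And>h. norm (D (h, 0)) \<le> p * norm h" and 2: "\<And>h. norm (D (0, h)) \<le> q * norm h"
    and "p \<le> K" "q \<le> K"
  shows "norm (D h) \<le> K * (norm (fst h) + norm (snd h))"
proof -
  have "D h = D ((fst h, 0) + (0, snd h))" by simp
  also have "\<dots> = D (fst h, 0) + D (0, snd h)" by (rule linear_add[OF lin])
  finally have "norm (D h) \<le> p * norm (fst h) + q * norm (snd h)"
    using norm_triangle_le[OF add_mono[OF 1 2]] by simp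
  also have "\<dots> \<le> K * norm (fst h) + K * norm (snd h)"
    using assms(4,5) by (intro add_mono mult_right_mono) auto
  finally show ?thesis by (simp add: distrib_left)
qed

text \<open>State and control are merged into one variable and the derivatives are abstract, so the
  estimates are free of matrices. Measurability is demanded of each section in time only; joint
  measurability of the data is turned into this by
  \<open>caratheodory_section_measurable\<close>.\<close>

locale control =
  fixes T L :: real
    and b :: "real \<Rightarrow> 'x::euclidean_space \<times> 'u::euclidean_space \<Rightarrow> 'x" and Db D2b
    and f :: "real \<Rightarrow> 'x \<times> 'u \<Rightarrow> real" and Df D2f
    and g :: "'x \<Rightarrow> real" and Dg D2g
    and x0 :: 'x
  assumes T: "0 < T" and L: "0 < L"
    and b_deriv: "\<And>t. t \<in> {0..T} \<Longrightarrow> twice_deriv L (b t) (Db t) (D2b t)"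
    and b_block: "\<And>t. t \<in> {0..T} \<Longrightarrow> lipschitz_block L (D2b t)"
    and f_deriv: "\<And>t. t \<in> {0..T} \<Longrightarrow> twice_deriv L (f t) (Df t) (D2f t)"
    and f_block: "\<And>t. t \<in> {0..T} \<Longrightarrow> lipschitz_block L (D2f t)"
    and g_deriv: "twice_deriv L g Dg D2g"
    and g_lipschitz: "\<And>x x' h k. norm (D2g x h k - D2g x' h k) \<le> L * norm (x - x') * norm h * norm k"
    and b_measurable: "\<And>z. (\<lambda>t. b t z) \<in> borel_measurable (leb T)"
    and f_measurable: "\<And>z. (\<lambda>t. f t z) \<in> borel_measurable (leb T)"
    and b_growth: "\<And>t z. t \<in> {0..T} \<Longrightarrow> norm (b t z) \<le> L * (norm (fst z) + norm (snd z) + 1)"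
    and Db_bound: "\<And>t z h. t \<in> {0..T} \<Longrightarrow> norm (Db t z h) \<le> L * (norm (fst h) + norm (snd h))"
    and f_growth: "\<And>t z. t \<in> {0..T} \<Longrightarrow> \<bar>f t z\<bar> \<le> L * ((norm (fst z))\<^sup>2 + (norm (snd z))\<^sup>2 + 1)"
    and Df_bound: "\<And>t z h. t \<in> {0..T} \<Longrightarrow>
      \<bar>Df t z h\<bar> \<le> L * (norm (fst z) + norm (snd z) + 1) * (norm (fst h) + norm (snd h))"
    and Dg_bound: "\<And>x h. \<bar>Dg x h\<bar> \<le> L * (norm x + 1) * norm h"
begin

lemma T0: "0 \<le> T" and L0: "0 \<le> L" using T L by auto

lemma T_mem: "T \<in> {0..T}" using T by auto

lemmas b_comp[measurable] = twice_deriv_measurable[OF L0 b_deriv b_measurable]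
lemmas f_comp[measurable] = twice_deriv_measurable[OF L0 f_deriv f_measurable]
lemmas Db_comp[measurable] = twice_deriv_measurable1[OF L0 b_deriv b_measurable]
lemmas Df_comp[measurable] = twice_deriv_measurable1[OF L0 f_deriv f_measurable]

lemma D2b_comp[measurable]:
  "z \<in> borel_measurable (leb T) \<Longrightarrow> h \<in> borel_measurable (leb T) \<Longrightarrow> k \<in> borel_measurable (leb T) \<Longrightarrow>
   (\<lambda>t. D2b t (z t) (h t) (k t)) \<in> borel_measurable (leb T)"
  by (rule twice_deriv_measurable2[OF L0 b_deriv b_measurable lipschitz_block_norm[OF b_block L0]]) (use L in auto)

lemma D2f_comp[measurable]:
  "z \<in> borel_measurable (leb T) \<Longrightarrow> h \<in> borel_measurable (leb T) \<Longrightarrow> k \<in> borel_measurable (leb T) \<Longrightarrow>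
   (\<lambda>t. D2f t (z t) (h t) (k t)) \<in> borel_measurable (leb T)"
  by (rule twice_deriv_measurable2[OF L0 f_deriv f_measurable lipschitz_block_norm[OF f_block L0]]) (use L in auto)

lemma Db_linear: "t \<in> {0..T} \<Longrightarrow> linear (Db t z)" by (rule twice_deriv_linear(1)[OF b_deriv])
lemma Df_linear: "t \<in> {0..T} \<Longrightarrow> linear (Df t z)" by (rule twice_deriv_linear(1)[OF f_deriv])
lemma Dg_linear: "linear (Dg z)" by (rule twice_deriv_linear(1)[OF g_deriv])

lemma b_lip: "t \<in> {0..T} \<Longrightarrow> norm (b t z' - b t z) \<le> L * (norm (fst z' - fst z) + norm (snd z' - snd z))"
  using increment_bound[of "b t" "Db t" z "z' - z" 0 "L * (norm (fst z' - fst z) + norm (snd z' - snd z))"]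
    twice_derivD(1)[OF b_deriv] Db_bound[of t _ "z' - z"] by simp

text \<open>\<open>DH\<close> and \<open>D2H\<close> are the first and second derivatives of the
  Hamiltonian in the joint variable with the adjoint value \<open>\<pi>\<close> frozen;
  \<open>Hx\<close> and \<open>Hu\<close> are its partial gradients.\<close>

definition DH :: "real \<Rightarrow> 'x \<times> 'u \<Rightarrow> 'x \<Rightarrow> 'x \<times> 'u \<Rightarrow> real" where
  "DH t z \<pi> h = Db t z h \<bullet> \<pi> + Df t z h"

definition D2H :: "real \<Rightarrow> 'x \<times> 'u \<Rightarrow> 'x \<Rightarrow> 'x \<times> 'u \<Rightarrow> 'x \<times> 'u \<Rightarrow> real" where
  "D2H t z \<pi> h k = D2b t z h k \<bullet> \<pi> + D2f t z h k"

definition Hx :: "real \<Rightarrow> 'x \<times> 'u \<Rightarrow> 'x \<Rightarrow> 'x" where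
  "Hx t z \<pi> = riesz (\<lambda>\<eta>. DH t z \<pi> (\<eta>, 0))"

definition Hu :: "real \<Rightarrow> 'x \<times> 'u \<Rightarrow> 'x \<Rightarrow> 'u" where
  "Hu t z \<pi> = riesz (\<lambda>\<eta>. DH t z \<pi> (0, \<eta>))"

lemma DH_linear:
  assumes t: "t \<in> {0..T}" shows "linear (DH t z \<pi>)"
  by (rule linearI)
    (simp_all add: DH_def linear_add[OF Db_linear[OF t]] linear_add[OF Df_linear[OF t]]
      linear_scale[OF Db_linear[OF t]] linear_scale[OF Df_linear[OF t]] inner_add_left algebra_simps)

lemma Hx_inner: "t \<in> {0..T} \<Longrightarrow> Hx t z \<pi> \<bullet> \<eta> = DH t z \<pi> (\<eta>, 0)"
  unfolding Hx_def by (subst riesz_inner) (auto intro: linear_compose[OF linear_pair_left DH_linear, unfolded comp_def])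

lemma Hu_inner: "t \<in> {0..T} \<Longrightarrow> Hu t z \<pi> \<bullet> \<eta> = DH t z \<pi> (0, \<eta>)"
  unfolding Hu_def by (subst riesz_inner) (auto intro: linear_compose[OF linear_pair_right DH_linear, unfolded comp_def])

lemma DH_bound:
  assumes t: "t \<in> {0..T}"
  shows "\<bar>DH t z \<pi> h\<bar> \<le> (L * norm \<pi> + L * (norm (fst z) + norm (snd z) + 1)) * (norm (fst h) + norm (snd h))"
  using inner_le[OF Db_bound[OF t], of z h \<pi>] Df_bound[OF t, of z h] by (simp add: DH_def algebra_simps)

lemma Hx_bound:
  assumes t: "t \<in> {0..T}"
  shows "norm (Hx t z \<pi>) \<le> L * norm \<pi> + L * (norm (fst z) + norm (snd z) + 1)"
  by (rule norm_le_of_inner) (use DH_bound[OF t, of z \<pi> "(_, 0)"] L in \<open>auto simp: Hx_inner[OF t]\<close>)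

lemma Hu_bound:
  assumes t: "t \<in> {0..T}"
  shows "norm (Hu t z \<pi>) \<le> L * norm \<pi> + L * (norm (fst z) + norm (snd z) + 1)"
  by (rule norm_le_of_inner) (use DH_bound[OF t, of z \<pi> "(0, _)"] L in \<open>auto simp: Hu_inner[OF t]\<close>)

lemma norm_diff_le_fst_snd: "norm (z - z') \<le> norm (fst z - fst z') + norm (snd z - snd z')"
  using norm_le_fst_snd[of "z - z'"] by simp

lemma deriv_increment_le:
  assumes d: "twice_deriv L \<phi> D D2"
  shows "norm (D z h - D z' h) \<le> L * (norm (fst z - fst z') + norm (snd z - snd z')) * norm h"
proof -
  have "norm (D z h - D z' h) \<le> L * norm (z - z') * norm h"
    using twice_deriv_first_increment[OF d, of z' "z - z'" h] by simp
  also have "\<dots> \<le> L * (norm (fst z - fst z') + norm (snd z - snd z')) * norm h"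
    using L by (intro mult_right_mono mult_left_mono norm_diff_le_fst_snd) auto
  finally show ?thesis .
qed

text \<open>The difference of the adjoints is paired with the uniformly bounded derivative of
  \<open>b\<close>, the difference of the derivatives with \<open>\<pi>'\<close>. Because of this
  asymmetry later bounds contain the \<open>L1\<close> norm of just one of the two controls.\<close>

lemma DH_diff:
  assumes t: "t \<in> {0..T}"
  shows "\<bar>DH t z \<pi> h - DH t z' \<pi>' h\<bar> \<le> L * (norm (fst h) + norm (snd h)) * norm (\<pi> - \<pi>')
    + L * (norm (fst z - fst z') + norm (snd z - snd z')) * (1 + norm \<pi>') * norm h"
proof -
  have "DH t z \<pi> h - DH t z' \<pi>' h = Db t z h \<bullet> (\<pi> - \<pi>') + (Db t z h - Db t z' h) \<bullet> \<pi>' + (Df t z h - Df t z' h)"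
    by (simp add: DH_def inner_diff_left inner_diff_right)
  then show ?thesis
    using inner_le[OF Db_bound[OF t], of z h "\<pi> - \<pi>'"]
      inner_le[OF deriv_increment_le[OF b_deriv[OF t]], of z h z' \<pi>']
      deriv_increment_le[OF f_deriv[OF t], of z h z']
    by (simp add: algebra_simps)
qed

lemma Hx_diff:
  assumes t: "t \<in> {0..T}"
  shows "norm (Hx t z \<pi> - Hx t z' \<pi>') \<le> L * norm (\<pi> - \<pi>')
    + L * (norm (fst z - fst z') + norm (snd z - snd z')) * (1 + norm \<pi>')"
proof (rule norm_le_of_inner)
  fix h
  show "\<bar>(Hx t z \<pi> - Hx t z' \<pi>') \<bullet> h\<bar> \<le> (L * norm (\<pi> - \<pi>')
    + L * (norm (fst z - fst z') + norm (snd z - snd z')) * (1 + norm \<pi>')) * norm h"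
    using DH_diff[OF t, of z \<pi> "(h, 0)" z' \<pi>']
    by (simp add: inner_diff_left Hx_inner[OF t] algebra_simps)
qed (use L in simp)

lemma Hx_comp[measurable]:
  "z \<in> borel_measurable (leb T) \<Longrightarrow> \<pi> \<in> borel_measurable (leb T) \<Longrightarrow> (\<lambda>t. Hx t (z t) (\<pi> t)) \<in> borel_measurable (leb T)"
  unfolding Hx_def DH_def
  by (intro riesz_measurable borel_measurable_add borel_measurable_inner Db_comp Df_comp borel_measurable_const)

lemma Hu_comp[measurable]:
  "z \<in> borel_measurable (leb T) \<Longrightarrow> \<pi> \<in> borel_measurable (leb T) \<Longrightarrow> (\<lambda>t. Hu t (z t) (\<pi> t)) \<in> borel_measurable (leb T)"
  unfolding Hu_def DH_def
  by (intro riesz_measurable borel_measurable_add borel_measurable_inner Db_comp Df_comp borel_measurable_const)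

text \<open>\<open>X\<close>, \<open>P\<close> and \<open>Y\<close> are the state, the adjoint and
  the linearized state. They are encoded like \<open>state\<close>, \<open>adjoint_state\<close> and
  \<open>linearized_state\<close>, so that identifying them amounts to rewriting right-hand
  sides.\<close>

definition X :: "(real \<Rightarrow> 'u) \<Rightarrow> real \<Rightarrow> 'x" where
  "X u = (THE x. x \<in> extensional {0..T} \<and> solves_ode_on T (\<lambda>t \<xi>. b t (\<xi>, u t)) x \<and> x 0 = x0)"

definition Z :: "(real \<Rightarrow> 'u) \<Rightarrow> real \<Rightarrow> 'x \<times> 'u" where
  "Z u t = (X u t, u t)"

definition P :: "(real \<Rightarrow> 'u) \<Rightarrow> real \<Rightarrow> 'x" where
  "P u = (THE p. p \<in> extensional {0..T} \<and> solves_ode_on T (\<lambda>t \<pi>. - Hx t (Z u t) \<pi>) p \<and> p T = riesz (Dg (X u T)))"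

definition Y :: "(real \<Rightarrow> 'u) \<Rightarrow> (real \<Rightarrow> 'u) \<Rightarrow> real \<Rightarrow> 'x" where
  "Y u v = (THE y. y \<in> extensional {0..T} \<and> solves_ode_on T (\<lambda>t \<eta>. Db t (Z u t) (\<eta>, v t)) y \<and> y 0 = 0)"

section \<open>Well-posedness of the state, adjoint and linearized equations\<close>

lemma X_solves:
  assumes u: "u \<in> L2 T"
  shows "primitive_on T (\<lambda>t. b t (Z u t)) (X u)" "X u 0 = x0"
proof -
  note um[measurable] = L2_measurable[OF u]
  have "\<exists>!x. x \<in> extensional {0..T} \<and> solves_ode_on T (\<lambda>t \<xi>. b t (\<xi>, u t)) x \<and> x 0 = x0"
  proof (rule ode_initial_ex1[OF T0 L0])
    fix x :: "real \<Rightarrow> 'x" assume x: "continuous_on {0..T} x"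
    note xm[measurable] = continuous_measurable_leb[OF x]
    show "integrable (leb T) (\<lambda>s. b s (x s, u s))"
    proof (rule integrable_leb_bound(1))
      show "integrable (leb T) (\<lambda>s. L * (norm (x s) + norm (u s) + 1))"
        using integrable_leb_continuous[OF x] L2_norm_integrable[OF u] by simp
      show "norm (b s (x s, u s)) \<le> L * (norm (x s) + norm (u s) + 1)" if "s \<in> {0..T}" for s
        using b_growth[OF that, of "(x s, u s)"] by simp
    qed measurable
  next
    fix s \<xi> \<eta> assume "s \<in> {0..T}"
    then show "norm (b s (\<xi>, u s) - b s (\<eta>, u s)) \<le> L * norm (\<xi> - \<eta>)" using b_lip[of s "(\<xi>, u s)" "(\<eta>, u s)"] by simp
  qed
  from theI'[OF this, folded X_def] show "primitive_on T (\<lambda>t. b t (Z u t)) (X u)" "X u 0 = x0"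
    unfolding solves_ode_on_primitive Z_def by auto
qed

lemma X_continuous: "u \<in> L2 T \<Longrightarrow> continuous_on {0..T} (X u)"
  by (rule primitive_on_continuous[OF X_solves(1)])

lemma Z_measurable: "u \<in> L2 T \<Longrightarrow> Z u \<in> borel_measurable (leb T)"
  unfolding Z_def by (intro borel_measurable_Pair continuous_measurable_leb[OF X_continuous] L2_measurable)

lemma P_solves:
  assumes u: "u \<in> L2 T"
  shows "primitive_on T (\<lambda>t. - Hx t (Z u t) (P u t)) (P u)" "P u T = riesz (Dg (X u T))"
proof -
  note um[measurable] = L2_measurable[OF u] Z_measurable[OF u]
  have "\<exists>!p. p \<in> extensional {0..T} \<and> solves_ode_on T (\<lambda>t \<pi>. - Hx t (Z u t) \<pi>) p \<and> p T = riesz (Dg (X u T))"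
  proof (rule ode_terminal_ex1[OF T0 L0])
    fix p :: "real \<Rightarrow> 'x" assume p: "continuous_on {0..T} p"
    note pm[measurable] = continuous_measurable_leb[OF p]
    show "integrable (leb T) (\<lambda>s. - Hx s (Z u s) (p s))"
    proof (rule integrable_leb_bound(1))
      show "integrable (leb T) (\<lambda>s. L * norm (p s) + L * (norm (X u s) + norm (u s) + 1))"
        using integrable_leb_continuous[OF p] integrable_leb_continuous[OF X_continuous[OF u]] L2_norm_integrable[OF u] by simp
      show "norm (- Hx s (Z u s) (p s)) \<le> L * norm (p s) + L * (norm (X u s) + norm (u s) + 1)" if "s \<in> {0..T}" for s
        using Hx_bound[OF that, of "Z u s" "p s"] by (simp add: Z_def)
    qed measurable
  next
    fix s \<xi> \<eta> assume "s \<in> {0..T}"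
    then show "norm (- Hx s (Z u s) \<xi> - - Hx s (Z u s) \<eta>) \<le> L * norm (\<xi> - \<eta>)"
      using Hx_diff[of s "Z u s" \<eta> "Z u s" \<xi>] by (simp add: norm_minus_commute)
  qed
  from theI'[OF this, folded P_def] show "primitive_on T (\<lambda>t. - Hx t (Z u t) (P u t)) (P u)" "P u T = riesz (Dg (X u T))"
    unfolding solves_ode_on_primitive by auto
qed

lemma Y_solves:
  assumes u: "u \<in> L2 T" and v: "v \<in> L2 T"
  shows "primitive_on T (\<lambda>t. Db t (Z u t) (Y u v t, v t)) (Y u v)" "Y u v 0 = 0"
proof -
  note um[measurable] = Z_measurable[OF u] L2_measurable[OF v]
  have "\<exists>!y. y \<in> extensional {0..T} \<and> solves_ode_on T (\<lambda>t \<eta>. Db t (Z u t) (\<eta>, v t)) y \<and> y 0 = 0"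
  proof (rule ode_initial_ex1[OF T0 L0])
    fix y :: "real \<Rightarrow> 'x" assume y: "continuous_on {0..T} y"
    note ym[measurable] = continuous_measurable_leb[OF y]
    show "integrable (leb T) (\<lambda>s. Db s (Z u s) (y s, v s))"
    proof (rule integrable_leb_bound(1))
      show "integrable (leb T) (\<lambda>s. L * (norm (y s) + norm (v s)))"
        using integrable_leb_continuous[OF y] L2_norm_integrable[OF v] by simp
      show "norm (Db s (Z u s) (y s, v s)) \<le> L * (norm (y s) + norm (v s))" if "s \<in> {0..T}" for s
        using Db_bound[OF that, of "Z u s" "(y s, v s)"] by simp
    qed measurable
  next
    fix s \<xi> \<eta> assume s: "s \<in> {0..T}"
    then show "norm (Db s (Z u s) (\<xi>, v s) - Db s (Z u s) (\<eta>, v s)) \<le> L * norm (\<xi> - \<eta>)"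
      using Db_bound[OF s, of "Z u s" "(\<xi> - \<eta>, 0)"] linear_diff[OF Db_linear[OF s], of "Z u s" "(\<xi>, v s)" "(\<eta>, v s)"] by simp
  qed
  from theI'[OF this, folded Y_def] show "primitive_on T (\<lambda>t. Db t (Z u t) (Y u v t, v t)) (Y u v)" "Y u v 0 = 0"
    unfolding solves_ode_on_primitive by auto
qed

lemma P_continuous: "u \<in> L2 T \<Longrightarrow> continuous_on {0..T} (P u)"
  by (rule primitive_on_continuous[OF P_solves(1)])

lemma Y_continuous: "u \<in> L2 T \<Longrightarrow> v \<in> L2 T \<Longrightarrow> continuous_on {0..T} (Y u v)"
  by (rule primitive_on_continuous[OF Y_solves(1)])

end

section \<open>Estimates for the state, the adjoint and the Hessian form\<close>

lemma nrm1_mult_le: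
  assumes "v \<in> L2 T" "w \<in> L2 T" "0 \<le> T"
  shows "nrm1 T v * nrm1 T w \<le> T * (nrm2 T v * nrm2 T w)"
proof -
  have "nrm1 T v * nrm1 T w \<le> (sqrt T * nrm2 T v) * (sqrt T * nrm2 T w)"
    using assms by (intro mult_mono nrm1_le_nrm2) auto
  also have "\<dots> = (sqrt T * sqrt T) * (nrm2 T v * nrm2 T w)" by (simp only: mult_ac)
  finally show ?thesis using assms(3) by simp
qed

lemma L2_norm: "v \<in> L2 T \<Longrightarrow> (\<lambda>t. norm (v t)) \<in> L2 T" "nrm2 T (\<lambda>t. norm (v t)) = nrm2 T v"
  by (auto simp: L2_iff nrm2_eq)

text \<open>The left-hand side is the constant obtained by estimating the difference of two Hessian forms
  directly; the paper reaches \<open>C\<^sub>4\<close> through the adjoint \<open>\<psi>\<close> of the linearized equation.\<close>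

lemma C_4_dominates:
  fixes L T C1 c Cy Kpsi Cpsi C2 E :: real
  assumes pos: "0 \<le> L" "0 \<le> T" "0 \<le> C1" "0 \<le> E" and c: "c = L * E" "c \<le> C1"
    and Cy: "Cy = c * ((C1 + c + C1 * c * T) * T + 1)"
    and K: "Kpsi = E * (L * Cy + C1 * (Cy * T + 1))"
    and psi: "E * (L * Cy * (C1 * T + 1) + L * Kpsi * T * (C1 * T + 1) + C1 * (Cy * T\<^sup>2 + 2 * Cy * T + T + 1)) \<le> Cpsi"
    and C2: "Cy \<le> C2" "Kpsi \<le> C2" "Cpsi \<le> C2"
  shows "C1 * ((T + 1) * c\<^sup>2 * T + 2 * c * (T + 1) + 1) + 2 * C1 * Cy * (c * T + 1) + L * C1 * c\<^sup>2 * T + 2 * L * Cy * c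
    \<le> C2 * (L * (C1 * T + 2) + C1 * (T + 2)) + C1"
proof -
  have c0: "0 \<le> c" using pos c by simp
  have Cy_c: "c \<le> Cy"
  proof -
    have "c * 1 \<le> c * ((C1 + c + C1 * c * T) * T + 1)" using c0 pos by (intro mult_left_mono) auto
    then show ?thesis using Cy by simp
  qed
  have Cy0: "0 \<le> Cy" using Cy_c c0 by simp
  \<comment> \<open>With this factorization the \<open>Kpsi\<close> terms produce
    \<open>Cy * C1 * (Cy * T + 1)\<close>, which pays for one of the two copies of
    \<open>C1 * Cy * (c * T + 1)\<close> in the claim.\<close>
  have Cy': "Cy = c * (1 + C1 * T) * (1 + c * T)" using Cy by (simp add: algebra_simps)
  have K1: "L * (C1 * T + 1) * (1 + c * T) * Kpsi = (1 + C1 * T) * (1 + c * T) * (c * L * Cy) + Cy * C1 * (Cy * T + 1)"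
  proof -
    have gen: "e * p * q * (x + y) = p * q * (e * x) + (e * p * q) * y" for e p q x y :: real
      by (simp add: distrib_left)
    have "L * (C1 * T + 1) * (1 + c * T) * Kpsi = c * (1 + C1 * T) * (1 + c * T) * (L * Cy + C1 * (Cy * T + 1))"
      unfolding K c(1) by (simp only: mult_ac add.commute[of "C1 * T"] mult.commute[of T C1])
    also have "\<dots> = (1 + C1 * T) * (1 + c * T) * (c * (L * Cy)) + (c * (1 + C1 * T) * (1 + c * T)) * (C1 * (Cy * T + 1))"
      by (rule gen)
    also have "\<dots> = (1 + C1 * T) * (1 + c * T) * (c * (L * Cy)) + Cy * (C1 * (Cy * T + 1))"
      by (simp only: Cy'[symmetric])
    finally show ?thesis by (simp only: mult.assoc)
  qed
  have K2: "1 * (c * L * Cy) + Cy * C1 * (c * T + 1) \<le> L * (C1 * T + 1) * (1 + c * T) * Kpsi"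
    unfolding K1
  proof (intro add_mono mult_right_mono mult_left_mono)
    have "1 * 1 \<le> (1 + C1 * T) * (1 + c * T)" using pos c0 by (intro mult_mono) auto
    then show "1 \<le> (1 + C1 * T) * (1 + c * T)" by simp
  qed (use pos c0 Cy0 Cy_c in auto)
  \<comment> \<open>The factor of \<open>C2\<close> is split into four summands, and in each of them
    \<open>C2\<close> is replaced by a smaller quantity that suits it: \<open>Kpsi\<close>, the
    expression below \<open>Cpsi\<close>, and twice \<open>Cy\<close>.\<close>
  have "L * (C1 * T + 1) * Kpsi + L * (E * (L * Cy * (C1 * T + 1) + L * Kpsi * T * (C1 * T + 1) + C1 * (Cy * T\<^sup>2 + 2 * Cy * T + T + 1)))
      + C1 * (T + 1) * Cy + C1 * Cy \<le> L * (C1 * T + 1) * C2 + L * C2 + C1 * (T + 1) * C2 + C1 * C2"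
    using C2 psi pos by (intro add_mono mult_left_mono order_trans[OF psi]) auto
  moreover have "L * (E * (L * Cy * (C1 * T + 1) + L * Kpsi * T * (C1 * T + 1) + C1 * (Cy * T\<^sup>2 + 2 * Cy * T + T + 1)))
     = c * L * Cy * (C1 * T + 1) + L * (C1 * T + 1) * (c * T) * Kpsi + c * C1 * (Cy * T\<^sup>2 + 2 * Cy * T + T + 1)"
    unfolding c(1) by (simp add: algebra_simps)
  moreover have "L * c * C1 * T * c + L * c * Cy \<le> c * L * Cy * (C1 * T + 1)"
  proof -
    have "L * c * C1 * T * c \<le> L * c * C1 * T * Cy" using pos c0 Cy_c by (intro mult_left_mono) auto
    then show ?thesis by (simp add: algebra_simps)
  qed
  moreover have "C1 * c\<^sup>2 * T * (T + 1) + c * C1 * (T + 1) + c * C1 * (Cy * T) \<le> c * C1 * (Cy * T\<^sup>2 + 2 * Cy * T + T + 1)"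
  proof -
    have "c * C1 * (c * T * (T + 1)) \<le> c * C1 * (Cy * T * (T + 1))"
      using pos c0 Cy_c by (intro mult_left_mono mult_right_mono) auto
    then show ?thesis by (simp add: algebra_simps power2_eq_square)
  qed
  moreover have "C1 * (T + 1) * c \<le> C1 * (T + 1) * Cy" using pos Cy_c by (intro mult_left_mono) auto
  ultimately show ?thesis using K2 by (simp add: algebra_simps power2_eq_square)
qed

context control
begin

text \<open>The Lipschitz constant of the map from controls in \<open>L1\<close> to states in the
  supremum norm, and hence also the bound for the linearized state.\<close>

definition cE :: real where "cE = L * exp (L * T)"

abbreviation "Cx \<equiv> C_x T L (norm x0)"
abbreviation "Kp \<equiv> K_p T L (norm x0)"
abbreviation "Cp \<equiv> C_p T L (norm x0)"
abbreviation "CH \<equiv> C_H T L (norm x0)"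
abbreviation "C1 \<equiv> C_1 T L (norm x0)"
abbreviation "Cy \<equiv> C_y T L (norm x0)"
abbreviation "C2 \<equiv> C_2 T L (norm x0)"
abbreviation "C4 \<equiv> C_4 T L (norm x0)"

lemma cE_pos: "0 < cE" using L by (simp add: cE_def)

lemma Cx_ge: "exp (L * T) * (norm x0 + L * T) \<le> Cx" "cE \<le> Cx" by (auto simp: C_x_def cE_def)

lemma Cx_pos: "0 < Cx" using Cx_ge(2) cE_pos by linarith

lemma Kp_eq: "Kp = cE * (1 + Cx) * (T + 1)" by (simp add: K_p_def cE_def)

lemma Kp_pos: "0 < Kp" unfolding Kp_eq using cE_pos Cx_pos T by (intro mult_pos_pos) auto

lemma Cp_ge: "Kp \<le> Cp" "cE * (Cx + (Cx * T + 1) * (1 + Kp)) \<le> Cp"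
  by (auto simp: C_p_def cE_def)

lemma CH_ge: "L * (Cp + Cx + Cp * Cx) \<le> CH" "L * (1 + Cp) \<le> CH" by (auto simp: C_H_def)

lemma C1_ge: "Cx \<le> C1" "Cp \<le> C1" "CH \<le> C1" by (auto simp: C_1_def)

lemma C1_pos: "0 < C1" using C1_ge(1) Cx_pos by linarith

lemma Cy_eq: "Cy = cE * ((C1 + cE + C1 * cE * T) * T + 1)"
  by (simp add: C_y_def cE_def mult_ac)

lemma Cy_pos: "0 < Cy"
  unfolding Cy_eq using cE_pos C1_pos T by (intro mult_pos_pos add_nonneg_pos mult_nonneg_nonneg) auto

text \<open>The first two groups of terms come from the integral part of \<open>B\<close> and the
  last two from the terminal part, as they are computed in \<open>B_lipschitz\<close>.\<close>

lemma C4_dominates: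
  "sqrt T * (C1 * ((T + 1) * cE\<^sup>2 * T + 2 * cE * (T + 1) + 1) + 2 * C1 * Cy * (cE * T + 1) + L * C1 * cE\<^sup>2 * T + 2 * L * Cy * cE) \<le> C4"
proof -
  have c: "cE \<le> C1" using Cx_ge(2) C1_ge(1) by linarith
  show ?thesis
    unfolding C_4_def
  proof (intro mult_left_mono C_4_dominates[where E="exp (L * T)" and Kpsi="K_psi T L (norm x0)" and Cpsi="C_psi T L (norm x0)"])
    show "Cy = cE * ((C1 + cE + C1 * cE * T) * T + 1)" by (rule Cy_eq)
    show "exp (L * T) * (L * Cy * (C1 * T + 1) + L * K_psi T L (norm x0) * T * (C1 * T + 1) +
        C1 * (Cy * T\<^sup>2 + 2 * Cy * T + T + 1)) \<le> C_psi T L (norm x0)"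
      by (simp add: C_psi_def)
    show "K_psi T L (norm x0) \<le> C2" by (simp add: C_2_def C_psi_def)
  qed (use T L C1_pos c in \<open>simp_all add: cE_def K_psi_def C_2_def\<close>)
qed

lemma C4_pos: "0 < C4"
proof -
  have "0 < sqrt T * (C1 * ((T + 1) * cE\<^sup>2 * T + 2 * cE * (T + 1) + 1) + 2 * C1 * Cy * (cE * T + 1) + L * C1 * cE\<^sup>2 * T + 2 * L * Cy * cE)"
    using T L C1_pos cE_pos Cy_pos by (intro mult_pos_pos add_pos_pos) auto
  then show ?thesis using C4_dominates by linarith
qed

section \<open>Gronwall estimates for the state, the adjoint and the linearized state\<close>

lemma X_bound:
  assumes u: "u \<in> L2 T" and t: "t \<in> {0..T}"
  shows "norm (X u t) \<le> Cx * (1 + nrm1 T u)"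
proof -
  have "norm (X u t) \<le> exp (L * T) * (norm (X u 0) + (LINT t|leb T. L * (norm (u t) + 1)))"
  proof (rule gronwall_forward[OF X_solves(1)[OF u] T0 L0 _ _ _ t])
    show "integrable (leb T) (\<lambda>t. L * (norm (u t) + 1))" using L2_norm_integrable[OF u] by simp
    show "norm (b t (Z u t)) \<le> L * norm (X u t) + L * (norm (u t) + 1)" if "t \<in> {0..T}" for t
      using b_growth[OF that, of "Z u t"] by (simp add: Z_def algebra_simps)
  qed (use L in simp)
  also have "(LINT t|leb T. L * (norm (u t) + 1)) = L * (nrm1 T u + T)"
    using L2_norm_integrable[OF u] T0 by (simp add: nrm1_eq measure_leb)
  also have "exp (L * T) * (norm (X u 0) + L * (nrm1 T u + T)) = exp (L * T) * (norm x0 + L * T) + cE * nrm1 T u"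
    using X_solves(2)[OF u] by (simp add: cE_def algebra_simps)
  also have "\<dots> \<le> Cx + Cx * nrm1 T u"
    by (intro add_mono mult_right_mono Cx_ge) simp
  finally show ?thesis by (simp add: algebra_simps)
qed

lemma X_diff:
  assumes u: "u \<in> L2 T" and w: "w \<in> L2 T" and t: "t \<in> {0..T}"
  shows "norm (X u t - X w t) \<le> cE * nrm1 T (\<lambda>t. u t - w t)"
proof -
  have i: "integrable (leb T) (\<lambda>t. L * norm (u t - w t))"
    using L2_norm_integrable[OF L2_diff(1)[OF u w]] by simp
  have "norm (X u t - X w t) \<le> exp (L * T) * (norm (X u 0 - X w 0) + (LINT t|leb T. L * norm (u t - w t)))"
  proof (rule gronwall_forward[OF primitive_on_diff[OF X_solves(1)[OF u] X_solves(1)[OF w]] T0 L0 i _ _ t])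
    show "norm (b t (Z u t) - b t (Z w t)) \<le> L * norm (X u t - X w t) + L * norm (u t - w t)" if "t \<in> {0..T}" for t
      using b_lip[OF that, of "Z u t" "Z w t"] by (simp add: Z_def algebra_simps)
  qed (use L in simp)
  then show ?thesis
    using X_solves(2)[OF u] X_solves(2)[OF w] by (simp add: nrm1_eq cE_def mult_ac)
qed

lemma riesz_Dg_inner: "riesz (Dg x) \<bullet> h = Dg x h"
  by (rule riesz_inner[OF Dg_linear])

lemma P_bound:
  assumes u: "u \<in> L2 T" and t: "t \<in> {0..T}"
  shows "norm (P u t) \<le> Kp * (1 + nrm1 T u)"
proof -
  define N where "N = 1 + nrm1 T u"
  have N1: "1 \<le> N" by (simp add: N_def)
  have CN: "0 \<le> Cx * N" using Cx_pos N1 by simp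
  have pT: "norm (P u T) \<le> L * (Cx * N + 1)"
  proof (rule norm_le_of_inner)
    fix h
    have "\<bar>Dg (X u T) h\<bar> \<le> L * (norm (X u T) + 1) * norm h" by (rule Dg_bound)
    also have "\<dots> \<le> L * (Cx * N + 1) * norm h"
      using X_bound[OF u T_mem] L by (intro mult_right_mono mult_left_mono) (auto simp: N_def)
    finally show "\<bar>P u T \<bullet> h\<bar> \<le> L * (Cx * N + 1) * norm h" by (simp add: P_solves(2)[OF u] riesz_Dg_inner)
  qed (use L CN in simp)
  have "norm (P u t) \<le> exp (L * T) * (norm (P u T) + (LINT t|leb T. L * (Cx * N + 1) + L * norm (u t)))"
  proof (rule gronwall_backward[OF P_solves(1)[OF u] T0 L0 _ _ _ t])
    show "integrable (leb T) (\<lambda>t. L * (Cx * N + 1) + L * norm (u t))" using L2_norm_integrable[OF u] by simp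
    show "norm (- Hx t (Z u t) (P u t)) \<le> L * norm (P u t) + (L * (Cx * N + 1) + L * norm (u t))" if "t \<in> {0..T}" for t
    proof -
      have "norm (Hx t (Z u t) (P u t)) \<le> L * norm (P u t) + L * (norm (X u t) + norm (u t) + 1)"
        using Hx_bound[OF that, of "Z u t" "P u t"] by (simp add: Z_def)
      also have "\<dots> \<le> L * norm (P u t) + L * (Cx * N + norm (u t) + 1)"
        using X_bound[OF u that] L by (intro add_left_mono mult_left_mono) (auto simp: N_def)
      finally show ?thesis by (simp add: algebra_simps)
    qed
  qed (use L CN in simp)
  also have "(LINT t|leb T. L * (Cx * N + 1) + L * norm (u t)) = T * (L * (Cx * N + 1)) + L * nrm1 T u"
    using L2_norm_integrable[OF u] T0 by (simp add: nrm1_eq measure_leb)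
  also have "exp (L * T) * (norm (P u T) + (T * (L * (Cx * N + 1)) + L * nrm1 T u))
      \<le> exp (L * T) * (L * (Cx * N + 1) + (T * (L * (Cx * N + 1)) + L * nrm1 T u))"
    by (intro mult_left_mono add_right_mono pT) simp
  also have "\<dots> = cE * ((Cx * N + 1) * (T + 1) + nrm1 T u)" by (simp add: cE_def algebra_simps)
  also have "\<dots> \<le> cE * ((1 + Cx) * (T + 1) * N)"
  proof (rule mult_left_mono)
    have "nrm1 T u * 1 \<le> nrm1 T u * (T + 1)" using T by (intro mult_left_mono) auto
    then show "(Cx * N + 1) * (T + 1) + nrm1 T u \<le> (1 + Cx) * (T + 1) * N" by (simp add: N_def algebra_simps)
  qed (use cE_pos in simp)
  finally show ?thesis by (simp add: Kp_eq N_def mult_ac)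
qed

lemma P_diff:
  assumes u: "u \<in> L2 T" and w: "w \<in> L2 T" and t: "t \<in> {0..T}"
  shows "norm (P u t - P w t) \<le> Cp * (1 + nrm1 T w) * nrm1 T (\<lambda>t. u t - w t)"
proof -
  define N where "N = 1 + nrm1 T w"
  define d where "d = nrm1 T (\<lambda>t. u t - w t)"
  have N1: "1 \<le> N" by (simp add: N_def)
  have d0: "0 \<le> d" by (simp add: d_def)
  have KN: "0 \<le> Kp * N" using Kp_pos N1 by simp
  have uw: "integrable (leb T) (\<lambda>t. norm (u t - w t))"
    using L2_norm_integrable[OF L2_diff(1)[OF u w]] .
  have pT: "norm (P u T - P w T) \<le> L * (cE * d)"
  proof -
    have "norm (P u T - P w T) \<le> L * norm (X u T - X w T)"
    proof (rule norm_le_of_inner)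
      fix h
      show "\<bar>(P u T - P w T) \<bullet> h\<bar> \<le> L * norm (X u T - X w T) * norm h"
        using twice_deriv_first_increment[OF g_deriv, of "X w T" "X u T - X w T" h]
        by (simp add: P_solves(2) u w inner_diff_left riesz_Dg_inner)
    qed (use L in simp)
    also have "\<dots> \<le> L * (cE * d)" using X_diff[OF u w T_mem] L by (simp add: d_def)
    finally show ?thesis .
  qed
  define k where "k = (\<lambda>t. L * (1 + Kp * N) * (cE * d + norm (u t - w t)))"
  have ik: "integrable (leb T) k" using uw by (simp add: k_def)
  have "norm (P u t - P w t) \<le> exp (L * T) * (norm (P u T - P w T) + (LINT t|leb T. k t))"
  proof (rule gronwall_backward[OF primitive_on_diff[OF P_solves(1)[OF u] P_solves(1)[OF w]] T0 L0 ik _ _ t])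
    fix t assume t: "t \<in> {0..T}"
    have "norm (- Hx t (Z u t) (P u t) - - Hx t (Z w t) (P w t)) = norm (Hx t (Z u t) (P u t) - Hx t (Z w t) (P w t))"
      by (simp add: norm_minus_commute)
    also have "\<dots> \<le> L * norm (P u t - P w t) + L * (norm (X u t - X w t) + norm (u t - w t)) * (1 + norm (P w t))"
      using Hx_diff[OF t, of "Z u t" "P u t" "Z w t" "P w t"] by (simp add: Z_def)
    also have "\<dots> \<le> L * norm (P u t - P w t) + L * (cE * d + norm (u t - w t)) * (1 + Kp * N)"
      using X_diff[OF u w t] P_bound[OF w t] L cE_pos d0
      by (intro add_left_mono mult_mono mult_left_mono) (auto simp: d_def N_def)
    finally show "norm (- Hx t (Z u t) (P u t) - - Hx t (Z w t) (P w t)) \<le> L * norm (P u t - P w t) + k t"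
      by (simp add: k_def mult_ac)
    show "0 \<le> k t" using L KN cE_pos d0 by (simp add: k_def)
  qed
  also have "(LINT t|leb T. k t) = L * (1 + Kp * N) * (cE * T + 1) * d"
    using uw T0 by (simp add: k_def d_def nrm1_eq measure_leb algebra_simps)
  also have "exp (L * T) * (norm (P u T - P w T) + L * (1 + Kp * N) * (cE * T + 1) * d)
      \<le> exp (L * T) * (L * (cE * d) + L * (1 + Kp * N) * (cE * T + 1) * d)"
    by (intro mult_left_mono add_right_mono pT) simp
  also have "\<dots> = cE * (cE + (cE * T + 1) * (1 + Kp * N)) * d" by (simp add: cE_def algebra_simps)
  \<comment> \<open>Since \<open>N\<close> is at least 1, every summand may be multiplied by it;
    \<open>cE\<close> is enlarged to \<open>Cx\<close> to reach the form in
    \<open>C_p\<close>.\<close>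
  also have "\<dots> \<le> cE * ((Cx + (Cx * T + 1) * (1 + Kp)) * N) * d"
  proof (intro mult_right_mono mult_left_mono d0)
    have "cE * 1 \<le> Cx * N" using Cx_ge(2) N1 Cx_pos by (intro mult_mono) auto
    moreover have "(cE * T + 1) * (1 + Kp * N) \<le> (Cx * T + 1) * ((1 + Kp) * N)"
      using Cx_ge(2) N1 T Cx_pos Kp_pos by (intro mult_mono add_mono mult_right_mono) (auto simp: algebra_simps)
    ultimately show "cE + (cE * T + 1) * (1 + Kp * N) \<le> (Cx + (Cx * T + 1) * (1 + Kp)) * N"
      by (simp add: distrib_right mult.assoc)
  qed (use cE_pos in simp)
  also have "\<dots> = (cE * (Cx + (Cx * T + 1) * (1 + Kp))) * N * d" by (simp only: mult.assoc)
  also have "\<dots> \<le> Cp * N * d" using N1 d0 by (intro mult_right_mono Cp_ge) auto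
  finally show ?thesis by (simp add: N_def d_def)
qed

lemma Y_bound:
  assumes u: "u \<in> L2 T" and v: "v \<in> L2 T" and t: "t \<in> {0..T}"
  shows "norm (Y u v t) \<le> cE * nrm1 T v"
proof -
  have "norm (Y u v t) \<le> exp (L * T) * (norm (Y u v 0) + (LINT t|leb T. L * norm (v t)))"
  proof (rule gronwall_forward[OF Y_solves(1)[OF u v] T0 L0 _ _ _ t])
    show "integrable (leb T) (\<lambda>t. L * norm (v t))" using L2_norm_integrable[OF v] by simp
    show "norm (Db t (Z u t) (Y u v t, v t)) \<le> L * norm (Y u v t) + L * norm (v t)" if "t \<in> {0..T}" for t
      using Db_bound[OF that, of "Z u t" "(Y u v t, v t)"] by (simp add: algebra_simps)
  qed (use L in simp)
  then show ?thesis using Y_solves(2)[OF u v] by (simp add: nrm1_eq cE_def mult_ac)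
qed

text \<open>The defect solves the homogeneous linearized equation with initial value zero, so
  Gronwall's inequality annihilates it.\<close>

lemma Y_linear:
  assumes u: "u \<in> L2 T" and v: "v \<in> L2 T" and w: "w \<in> L2 T" and t: "t \<in> {0..T}"
  shows "Y u (\<lambda>t. a *\<^sub>R v t + w t) t = a *\<^sub>R Y u v t + Y u w t"
proof -
  let ?q = "\<lambda>t. a *\<^sub>R v t + w t"
  have q: "?q \<in> L2 T" by (intro L2_add(1) L2_scale(1) v w)
  let ?d = "\<lambda>t. Y u ?q t - (a *\<^sub>R Y u v t + Y u w t)"
  let ?\<phi> = "\<lambda>t. Db t (Z u t) (Y u ?q t, ?q t) - (a *\<^sub>R Db t (Z u t) (Y u v t, v t) + Db t (Z u t) (Y u w t, w t))"
  have p: "primitive_on T ?\<phi> ?d"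
    by (intro primitive_on_diff primitive_on_add primitive_on_scale Y_solves(1) u v w q)
  have "norm (?d t) \<le> exp (L * T) * (norm (?d 0) + (LINT t|leb T. 0))"
  proof (rule gronwall_forward[OF p T0 L0 _ _ _ t])
    fix t assume t: "t \<in> {0..T}"
    have "?\<phi> t = Db t (Z u t) ((Y u ?q t, ?q t) - (a *\<^sub>R (Y u v t, v t) + (Y u w t, w t)))"
      by (simp only: linear_diff[OF Db_linear[OF t]] linear_add[OF Db_linear[OF t]] linear_scale[OF Db_linear[OF t]])
    also have "\<dots> = Db t (Z u t) (?d t, 0)" by simp
    finally show "norm (?\<phi> t) \<le> L * norm (?d t) + 0"
      using Db_bound[OF t, of "Z u t" "(?d t, 0)"] by simp
  qed auto
  then show ?thesis by (simp add: Y_solves(2) u v w q)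
qed

text \<open>The source of the difference equation contains the pointwise product of
  \<open>u - w\<close> and \<open>v\<close>, whose integral is controlled by the Cauchy-Schwarz
  inequality. This is why \<open>L2\<close> norms appear here, whereas \<open>L1\<close> norms
  suffice for \<open>X_diff\<close> and \<open>P_diff\<close>.\<close>

lemma Y_diff:
  assumes u: "u \<in> L2 T" and w: "w \<in> L2 T" and v: "v \<in> L2 T" and t: "t \<in> {0..T}"
  shows "norm (Y u v t - Y w v t) \<le> Cy * nrm2 T (\<lambda>t. u t - w t) * nrm2 T v"
proof -
  define d where "d = nrm1 T (\<lambda>t. u t - w t)"
  define D where "D = nrm2 T (\<lambda>t. u t - w t)"
  define n where "n = nrm1 T v"
  define V where "V = nrm2 T v"
  have pos: "0 \<le> d" "0 \<le> D" "0 \<le> n" "0 \<le> V" by (auto simp: d_def D_def n_def V_def)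
  have uw: "(\<lambda>t. u t - w t) \<in> L2 T" by (intro L2_diff u w)
  note i = L2_norm_integrable[OF uw] L2_norm_integrable[OF v] L2_mult_integrable[OF uw v]
  define k where "k = (\<lambda>t. L * (cE * d * (cE * n) + cE * d * norm (v t) + cE * n * norm (u t - w t) + norm (u t - w t) * norm (v t)))"
  have ik: "integrable (leb T) k" using i by (simp add: k_def)
  have "norm (Y u v t - Y w v t) \<le> exp (L * T) * (norm (Y u v 0 - Y w v 0) + (LINT t|leb T. k t))"
  proof (rule gronwall_forward[OF primitive_on_diff[OF Y_solves(1)[OF u v] Y_solves(1)[OF w v]] T0 L0 ik _ _ t])
    fix t assume t: "t \<in> {0..T}"
    let ?y = "Y u v t - Y w v t" and ?h = "(Y w v t, v t)"
    have "Db t (Z u t) (Y u v t, v t) = Db t (Z u t) ((?y, 0) + ?h)" by simp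
    also have "\<dots> = Db t (Z u t) (?y, 0) + Db t (Z u t) ?h" by (rule linear_add[OF Db_linear[OF t]])
    finally have "norm (Db t (Z u t) (Y u v t, v t) - Db t (Z w t) (Y w v t, v t))
        \<le> norm (Db t (Z u t) (?y, 0)) + norm (Db t (Z u t) ?h - Db t (Z w t) ?h)"
      using norm_triangle_ineq[of "Db t (Z u t) (?y, 0)" "Db t (Z u t) ?h - Db t (Z w t) ?h"] by (simp add: add_diff_eq)
    also have "norm (Db t (Z u t) (?y, 0)) \<le> L * norm ?y" using Db_bound[OF t, of "Z u t" "(?y, 0)"] by simp
    also have "norm (Db t (Z u t) ?h - Db t (Z w t) ?h) \<le> L * (norm (X u t - X w t) + norm (u t - w t)) * norm ?h"
      using deriv_increment_le[OF b_deriv[OF t], of "Z u t" ?h "Z w t"] by (simp add: Z_def)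
    also have "\<dots> \<le> L * (cE * d + norm (u t - w t)) * (cE * n + norm (v t))"
      using X_diff[OF u w t] order_trans[OF norm_Pair_le[of "Y w v t" "v t"] add_right_mono[OF Y_bound[OF w v t], of "norm (v t)"]] L cE_pos pos
      by (intro mult_mono mult_left_mono) (auto simp: d_def n_def)
    also have "\<dots> = k t" by (simp add: k_def algebra_simps)
    finally show "norm (Db t (Z u t) (Y u v t, v t) - Db t (Z w t) (Y w v t, v t)) \<le> L * norm ?y + k t" by simp
    show "0 \<le> k t" unfolding k_def using L cE_pos pos by (intro mult_nonneg_nonneg add_nonneg_nonneg) auto
  qed
  also have "norm (Y u v 0 - Y w v 0) = 0" by (simp add: Y_solves(2) u v w)
  also have "(LINT t|leb T. k t) = L * ((cE * cE * T + 2 * cE) * (d * n) + (LINT t|leb T. norm (u t - w t) * norm (v t)))"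
    using i T0 by (simp add: k_def d_def n_def nrm1_eq measure_leb algebra_simps)
  also have "exp (L * T) * (0 + L * ((cE * cE * T + 2 * cE) * (d * n) + (LINT t|leb T. norm (u t - w t) * norm (v t))))
    = cE * ((cE * cE * T + 2 * cE) * (d * n) + (LINT t|leb T. norm (u t - w t) * norm (v t)))"
    by (simp add: cE_def mult_ac)
  \<comment> \<open>The coefficient is enlarged by means of \<open>cE \<le> C1\<close> to the one in
    the definition of \<open>C_y\<close>.\<close>
  also have "\<dots> \<le> cE * ((C1 + cE + C1 * cE * T) * (T * (D * V)) + D * V)"
  proof -
    have dn: "d * n \<le> T * (D * V)" using nrm1_mult_le[OF uw v T0] by (simp add: d_def n_def D_def V_def)
    have cs: "(LINT t|leb T. norm (u t - w t) * norm (v t)) \<le> D * V"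
      using L2_Cauchy_Schwarz[OF uw v] by (simp add: D_def V_def)
    have c: "cE \<le> C1" using Cx_ge(2) C1_ge(1) by linarith
    have "cE * (cE * T) \<le> C1 * (cE * T)" using c cE_pos T by (intro mult_right_mono) auto
    then have "cE * cE * T + 2 * cE \<le> C1 + cE + C1 * cE * T" using c by (simp add: mult.assoc)
    then have "(cE * cE * T + 2 * cE) * (d * n) \<le> (C1 + cE + C1 * cE * T) * (T * (D * V))"
      by (rule mult_mono[OF _ dn]) (use cE_pos C1_pos T pos in auto)
    then show ?thesis
      by (intro mult_left_mono add_mono cs) (use cE_pos in auto)
  qed
  also have "\<dots> = Cy * D * V" unfolding Cy_eq by (simp add: algebra_simps)
  finally show ?thesis by (simp add: D_def V_def)
qed

section \<open>The Hessian form and its Lipschitz dependence on the control\<close>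

definition W :: "(real \<Rightarrow> 'u) \<Rightarrow> (real \<Rightarrow> 'u) \<Rightarrow> real \<Rightarrow> 'x \<times> 'u" where
  "W u v t = (Y u v t, v t)"

lemma W_L2:
  assumes u: "u \<in> L2 T" and v: "v \<in> L2 T"
  shows "W u v \<in> L2 T" "nrm2 T (W u v) \<le> (cE * T + 1) * nrm2 T v"
proof -
  define k where "k = (\<lambda>t. cE * nrm1 T v + norm (v t))"
  have k: "k \<in> L2 T" unfolding k_def by (intro L2_add(1) L2_const L2_norm v)
  have m: "W u v \<in> borel_measurable (leb T)"
    unfolding W_def by (intro borel_measurable_Pair continuous_measurable_leb[OF Y_continuous[OF u v]] L2_measurable[OF v])
  have le: "norm (W u v t) \<le> norm (k t)" if "t \<in> {0..T}" for t
  proof -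
    have "norm (W u v t) \<le> k t"
      using norm_Pair_le[of "Y u v t" "v t"] Y_bound[OF u v that] by (simp add: W_def k_def)
    then show ?thesis by simp
  qed
  show "W u v \<in> L2 T" by (rule L2_bound(1)[OF m k le])
  have "nrm2 T (W u v) \<le> nrm2 T k" by (rule L2_bound(2)[OF m k le])
  also have "\<dots> \<le> nrm2 T (\<lambda>t. cE * nrm1 T v) + nrm2 T (\<lambda>t. norm (v t))"
    unfolding k_def by (intro L2_add(2) L2_const L2_norm v)
  also have "\<dots> = sqrt T * (cE * nrm1 T v) + nrm2 T v"
    using cE_pos by (simp add: nrm2_const[OF T0] L2_norm abs_mult)
  also have "\<dots> \<le> sqrt T * (cE * (sqrt T * nrm2 T v)) + nrm2 T v"
    using cE_pos T by (intro add_right_mono mult_left_mono nrm1_le_nrm2[OF v T0]) auto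
  also have "\<dots> = cE * (sqrt T * sqrt T) * nrm2 T v + nrm2 T v" by (simp only: mult_ac)
  finally show "nrm2 T (W u v) \<le> (cE * T + 1) * nrm2 T v" using T0 by (simp add: algebra_simps)
qed

lemma D2_linear:
  assumes t: "t \<in> {0..T}"
  shows "linear (\<lambda>h. D2H t z \<pi> h k)" "linear (D2H t z \<pi> h)"
  unfolding D2H_def
  by (rule linearI; simp add: linear_add[OF twice_deriv_linear(2)[OF b_deriv[OF t]]] linear_scale[OF twice_deriv_linear(2)[OF b_deriv[OF t]]]
      linear_add[OF twice_deriv_linear(2)[OF f_deriv[OF t]]] linear_scale[OF twice_deriv_linear(2)[OF f_deriv[OF t]]]
      linear_add[OF twice_deriv_linear(3)[OF b_deriv[OF t]]] linear_scale[OF twice_deriv_linear(3)[OF b_deriv[OF t]]]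
      linear_add[OF twice_deriv_linear(3)[OF f_deriv[OF t]]] linear_scale[OF twice_deriv_linear(3)[OF f_deriv[OF t]]]
      inner_add_left algebra_simps)+

lemma D2H_symmetric:
  assumes t: "t \<in> {0..T}" shows "D2H t z \<pi> h k = D2H t z \<pi> k h"
  using twice_deriv_block_symmetric[OF b_deriv[OF t] b_block[OF t] L0, of z h k]
    twice_deriv_block_symmetric[OF f_deriv[OF t] f_block[OF t] L0, of z h k] by (simp add: D2H_def)

lemma D2g_symmetric: "D2g z h k = D2g z k h"
  by (rule twice_deriv_symmetric[OF g_deriv L0 g_lipschitz])

lemma D2g_linear: "linear (\<lambda>h. D2g z h k)" "linear (D2g z h)"
  using twice_deriv_linear[OF g_deriv] by auto

lemma D2H_bound:
  assumes t: "t \<in> {0..T}" shows "\<bar>D2H t z \<pi> h k\<bar> \<le> L * (1 + norm \<pi>) * norm h * norm k"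
  using inner_le[OF twice_derivD(3)[OF b_deriv[OF t]], of z h k \<pi>] twice_derivD(3)[OF f_deriv[OF t], of z h k]
  by (simp add: D2H_def algebra_simps)

lemma D2H_comp:
  "z \<in> borel_measurable (leb T) \<Longrightarrow> p \<in> borel_measurable (leb T) \<Longrightarrow> h \<in> borel_measurable (leb T) \<Longrightarrow>
   k \<in> borel_measurable (leb T) \<Longrightarrow> (\<lambda>t. D2H t (z t) (p t) (h t) (k t)) \<in> borel_measurable (leb T)"
  unfolding D2H_def by (intro borel_measurable_add borel_measurable_inner D2b_comp D2f_comp)

lemma D2H_diff_gen:
  assumes t: "t \<in> {0..T}"
    and b: "norm (D2b t z h k - D2b t z' h k) \<le> L * \<delta> * norm h * norm k"
    and f: "norm (D2f t z h k - D2f t z' h k) \<le> L * \<delta> * norm h * norm k"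
  shows "\<bar>D2H t z \<pi> h k - D2H t z' \<pi>' h k\<bar> \<le> (L * \<delta> * (1 + norm \<pi>') + L * norm (\<pi> - \<pi>')) * norm h * norm k"
proof -
  have "D2H t z \<pi> h k - D2H t z' \<pi>' h k =
      (D2b t z h k - D2b t z' h k) \<bullet> \<pi>' + D2b t z h k \<bullet> (\<pi> - \<pi>') + (D2f t z h k - D2f t z' h k)"
    by (simp add: D2H_def inner_diff_left inner_diff_right)
  then show ?thesis
    using inner_le[OF b, of \<pi>'] inner_le[OF twice_derivD(3)[OF b_deriv[OF t]], of z h k "\<pi> - \<pi>'"] f
    by (simp add: algebra_simps)
qed

text \<open>The contributions of state, adjoint and control are sorted into a multiple of the
  \<open>L1\<close> distance and a multiple of the pointwise distance of the controls;
  \<open>C_H\<close> is the larger of the two coefficients.\<close>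

lemma
  assumes u: "u \<in> L2 T" and w: "w \<in> L2 T" and t: "t \<in> {0..T}"
  shows D2H_state_diff: "\<bar>D2H t (Z u t) (P u t) h k - D2H t (Z w t) (P w t) h k\<bar>
      \<le> C1 * (1 + nrm1 T w) * (nrm1 T (\<lambda>t. u t - w t) + norm (u t - w t)) * norm h * norm k" (is ?A)
    and D2H_state_diff_uu: "\<bar>D2H t (Z u t) (P u t) (0, h2) (0, k2) - D2H t (Z w t) (P w t) (0, h2) (0, k2)\<bar>
      \<le> C1 * (1 + nrm1 T w) * nrm1 T (\<lambda>t. u t - w t) * norm h2 * norm k2" (is ?B)
    and D2H_state_bound: "\<bar>D2H t (Z w t) (P w t) h k\<bar> \<le> C1 * (1 + nrm1 T w) * norm h * norm k" (is ?C)
proof -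
  define N where "N = 1 + nrm1 T w"
  define d where "d = nrm1 T (\<lambda>t. u t - w t)"
  define \<delta> where "\<delta> = norm (u t - w t)"
  have pos: "1 \<le> N" "0 \<le> d" "0 \<le> \<delta>" by (auto simp: N_def d_def \<delta>_def)
  have x: "norm (X u t - X w t) \<le> Cx * d"
    using X_diff[OF u w t] mult_right_mono[OF Cx_ge(2), of d] pos by (simp add: d_def)
  have p: "1 + norm (P w t) \<le> (1 + Cp) * N"
  proof -
    have "norm (P w t) \<le> Cp * N"
      using P_bound[OF w t] mult_right_mono[OF Cp_ge(1), of N] pos by (simp add: N_def)
    then show ?thesis using pos by (simp add: distrib_right)
  qed
  have dp: "norm (P u t - P w t) \<le> Cp * N * d"
    using P_diff[OF u w t] by (simp add: N_def d_def)
  \<comment> \<open>One inequality for both difference estimates: \<open>e2\<close> is the pointwise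
    distance of the controls in general and 0 in the control block.\<close>
  have main: "L * (e1 + e2) * (1 + norm (P w t)) + L * norm (P u t - P w t) \<le> C1 * N * (d + e2)"
    if "0 \<le> e1" "e1 \<le> Cx * d" "0 \<le> e2" for e1 e2
  proof -
    have "L * (e1 + e2) * (1 + norm (P w t)) + L * norm (P u t - P w t)
        \<le> L * (Cx * d + e2) * ((1 + Cp) * N) + L * (Cp * N * d)"
      using that p dp L Cx_pos pos by (intro add_mono mult_mono mult_left_mono) auto
    also have "\<dots> = N * (L * (Cp + Cx + Cp * Cx) * d + L * (1 + Cp) * e2)"
      by (simp add: algebra_simps)
    also have "\<dots> \<le> N * (C1 * d + C1 * e2)"
      using CH_ge C1_ge(3) pos that by (intro mult_left_mono add_mono mult_right_mono) auto
    finally show ?thesis by (simp add: algebra_simps)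
  qed
  have "\<bar>D2H t (Z u t) (P u t) h k - D2H t (Z w t) (P w t) h k\<bar>
      \<le> (L * (norm (X u t - X w t) + \<delta>) * (1 + norm (P w t)) + L * norm (P u t - P w t)) * norm h * norm k"
    by (rule D2H_diff_gen[OF t])
      (use lipschitz_blockD(1)[OF b_block[OF t], of "Z u t" h k "Z w t"]
        lipschitz_blockD(1)[OF f_block[OF t], of "Z u t" h k "Z w t"] in \<open>auto simp: Z_def \<delta>_def\<close>)
  also have "\<dots> \<le> C1 * N * (d + \<delta>) * norm h * norm k"
    by (intro mult_right_mono main) (use x pos in auto)
  finally show ?A by (simp add: N_def d_def \<delta>_def)
  have "\<bar>D2H t (Z u t) (P u t) (0, h2) (0, k2) - D2H t (Z w t) (P w t) (0, h2) (0, k2)\<bar>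
      \<le> (L * (norm (X u t - X w t) + 0) * (1 + norm (P w t)) + L * norm (P u t - P w t)) * norm ((0, h2) :: 'x \<times> 'u) * norm ((0, k2) :: 'x \<times> 'u)"
    by (rule D2H_diff_gen[OF t])
      (use lipschitz_blockD(2)[OF b_block[OF t], of "Z u t" h2 k2 "Z w t"]
        lipschitz_blockD(2)[OF f_block[OF t], of "Z u t" h2 k2 "Z w t"] in \<open>auto simp: Z_def norm_Pair\<close>)
  also have "\<dots> \<le> C1 * N * (d + 0) * norm ((0, h2) :: 'x \<times> 'u) * norm ((0, k2) :: 'x \<times> 'u)"
    by (intro mult_right_mono main) (use x pos in auto)
  finally show ?B by (simp add: N_def d_def norm_Pair)
  have "\<bar>D2H t (Z w t) (P w t) h k\<bar> \<le> L * (1 + norm (P w t)) * norm h * norm k"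
    by (rule D2H_bound[OF t])
  also have "\<dots> \<le> C1 * N * norm h * norm k"
  proof (intro mult_right_mono)
    have "L * (1 + norm (P w t)) \<le> L * ((1 + Cp) * N)" using p L by (intro mult_left_mono) auto
    also have "\<dots> = (L * (1 + Cp)) * N" by (simp only: mult.assoc)
    also have "\<dots> \<le> C1 * N" using CH_ge(2) C1_ge(3) pos by (intro mult_right_mono) auto
    finally show "L * (1 + norm (P w t)) \<le> C1 * N" .
  qed auto
  finally show ?C by (simp add: N_def)
qed

definition B :: "(real \<Rightarrow> 'u) \<Rightarrow> (real \<Rightarrow> 'u) \<Rightarrow> (real \<Rightarrow> 'u) \<Rightarrow> real" where
  "B u v w = (LINT t|leb T. D2H t (Z u t) (P u t) (W u v t) (W u w t)) + D2g (X u T) (Y u v T) (Y u w T)"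

lemma D2H_integrable:
  fixes h k :: "real \<Rightarrow> 'x \<times> 'u"
  assumes u: "u \<in> L2 T" and h: "h \<in> L2 T" and k: "k \<in> L2 T"
  shows "integrable (leb T) (\<lambda>t. D2H t (Z u t) (P u t) (h t) (k t))"
    and "\<bar>LINT t|leb T. D2H t (Z u t) (P u t) (h t) (k t)\<bar> \<le> C1 * (1 + nrm1 T u) * (nrm2 T h * nrm2 T k)"
proof -
  have m: "(\<lambda>t. D2H t (Z u t) (P u t) (h t) (k t)) \<in> borel_measurable (leb T)"
    by (intro D2H_comp Z_measurable[OF u] continuous_measurable_leb[OF P_continuous[OF u]] L2_measurable h k)
  have i: "integrable (leb T) (\<lambda>t. C1 * (1 + nrm1 T u) * (norm (h t) * norm (k t)))"
    using L2_mult_integrable[OF h k] by simp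
  have le: "norm (D2H t (Z u t) (P u t) (h t) (k t)) \<le> C1 * (1 + nrm1 T u) * (norm (h t) * norm (k t))" if "t \<in> {0..T}" for t
    using D2H_state_bound[OF u u that, of "h t" "k t"] by (simp add: mult.assoc)
  show "integrable (leb T) (\<lambda>t. D2H t (Z u t) (P u t) (h t) (k t))"
    by (rule integrable_leb_bound(1)[OF m i le])
  have "norm (LINT t|leb T. D2H t (Z u t) (P u t) (h t) (k t)) \<le> (LINT t|leb T. C1 * (1 + nrm1 T u) * (norm (h t) * norm (k t)))"
    by (rule integrable_leb_bound(2)[OF m i le])
  also have "\<dots> = C1 * (1 + nrm1 T u) * (LINT t|leb T. norm (h t) * norm (k t))" by simp
  also have "\<dots> \<le> C1 * (1 + nrm1 T u) * (nrm2 T h * nrm2 T k)"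
    using C1_pos by (intro mult_left_mono L2_Cauchy_Schwarz h k) (auto intro: add_nonneg_nonneg)
  finally show "\<bar>LINT t|leb T. D2H t (Z u t) (P u t) (h t) (k t)\<bar> \<le> C1 * (1 + nrm1 T u) * (nrm2 T h * nrm2 T k)" by simp
qed

lemma W_linear:
  assumes "u \<in> L2 T" "v \<in> L2 T" "w \<in> L2 T" "t \<in> {0..T}"
  shows "W u (\<lambda>t. a *\<^sub>R v t + w t) t = a *\<^sub>R W u v t + W u w t"
  using Y_linear[OF assms] by (simp add: W_def)

lemma B_linear:
  assumes u: "u \<in> L2 T" and v: "v \<in> L2 T" and w: "w \<in> L2 T" and q: "q \<in> L2 T"
  shows "B u (\<lambda>t. a *\<^sub>R v t + w t) q = a * B u v q + B u w q"
proof -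
  note i = D2H_integrable(1)[OF u W_L2(1)[OF u v] W_L2(1)[OF u q]] D2H_integrable(1)[OF u W_L2(1)[OF u w] W_L2(1)[OF u q]]
  have "(LINT t|leb T. D2H t (Z u t) (P u t) (W u (\<lambda>t. a *\<^sub>R v t + w t) t) (W u q t))
      = (LINT t|leb T. a * D2H t (Z u t) (P u t) (W u v t) (W u q t) + D2H t (Z u t) (P u t) (W u w t) (W u q t))"
    by (rule Bochner_Integration.integral_cong)
      (auto simp: W_linear[OF u v w] linear_add[OF D2_linear(1)] linear_scale[OF D2_linear(1)])
  also have "\<dots> = a * (LINT t|leb T. D2H t (Z u t) (P u t) (W u v t) (W u q t))
     + (LINT t|leb T. D2H t (Z u t) (P u t) (W u w t) (W u q t))"
    using i by simp
  finally have 1: "(LINT t|leb T. D2H t (Z u t) (P u t) (W u (\<lambda>t. a *\<^sub>R v t + w t) t) (W u q t))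
     = a * (LINT t|leb T. D2H t (Z u t) (P u t) (W u v t) (W u q t)) + (LINT t|leb T. D2H t (Z u t) (P u t) (W u w t) (W u q t))" .
  have "D2g (X u T) (Y u (\<lambda>t. a *\<^sub>R v t + w t) T) (Y u q T)
      = a * D2g (X u T) (Y u v T) (Y u q T) + D2g (X u T) (Y u w T) (Y u q T)"
    by (simp add: Y_linear[OF u v w T_mem] linear_add[OF D2g_linear(1)] linear_scale[OF D2g_linear(1)])
  with 1 show ?thesis by (simp add: B_def distrib_left)
qed

lemma B_symmetric: "B u v w = B u w v"
proof -
  have "(LINT t|leb T. D2H t (Z u t) (P u t) (W u v t) (W u w t)) = (LINT t|leb T. D2H t (Z u t) (P u t) (W u w t) (W u v t))"
    by (rule Bochner_Integration.integral_cong) (auto intro: D2H_symmetric)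
  then show ?thesis by (simp add: B_def D2g_symmetric[of _ "Y u v T"])
qed

lemma B_bounded:
  assumes u: "u \<in> L2 T"
  shows "\<exists>K\<ge>0. \<forall>v\<in>L2 T. \<forall>w\<in>L2 T. \<bar>B u v w\<bar> \<le> K * nrm2 T v * nrm2 T w"
proof -
  define K where "K = C1 * (1 + nrm1 T u) * ((cE * T + 1) * (cE * T + 1)) + L * (cE * cE * T)"
  have K0: "0 \<le> K" unfolding K_def using C1_pos cE_pos T L by (intro add_nonneg_nonneg mult_nonneg_nonneg) auto
  have "\<bar>B u v w\<bar> \<le> K * nrm2 T v * nrm2 T w" if v: "v \<in> L2 T" and w: "w \<in> L2 T" for v w
  proof -
    define V where "V = nrm2 T v"
    define Q where "Q = nrm2 T w"
    have "\<bar>LINT t|leb T. D2H t (Z u t) (P u t) (W u v t) (W u w t)\<bar> \<le> C1 * (1 + nrm1 T u) * (nrm2 T (W u v) * nrm2 T (W u w))"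
      by (rule D2H_integrable(2)[OF u W_L2(1)[OF u v] W_L2(1)[OF u w]])
    also have "\<dots> \<le> C1 * (1 + nrm1 T u) * (((cE * T + 1) * V) * ((cE * T + 1) * Q))"
      unfolding V_def Q_def using C1_pos cE_pos T
      by (intro mult_left_mono mult_mono W_L2 u v w) (auto intro: add_nonneg_nonneg)
    finally have 1: "\<bar>LINT t|leb T. D2H t (Z u t) (P u t) (W u v t) (W u w t)\<bar> \<le> C1 * (1 + nrm1 T u) * (((cE * T + 1) * V) * ((cE * T + 1) * Q))" .
    have "\<bar>D2g (X u T) (Y u v T) (Y u w T)\<bar> \<le> L * norm (Y u v T) * norm (Y u w T)"
      using twice_derivD(3)[OF g_deriv] by simp
    also have "\<dots> \<le> L * (cE * nrm1 T v) * (cE * nrm1 T w)"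
      using L cE_pos by (intro mult_mono mult_left_mono Y_bound u v w T_mem) auto
    also have "\<dots> = L * (cE * cE) * (nrm1 T v * nrm1 T w)" by (simp only: mult_ac)
    also have "\<dots> \<le> L * (cE * cE) * (T * (V * Q))"
      unfolding V_def Q_def using L cE_pos by (intro mult_left_mono nrm1_mult_le v w T0) auto
    finally have 2: "\<bar>D2g (X u T) (Y u v T) (Y u w T)\<bar> \<le> L * (cE * cE) * (T * (V * Q))" .
    have "\<bar>B u v w\<bar> \<le> C1 * (1 + nrm1 T u) * (((cE * T + 1) * V) * ((cE * T + 1) * Q)) + L * (cE * cE) * (T * (V * Q))"
      unfolding B_def using 1 2 by linarith
    also have "\<dots> = K * V * Q" by (simp add: K_def algebra_simps)
    finally show ?thesis by (simp add: V_def Q_def)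
  qed
  then show ?thesis using K0 by blast
qed

text \<open>The block of the Hessian in the control alone does not see the difference of the controls
  pointwise, so that the difference of the forms is bounded in the \<open>L\<^sup>2\<close> norm.\<close>

lemma B_lipschitz:
  assumes u: "u \<in> L2 T" and w: "w \<in> L2 T" and v: "v \<in> L2 T" and q: "q \<in> L2 T"
  shows "\<bar>B u v q - B w v q\<bar> \<le> C4 * (1 + nrm1 T w) * nrm2 T (\<lambda>t. u t - w t) * nrm2 T v * nrm2 T q"
proof -
  define N where "N = 1 + nrm1 T w"
  define \<delta> where "\<delta> = (\<lambda>t. u t - w t)"
  define d where "d = nrm1 T \<delta>"
  define D where "D = nrm2 T \<delta>"
  define V where "V = nrm2 T v"
  define Q where "Q = nrm2 T q"
  define s where "s = sqrt T"
  define y1 where "y1 = cE * nrm1 T v"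
  define y2 where "y2 = cE * nrm1 T q"
  define m1 where "m1 = Cy * D * V"
  define m2 where "m2 = Cy * D * Q"
  have \<delta>L: "\<delta> \<in> L2 T" unfolding \<delta>_def by (intro L2_diff u w)
  have pos: "1 \<le> N" "0 \<le> d" "0 \<le> D" "0 \<le> V" "0 \<le> Q" "0 \<le> s" "0 \<le> y1" "0 \<le> y2" "0 \<le> m1" "0 \<le> m2" "s * s = T"
    using T cE_pos Cy_pos by (auto simp: N_def d_def D_def V_def Q_def s_def y1_def y2_def m1_def m2_def)
  have C1N: "0 \<le> C1 * N" using C1_pos pos by simp
  have Yv: "norm (Y u v t) \<le> y1" "norm (Y w v t) \<le> y1" "norm (Y u v t - Y w v t) \<le> m1"
    and Yq: "norm (Y u q t) \<le> y2" "norm (Y w q t) \<le> y2" "norm (Y u q t - Y w q t) \<le> m2" if "t \<in> {0..T}" for t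
    using Y_bound[OF u v that] Y_bound[OF w v that] Y_bound[OF u q that] Y_bound[OF w q that]
      Y_diff[OF u w v that] Y_diff[OF u w q that]
    by (auto simp: y1_def y2_def m1_def m2_def D_def V_def Q_def \<delta>_def)
  have nW: "norm (W u' r t) \<le> norm (Y u' r t) + norm (r t)" for u' r t
    unfolding W_def by (rule norm_Pair_le)
  note i = L2_norm_integrable[OF \<delta>L] L2_norm_integrable[OF v] L2_norm_integrable[OF q]
    L2_mult_integrable[OF \<delta>L v] L2_mult_integrable[OF \<delta>L q] L2_mult_integrable[OF v q]
  define k where "k = (\<lambda>t. C1 * N * ((d + norm (\<delta> t)) * (y1 * y2) + y1 * (d * norm (q t) + norm (\<delta> t) * norm (q t))
    + y2 * (d * norm (v t) + norm (\<delta> t) * norm (v t)) + d * (norm (v t) * norm (q t))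
    + m1 * (y2 + norm (q t)) + m2 * (y1 + norm (v t))))"
  have ik: "integrable (leb T) k" using i by (simp add: k_def)
  define I1 where "I1 = (\<lambda>t. D2H t (Z u t) (P u t) (W u v t) (W u q t))"
  define I2 where "I2 = (\<lambda>t. D2H t (Z w t) (P w t) (W w v t) (W w q t))"
  have iI: "integrable (leb T) I1" "integrable (leb T) I2"
    unfolding I1_def I2_def by (intro D2H_integrable W_L2 u w v q)+
  have le: "norm (I1 t - I2 t) \<le> k t" if t: "t \<in> {0..T}" for t
  proof -
    note y = Yv[OF t] Yq[OF t]
    define A where "A = (\<lambda>h k. D2H t (Z u t) (P u t) h k - D2H t (Z w t) (P w t) h k)"
    define Hw where "Hw = D2H t (Z w t) (P w t)"
    have l: "linear (\<lambda>h. Hw h k)" "linear (Hw h)" "linear (\<lambda>h. A h k)" "linear (A h)" for h k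
      unfolding Hw_def A_def by (intro linear_compose_sub D2_linear[OF t])+
    have A1: "\<bar>A h k\<bar> \<le> C1 * N * (d + norm (\<delta> t)) * (norm h * norm k)" for h k
      using D2H_state_diff[OF u w t, of h k] by (simp add: A_def N_def d_def \<delta>_def mult.assoc)
    have A2: "\<bar>A (0, h) (0, k)\<bar> \<le> C1 * N * d * (norm h * norm k)" for h k
      using D2H_state_diff_uu[OF u w t, of h k] by (simp add: A_def N_def d_def \<delta>_def mult.assoc)
    have H1: "\<bar>Hw h k\<bar> \<le> C1 * N * (norm h * norm k)" for h k
      using D2H_state_bound[OF u w t, of h k] by (simp add: Hw_def N_def mult.assoc)
    \<comment> \<open>Telescoping: first the Hessian changes, then the first argument, then the
      second. The arguments differ in their state components only.\<close>
    have e1: "I1 t - I2 t = A (W u v t) (W u q t) + Hw (Y u v t - Y w v t, 0) (W u q t) + Hw (W w v t) (Y u q t - Y w q t, 0)"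
    proof -
      have a: "W u v t = (Y u v t - Y w v t, 0) + W w v t" "W u q t = (Y u q t - Y w q t, 0) + W w q t"
        by (auto simp: W_def)
      have "Hw (W u v t) (W u q t) = Hw (Y u v t - Y w v t, 0) (W u q t) + Hw (W w v t) (W u q t)"
        by (subst (1) a(1)) (rule linear_add[OF l(1)])
      moreover have "Hw (W w v t) (W u q t) = Hw (W w v t) (Y u q t - Y w q t, 0) + Hw (W w v t) (W w q t)"
        by (subst (1) a(2)) (rule linear_add[OF l(2)])
      ultimately show ?thesis by (simp add: I1_def I2_def A_def Hw_def)
    qed
    have C: "0 \<le> C1 * N * (d + norm (\<delta> t))" using C1N pos by simp
    \<comment> \<open>The blocks are separated because the product of the three functions
      \<open>\<delta>\<close>, \<open>v\<close> and \<open>q\<close> need not be integrable;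
      \<open>A2\<close> keeps it out of the last block.\<close>
    have e2: "A (W u v t) (W u q t) = A (Y u v t, 0) (Y u q t, 0) + A (Y u v t, 0) (0, q t) + A (0, v t) (Y u q t, 0) + A (0, v t) (0, q t)"
      using bilinear_split_pair[of A "W u v t" "W u q t", OF l(3,4)] by (simp add: W_def)
    have b1: "\<bar>A (Y u v t, 0) (Y u q t, 0)\<bar> \<le> C1 * N * (d + norm (\<delta> t)) * (y1 * y2)"
      by (rule order_trans[OF A1], intro mult_left_mono mult_mono C) (use y pos in \<open>auto simp: norm_Pair\<close>)
    have b2: "\<bar>A (Y u v t, 0) (0, q t)\<bar> \<le> C1 * N * (d + norm (\<delta> t)) * (y1 * norm (q t))"
      by (rule order_trans[OF A1], intro mult_left_mono mult_mono C) (use y pos in \<open>auto simp: norm_Pair\<close>)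
    have b3: "\<bar>A (0, v t) (Y u q t, 0)\<bar> \<le> C1 * N * (d + norm (\<delta> t)) * (norm (v t) * y2)"
      by (rule order_trans[OF A1], intro mult_left_mono mult_mono C) (use y pos in \<open>auto simp: norm_Pair\<close>)
    have b5: "\<bar>Hw (Y u v t - Y w v t, 0) (W u q t)\<bar> \<le> C1 * N * (m1 * (y2 + norm (q t)))"
      by (rule order_trans[OF H1], intro mult_left_mono mult_mono C1N)
        (use y pos order_trans[OF nW[of u q t] add_right_mono[OF y(4)]] in \<open>auto simp: norm_Pair\<close>)
    have b6: "\<bar>Hw (W w v t) (Y u q t - Y w q t, 0)\<bar> \<le> C1 * N * ((y1 + norm (v t)) * m2)"
      by (rule order_trans[OF H1], intro mult_left_mono mult_mono C1N)
        (use y pos order_trans[OF nW[of w v t] add_right_mono[OF y(2)]] in \<open>auto simp: norm_Pair\<close>)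
    have "norm (I1 t - I2 t) \<le> C1 * N * (d + norm (\<delta> t)) * (y1 * y2) + C1 * N * (d + norm (\<delta> t)) * (y1 * norm (q t))
      + C1 * N * (d + norm (\<delta> t)) * (norm (v t) * y2) + C1 * N * d * (norm (v t) * norm (q t))
      + C1 * N * (m1 * (y2 + norm (q t))) + C1 * N * ((y1 + norm (v t)) * m2)"
      unfolding e1 e2 real_norm_def using b1 b2 b3 A2[of "v t" "q t"] b5 b6 by linarith
    also have "\<dots> = k t" by (simp add: k_def algebra_simps)
    finally show ?thesis .
  qed
  have "\<bar>(LINT t|leb T. I1 t) - (LINT t|leb T. I2 t)\<bar> = norm (LINT t|leb T. I1 t - I2 t)" using iI by simp
  also have "\<dots> \<le> (LINT t|leb T. k t)"
    by (rule Bochner_Integration.integral_norm_bound_integral[OF _ ik]) (use iI le in auto)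
  also have "\<dots> = C1 * N * ((d * T + d) * (y1 * y2) + y1 * (d * nrm1 T q + (LINT t|leb T. norm (\<delta> t) * norm (q t)))
    + y2 * (d * nrm1 T v + (LINT t|leb T. norm (\<delta> t) * norm (v t))) + d * (LINT t|leb T. norm (v t) * norm (q t))
    + m1 * (y2 * T + nrm1 T q) + m2 * (y1 * T + nrm1 T v))"
  proof -
    have e: "(LINT t|leb T. norm (\<delta> t)) = d" "(LINT t|leb T. norm (v t)) = nrm1 T v" "(LINT t|leb T. norm (q t)) = nrm1 T q"
      by (auto simp: d_def nrm1_eq)
    show ?thesis
      unfolding k_def using i T0 by (simp add: measure_leb e mult.commute[of T])
  qed
  \<comment> \<open>Each \<open>L1\<close> norm is replaced by \<open>s\<close> times the
    \<open>L2\<close> norm, so that every summand acquires the common factor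
    \<open>D * V * Q\<close>.\<close>
  also have "\<dots> \<le> C1 * N * ((s * D * T + s * D) * ((cE * (s * V)) * (cE * (s * Q))) + (cE * (s * V)) * ((s * D) * (s * Q) + D * Q)
    + (cE * (s * Q)) * ((s * D) * (s * V) + D * V) + (s * D) * (V * Q)
    + m1 * ((cE * (s * Q)) * T + s * Q) + m2 * ((cE * (s * V)) * T + s * V))"
  proof -
    have d: "d \<le> s * D" and nv: "nrm1 T v \<le> s * V" and nq: "nrm1 T q \<le> s * Q"
      unfolding d_def s_def D_def V_def Q_def by (intro nrm1_le_nrm2 \<delta>L v q T0)+
    have yy: "y1 \<le> cE * (s * V)" "y2 \<le> cE * (s * Q)"
      unfolding y1_def y2_def using nv nq cE_pos by (auto intro: mult_left_mono)
    have cs: "(LINT t|leb T. norm (\<delta> t) * norm (q t)) \<le> D * Q" "(LINT t|leb T. norm (\<delta> t) * norm (v t)) \<le> D * V"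
      "(LINT t|leb T. norm (v t) * norm (q t)) \<le> V * Q"
      unfolding D_def V_def Q_def by (intro L2_Cauchy_Schwarz \<delta>L v q)+
    have nn: "0 \<le> (LINT t|leb T. norm (\<delta> t) * norm (q t))" "0 \<le> (LINT t|leb T. norm (\<delta> t) * norm (v t))"
      "0 \<le> (LINT t|leb T. norm (v t) * norm (q t))"
      by (auto intro!: integral_nonneg_AE)
    have sp: "0 \<le> s * D" "0 \<le> s * V" "0 \<le> s * Q" "0 \<le> cE * (s * V)" "0 \<le> cE * (s * Q)" "0 \<le> D * Q" "0 \<le> D * V" "0 \<le> V * Q"
      using pos cE_pos by auto
    show ?thesis
      by (rule mult_left_mono[OF _ C1N], intro add_mono mult_mono)
        (use d nv nq yy cs nn pos sp T0 in \<open>auto intro!: add_nonneg_nonneg mult_nonneg_nonneg\<close>)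
  qed
  also have "\<dots> = C1 * N * ((D * V * Q) * (s * ((T + 1) * cE * cE * (s * s) + 2 * cE * (s * s + 1) + 1 + 2 * Cy * (cE * T + 1))))"
    by (simp add: m1_def m2_def algebra_simps)
  also have "\<dots> = N * (D * V * Q) * (s * (C1 * ((T + 1) * cE\<^sup>2 * T + 2 * cE * (T + 1) + 1) + 2 * C1 * Cy * (cE * T + 1)))"
    unfolding pos by (simp add: algebra_simps power2_eq_square)
  finally have int: "\<bar>(LINT t|leb T. I1 t) - (LINT t|leb T. I2 t)\<bar>
    \<le> N * (D * V * Q) * (s * (C1 * ((T + 1) * cE\<^sup>2 * T + 2 * cE * (T + 1) + 1) + 2 * C1 * Cy * (cE * T + 1)))" .
  have g: "\<bar>D2g (X u T) (Y u v T) (Y u q T) - D2g (X w T) (Y w v T) (Y w q T)\<bar>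
    \<le> N * (D * V * Q) * (s * (L * C1 * cE\<^sup>2 * T + 2 * L * Cy * cE))"
  proof -
    note y = Yv[OF T_mem] Yq[OF T_mem]
    have "D2g (X u T) (Y u v T) (Y u q T) - D2g (X w T) (Y w v T) (Y w q T)
      = (D2g (X u T) (Y u v T) (Y u q T) - D2g (X w T) (Y u v T) (Y u q T))
        + D2g (X w T) (Y u v T - Y w v T) (Y u q T) + D2g (X w T) (Y w v T) (Y u q T - Y w q T)"
      by (simp add: linear_diff[OF D2g_linear(1)] linear_diff[OF D2g_linear(2)])
    moreover have "\<bar>D2g (X u T) (Y u v T) (Y u q T) - D2g (X w T) (Y u v T) (Y u q T)\<bar> \<le> L * (cE * d) * y1 * y2"
    proof -
      have "\<bar>D2g (X u T) (Y u v T) (Y u q T) - D2g (X w T) (Y u v T) (Y u q T)\<bar>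
        \<le> L * norm (X u T - X w T) * norm (Y u v T) * norm (Y u q T)" using g_lipschitz by simp
      also have "\<dots> \<le> L * (cE * d) * y1 * y2"
        using X_diff[OF u w T_mem] y L cE_pos pos by (intro mult_mono mult_nonneg_nonneg) (auto simp: d_def \<delta>_def)
      finally show ?thesis .
    qed
    moreover have "\<bar>D2g (X w T) (Y u v T - Y w v T) (Y u q T)\<bar> \<le> L * m1 * y2"
    proof -
      have "\<bar>D2g (X w T) (Y u v T - Y w v T) (Y u q T)\<bar> \<le> L * norm (Y u v T - Y w v T) * norm (Y u q T)"
        using twice_derivD(3)[OF g_deriv] by simp
      also have "\<dots> \<le> L * m1 * y2" by (intro mult_mono mult_nonneg_nonneg y) (use L pos in auto)
      finally show ?thesis .
    qed
    moreover have "\<bar>D2g (X w T) (Y w v T) (Y u q T - Y w q T)\<bar> \<le> L * y1 * m2"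
    proof -
      have "\<bar>D2g (X w T) (Y w v T) (Y u q T - Y w q T)\<bar> \<le> L * norm (Y w v T) * norm (Y u q T - Y w q T)"
        using twice_derivD(3)[OF g_deriv] by simp
      also have "\<dots> \<le> L * y1 * m2" by (intro mult_mono mult_nonneg_nonneg y) (use L pos in auto)
      finally show ?thesis .
    qed
    ultimately have "\<bar>D2g (X u T) (Y u v T) (Y u q T) - D2g (X w T) (Y w v T) (Y w q T)\<bar>
      \<le> L * (cE * d) * y1 * y2 + L * m1 * y2 + L * y1 * m2" by linarith
    also have "\<dots> \<le> L * (C1 * (s * D)) * (cE * (s * V)) * (cE * (s * Q)) + L * m1 * (cE * (s * Q)) + L * (cE * (s * V)) * m2"
    proof -
      have "d \<le> s * D" "nrm1 T v \<le> s * V" "nrm1 T q \<le> s * Q"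
        unfolding d_def s_def D_def V_def Q_def by (intro nrm1_le_nrm2 \<delta>L v q T0)+
      moreover have "cE \<le> C1" using Cx_ge(2) C1_ge(1) by linarith
      ultimately show ?thesis
        unfolding y1_def y2_def using L cE_pos C1_pos pos
        by (intro add_mono mult_mono mult_left_mono mult_nonneg_nonneg) auto
    qed
    also have "\<dots> = (D * V * Q) * (s * (L * C1 * cE * cE * (s * s) + 2 * L * Cy * cE))"
      by (simp add: m1_def m2_def algebra_simps)
    \<comment> \<open>The terminal part has no factor \<open>N\<close>; inserting it, as
      \<open>N\<close> is at least 1, gives both parts the same form.\<close>
    also have "\<dots> \<le> N * ((D * V * Q) * (s * (L * C1 * cE * cE * (s * s) + 2 * L * Cy * cE)))"
    proof -
      have "0 \<le> (D * V * Q) * (s * (L * C1 * cE * cE * (s * s) + 2 * L * Cy * cE))"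
        using pos L C1_pos cE_pos Cy_pos T by (intro mult_nonneg_nonneg add_nonneg_nonneg) auto
      from mult_right_mono[OF pos(1) this] show ?thesis by simp
    qed
    finally show ?thesis unfolding pos by (simp add: power2_eq_square mult_ac)
  qed
  have "\<bar>B u v q - B w v q\<bar> \<le> \<bar>(LINT t|leb T. I1 t) - (LINT t|leb T. I2 t)\<bar>
     + \<bar>D2g (X u T) (Y u v T) (Y u q T) - D2g (X w T) (Y w v T) (Y w q T)\<bar>"
    unfolding B_def I1_def[symmetric] I2_def[symmetric] by linarith
  also have "\<dots> \<le> N * (D * V * Q) * (s * (C1 * ((T + 1) * cE\<^sup>2 * T + 2 * cE * (T + 1) + 1) + 2 * C1 * Cy * (cE * T + 1)))
      + N * (D * V * Q) * (s * (L * C1 * cE\<^sup>2 * T + 2 * L * Cy * cE))"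
    by (rule add_mono[OF int g])
  also have "\<dots> = N * (D * V * Q) * (s * (C1 * ((T + 1) * cE\<^sup>2 * T + 2 * cE * (T + 1) + 1) + 2 * C1 * Cy * (cE * T + 1) + L * C1 * cE\<^sup>2 * T + 2 * L * Cy * cE))"
    by (simp only: distrib_left[symmetric] add.assoc)
  also have "\<dots> \<le> N * (D * V * Q) * C4"
    unfolding s_def using pos by (intro mult_left_mono C4_dominates) auto
  finally show ?thesis by (simp add: N_def D_def V_def Q_def \<delta>_def mult_ac)
qed

end

section \<open>Expansion of the cost\<close>

text \<open>Both expansions are tested with a short multiple of the difference \<open>d\<close>.
  With the tolerance \<open>n / 3\<close> for each of them the squared norm of \<open>d\<close>
  would be at most two thirds of itself. Since \<open>cost_gradient\<close> is an arbitrary choice,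
  this is what transfers norms from \<open>G\<close> to it.\<close>

lemma has_L2_gradient_unique:
  assumes G: "has_L2_gradient T \<Phi> u G" and G': "has_L2_gradient T \<Phi> u G'"
  shows "nrm2 T (\<lambda>t. G t - G' t) = 0"
proof (rule ccontr)
  define d where "d = (\<lambda>t. G t - G' t)"
  define n where "n = nrm2 T d"
  assume "nrm2 T (\<lambda>t. G t - G' t) \<noteq> 0"
  then have n: "0 < n" by (simp add: n_def d_def order.strict_iff_order)
  have L: "G \<in> L2 T" "G' \<in> L2 T" using G G' by (auto simp: has_L2_gradient_def)
  then have d: "d \<in> L2 T" unfolding d_def by (rule L2_diff)
  have e: "0 < n / 3" using n by simp
  obtain a where a: "a > 0" "\<And>h. h \<in> L2 T \<Longrightarrow> nrm2 T h \<le> a \<Longrightarrow>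
      \<bar>\<Phi> (\<lambda>t. u t + h t) - \<Phi> u - (LINT t|leb T. G t \<bullet> h t)\<bar> \<le> n / 3 * nrm2 T h"
    using G e unfolding has_L2_gradient_def by blast
  obtain b where b: "b > 0" "\<And>h. h \<in> L2 T \<Longrightarrow> nrm2 T h \<le> b \<Longrightarrow>
      \<bar>\<Phi> (\<lambda>t. u t + h t) - \<Phi> u - (LINT t|leb T. G' t \<bullet> h t)\<bar> \<le> n / 3 * nrm2 T h"
    using G' e unfolding has_L2_gradient_def by blast
  define s where "s = min a b / n"
  have s: "0 < s" using a b n by (simp add: s_def)
  define h where "h = (\<lambda>t. s *\<^sub>R d t)"
  have h: "h \<in> L2 T" and nh: "nrm2 T h = s * n"
    unfolding h_def using L2_scale[OF d, of s] s by (auto simp: n_def)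
  have "nrm2 T h \<le> a" "nrm2 T h \<le> b" unfolding nh using n by (auto simp: s_def)
  from a(2)[OF h this(1)] b(2)[OF h this(2)]
  have "\<bar>(LINT t|leb T. G t \<bullet> h t) - (LINT t|leb T. G' t \<bullet> h t)\<bar> \<le> n / 3 * (s * n) + n / 3 * (s * n)"
    unfolding nh by linarith
  also have "(LINT t|leb T. G t \<bullet> h t) - (LINT t|leb T. G' t \<bullet> h t) = (LINT t|leb T. d t \<bullet> h t)"
    using L2_inner_integrable(1)[OF L(1) h] L2_inner_integrable(1)[OF L(2) h] by (simp add: d_def inner_diff_left)
  also have "\<dots> = s * n\<^sup>2" by (simp add: h_def n_def nrm2_sq_inner)
  finally have "s * n\<^sup>2 \<le> 2 / 3 * (s * n\<^sup>2)" by (simp add: power2_eq_square mult_ac)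
  moreover have "0 < s * n\<^sup>2" using s n by simp
  ultimately show False by linarith
qed

lemma has_real_derivative_of_quadratic_bound:
  fixes F :: "real \<Rightarrow> real"
  assumes "\<And>r. \<bar>r\<bar> \<le> 1 \<Longrightarrow> \<bar>F (x + r) - F x - r * c\<bar> \<le> C * r\<^sup>2"
  shows "(F has_real_derivative c) (at x)"
  unfolding DERIV_def
proof (rule LIM_zero_cancel, rule Lim_null_comparison)
  have "((\<lambda>r. C * \<bar>r\<bar>) \<longlongrightarrow> C * \<bar>0\<bar>) (at 0)" by (intro tendsto_intros)
  then show "((\<lambda>r. C * \<bar>r\<bar>) \<longlongrightarrow> 0) (at 0)" by simp
  show "\<forall>\<^sub>F r in at 0. norm ((F (x + r) - F x) / r - c) \<le> C * \<bar>r\<bar>"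
    unfolding eventually_at
  proof (intro exI[of _ 1] conjI ballI impI)
    fix r :: real assume "r \<noteq> 0 \<and> dist r 0 < 1"
    then have r: "r \<noteq> 0" "\<bar>r\<bar> \<le> 1" by auto
    have "(F (x + r) - F x) / r - c = (F (x + r) - F x - r * c) / r" using r by (simp add: field_simps)
    then have "norm ((F (x + r) - F x) / r - c) = \<bar>F (x + r) - F x - r * c\<bar> / \<bar>r\<bar>" by (simp add: abs_divide)
    also have "\<dots> \<le> (C * r\<^sup>2) / \<bar>r\<bar>" by (rule divide_right_mono[OF assms[OF r(2)]]) simp
    also have "\<dots> = C * \<bar>r\<bar>"
    proof -
      have "r\<^sup>2 = \<bar>r\<bar> * \<bar>r\<bar>" by (simp add: power2_eq_square)
      then show ?thesis using r(1) by (simp only: mult.assoc[symmetric]) simp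
    qed
    finally show "norm ((F (x + r) - F x) / r - c) \<le> C * \<bar>r\<bar>" .
  qed simp
qed

context control
begin

definition J :: "(real \<Rightarrow> 'u) \<Rightarrow> real" where
  "J u = (LINT t|leb T. f t (Z u t)) + g (X u T)"

definition G :: "(real \<Rightarrow> 'u) \<Rightarrow> real \<Rightarrow> 'u" where
  "G u t = Hu t (Z u t) (P u t)"

definition DJ :: "(real \<Rightarrow> 'u) \<Rightarrow> (real \<Rightarrow> 'u) \<Rightarrow> real" where
  "DJ u w = (LINT t|leb T. G u t \<bullet> w t)"

lemma G_L2:
  assumes u: "u \<in> L2 T" shows "G u \<in> L2 T"
proof -
  define c where "c = L * (Kp * (1 + nrm1 T u)) + L * (Cx * (1 + nrm1 T u) + 1)"
  have k: "(\<lambda>t. c + L *\<^sub>R norm (u t)) \<in> L2 T" by (intro L2_add(1) L2_const L2_scale L2_norm u)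
  show ?thesis
  proof (rule L2_bound(1)[OF _ k])
    show "G u \<in> borel_measurable (leb T)"
      unfolding G_def by (intro Hu_comp Z_measurable[OF u] continuous_measurable_leb[OF P_continuous[OF u]])
    fix t assume t: "t \<in> {0..T}"
    have "norm (G u t) \<le> L * norm (P u t) + L * (norm (X u t) + norm (u t) + 1)"
      using Hu_bound[OF t, of "Z u t" "P u t"] by (simp add: G_def Z_def)
    also have "\<dots> \<le> L * (Kp * (1 + nrm1 T u)) + L * (Cx * (1 + nrm1 T u) + norm (u t) + 1)"
      using P_bound[OF u t] X_bound[OF u t] L by (intro add_mono mult_left_mono) auto
    also have "\<dots> = c + L *\<^sub>R norm (u t)" by (simp add: c_def algebra_simps)
    finally show "norm (G u t) \<le> norm (c + L *\<^sub>R norm (u t))" by simp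
  qed
qed

lemma DJ_linear:
  assumes "u \<in> L2 T" "v \<in> L2 T" "w \<in> L2 T"
  shows "DJ u (\<lambda>t. a *\<^sub>R v t + w t) = a * DJ u v + DJ u w"
  using L2_inner_integrable(1)[OF G_L2[OF assms(1)] assms(2)] L2_inner_integrable(1)[OF G_L2[OF assms(1)] assms(3)]
  by (simp add: DJ_def inner_add_right)

lemma DJ_scale: "DJ u (\<lambda>t. a *\<^sub>R v t) = a * DJ u v"
  by (simp add: DJ_def)

lemma DJ_bound: "u \<in> L2 T \<Longrightarrow> w \<in> L2 T \<Longrightarrow> \<bar>DJ u w\<bar> \<le> nrm2 T (G u) * nrm2 T w"
  unfolding DJ_def by (rule L2_inner_integrable(2)[OF G_L2])

lemma zero_L2: "(\<lambda>t. 0) \<in> L2 T" by (rule L2_const)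

lemma B_scale:
  assumes u: "u \<in> L2 T" and v: "v \<in> L2 T" and w: "w \<in> L2 T"
  shows "B u (\<lambda>t. a *\<^sub>R v t) w = a * B u v w"
proof -
  have "B u (\<lambda>t. 0) w = 0" using B_linear[OF u zero_L2 zero_L2 w, of 1] by simp
  then show ?thesis using B_linear[OF u v zero_L2 w, of a] by simp
qed

lemma B_add:
  assumes u: "u \<in> L2 T" and v: "v \<in> L2 T" and w: "w \<in> L2 T" and q: "q \<in> L2 T"
  shows "B u (\<lambda>t. v t + w t) q = B u v q + B u w q"
  using B_linear[OF u v w q, of 1] by simp

text \<open>The constant of the quadratic remainder in \<open>X_first_order\<close>; not to be
  confused with \<open>C_4\<close>.\<close>

definition K4 :: real where "K4 = cE * (cE\<^sup>2 * T\<^sup>2 + 1)"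

lemma K4_nonneg: "0 \<le> K4" using cE_pos by (simp add: K4_def)

section \<open>Expansions of the state and the cost\<close>

lemma X_increment_bound:
  assumes u: "u \<in> L2 T" and h: "h \<in> L2 T" and t: "t \<in> {0..T}"
  shows "norm (X (\<lambda>t. u t + h t) t - X u t) \<le> cE * nrm1 T h"
  using X_diff[OF L2_add(1)[OF u h] u t] by simp

text \<open>The pointwise remainder of \<open>b\<close> is quadratic in the increments, and the time
  integral of the square of \<open>h\<close> is its squared \<open>L2\<close> norm. Hence the state
  is differentiable from \<open>L2\<close> to the supremum norm, although \<open>b\<close> is
  evaluated at unbounded controls.\<close>

lemma X_first_order:
  assumes u: "u \<in> L2 T" and h: "h \<in> L2 T" and t: "t \<in> {0..T}"
  shows "norm (X (\<lambda>t. u t + h t) t - X u t - Y u h t) \<le> K4 * (nrm2 T h)\<^sup>2"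
proof -
  let ?u = "\<lambda>t. u t + h t"
  have u': "?u \<in> L2 T" by (intro L2_add u h)
  define n where "n = nrm1 T h"
  define k where "k = (\<lambda>t. L * ((cE * n)\<^sup>2 + (norm (h t))\<^sup>2))"
  have ih: "integrable (leb T) (\<lambda>t. (norm (h t))\<^sup>2)" using h by (simp add: L2_iff)
  have ik: "integrable (leb T) k" using ih by (simp add: k_def)
  have "norm (X ?u t - X u t - Y u h t) \<le> exp (L * T) * (norm (X ?u 0 - X u 0 - Y u h 0) + (LINT t|leb T. k t))"
  proof (rule gronwall_forward[OF primitive_on_diff[OF primitive_on_diff[OF X_solves(1)[OF u'] X_solves(1)[OF u]] Y_solves(1)[OF u h]] T0 L0 ik _ _ t])
    fix t assume t: "t \<in> {0..T}"
    let ?d = "X ?u t - X u t - Y u h t"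
    define dz where "dz = Z ?u t - Z u t"
    have dz: "dz = (?d, 0) + (Y u h t, h t)" by (simp add: dz_def Z_def)
    have "Db t (Z u t) dz = Db t (Z u t) (?d, 0) + Db t (Z u t) (Y u h t, h t)"
      unfolding dz by (rule linear_add[OF Db_linear[OF t]])
    then have "b t (Z ?u t) - b t (Z u t) - Db t (Z u t) (Y u h t, h t)
       = (b t (Z u t + dz) - b t (Z u t) - Db t (Z u t) dz) + Db t (Z u t) (?d, 0)"
      by (simp add: dz_def)
    also have "norm \<dots> \<le> L * (norm dz)\<^sup>2 + L * norm ?d"
      using norm_triangle_le[OF add_mono[OF twice_deriv_first_order_remainder[OF b_deriv[OF t] L0, of "Z u t" dz]
          Db_bound[OF t, of "Z u t" "(?d, 0)"]]] by simp
    also have "(norm dz)\<^sup>2 \<le> (cE * n)\<^sup>2 + (norm (h t))\<^sup>2"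
    proof -
      have "(norm dz)\<^sup>2 = (norm (X ?u t - X u t))\<^sup>2 + (norm (h t))\<^sup>2" by (simp add: dz_def Z_def norm_Pair)
      also have "\<dots> \<le> (cE * n)\<^sup>2 + (norm (h t))\<^sup>2"
        using X_increment_bound[OF u h t] by (intro add_right_mono power_mono) (auto simp: n_def)
      finally show ?thesis .
    qed
    finally show "norm (b t (Z ?u t) - b t (Z u t) - Db t (Z u t) (Y u h t, h t)) \<le> L * norm ?d + k t"
      using L by (simp add: k_def mult_left_mono)
    show "0 \<le> k t" using L by (simp add: k_def)
  qed
  also have "norm (X ?u 0 - X u 0 - Y u h 0) = 0" by (simp add: X_solves(2) Y_solves(2) u u' h)
  also have "(LINT t|leb T. k t) = L * (T * (cE * n)\<^sup>2 + (nrm2 T h)\<^sup>2)"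
    unfolding k_def nrm2_square using ih T0 by (simp add: measure_leb)
  also have "exp (L * T) * (0 + L * (T * (cE * n)\<^sup>2 + (nrm2 T h)\<^sup>2)) = cE * (cE\<^sup>2 * T * (n * n) + (nrm2 T h)\<^sup>2)"
    by (simp add: cE_def power2_eq_square algebra_simps)
  also have "\<dots> \<le> cE * (cE\<^sup>2 * T * (T * (nrm2 T h * nrm2 T h)) + (nrm2 T h)\<^sup>2)"
    using cE_pos T nrm1_mult_le[OF h h T0] by (intro mult_left_mono add_right_mono) (auto simp: n_def)
  also have "\<dots> = K4 * (nrm2 T h)\<^sup>2" by (simp add: K4_def power2_eq_square algebra_simps)
  finally show ?thesis .
qed

lemma f_integrable:
  assumes u: "u \<in> L2 T" shows "integrable (leb T) (\<lambda>t. f t (Z u t))"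
proof (rule integrable_leb_bound(1))
  have "(X u) \<in> L2 T"
  proof (rule L2_bound(1)[OF _ L2_const[of "Cx * (1 + nrm1 T u)"]])
    show "X u \<in> borel_measurable (leb T)" by (rule continuous_measurable_leb[OF X_continuous[OF u]])
    show "norm (X u t) \<le> norm (Cx * (1 + nrm1 T u))" if "t \<in> {0..T}" for t
      using X_bound[OF u that] by simp
  qed
  then show "integrable (leb T) (\<lambda>t. L * ((norm (X u t))\<^sup>2 + (norm (u t))\<^sup>2 + 1))"
    using u by (simp add: L2_iff)
  show "(\<lambda>t. f t (Z u t)) \<in> borel_measurable (leb T)" by (intro f_comp Z_measurable[OF u])
  show "norm (f t (Z u t)) \<le> L * ((norm (X u t))\<^sup>2 + (norm (u t))\<^sup>2 + 1)" if "t \<in> {0..T}" for t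
    using f_growth[OF that, of "Z u t"] by (simp add: Z_def)
qed

text \<open>The first summand stems from the integral part of the cost, the other two from the
  terminal part: the Taylor remainder of \<open>g\<close>, and the exchange of the true terminal
  increment for the linearized one.\<close>

definition K6 :: real where
  "K6 = L * (1 + Kp) * (7 * cE * sqrt T * (cE\<^sup>2 * T\<^sup>2 + 1) + K4 * (cE * sqrt T * T + sqrt T))
     + L * cE ^ 3 * sqrt T * T + L * K4 * cE * sqrt T"

lemma K6_nonneg: "0 \<le> K6"
  unfolding K6_def using L Kp_pos cE_pos T K4_nonneg by (intro add_nonneg_nonneg mult_nonneg_nonneg) auto

text \<open>Testing the adjoint equation with the increment of the state removes the first order term of
  the state from the increment of the cost.\<close>

lemma J_expansion:
  assumes u: "u \<in> L2 T" and h: "h \<in> L2 T"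
  shows "\<bar>J (\<lambda>t. u t + h t) - J u - DJ u h - B u h h / 2\<bar> \<le> K6 * (1 + nrm1 T u) * (nrm2 T h) ^ 3"
proof -
  let ?u = "\<lambda>t. u t + h t"
  define N where "N = 1 + nrm1 T u"
  define H where "H = nrm2 T h"
  define s where "s = sqrt T"
  define m where "m = cE * (s * H)"
  define dx where "dx = (\<lambda>t. X ?u t - X u t)"
  define dz where "dz = (\<lambda>t. Z ?u t - Z u t)"
  define e where "e = (\<lambda>t. dx t - Y u h t)"
  have u': "?u \<in> L2 T" by (intro L2_add u h)
  have pos: "1 \<le> N" "0 \<le> H" "0 \<le> s" "s * s = T" "0 \<le> m"
    using T cE_pos by (auto simp: N_def H_def s_def m_def)
  have n1: "nrm1 T h \<le> s * H" unfolding s_def H_def by (rule nrm1_le_nrm2[OF h T0])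
  have nm: "cE * nrm1 T h \<le> m" unfolding m_def using n1 cE_pos by (intro mult_left_mono) auto
  have dxm: "norm (dx t) \<le> m" and Ym: "norm (Y u h t) \<le> m" and em: "norm (e t) \<le> K4 * H\<^sup>2" if "t \<in> {0..T}" for t
    using X_increment_bound[OF u h that] Y_bound[OF u h that] X_first_order[OF u h that] nm
    by (auto simp: dx_def e_def H_def)
  have dz_eq: "dz t = (dx t, h t)" for t by (simp add: dz_def dx_def Z_def)
  have dz_W: "dz t = W u h t + (e t, 0)" for t by (simp add: dz_eq W_def e_def)
  have Pq: "1 + norm (P u t) \<le> (1 + Kp) * N" if "t \<in> {0..T}" for t
  proof -
    have "norm (P u t) \<le> Kp * N" using P_bound[OF u that] by (simp add: N_def)
    then show ?thesis using pos(1) by (simp add: distrib_right)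
  qed
  define \<psi> where "\<psi> = (\<lambda>t. b t (Z ?u t) - b t (Z u t))"
  have pdx: "primitive_on T \<psi> dx"
    unfolding \<psi>_def dx_def by (intro primitive_on_diff X_solves(1) u u')
  note parts = primitive_on_by_parts[OF P_solves(1)[OF u] pdx T]
  have dx0: "dx 0 = 0" by (simp add: dx_def X_solves(2) u u')
  \<comment> \<open>The boundary term at 0 vanishes because both states start at \<open>x0\<close>;
    the one at \<open>T\<close> is the derivative of \<open>g\<close> by the terminal condition of
    the adjoint.\<close>
  have P\<psi>: "(LINT t|leb T. P u t \<bullet> \<psi> t) = Dg (X u T) (dx T) + (LINT t|leb T. Hx t (Z u t) (P u t) \<bullet> dx t)"
    using parts(3) by (simp add: dx0 P_solves(2)[OF u] riesz_Dg_inner)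
  have iHx: "integrable (leb T) (\<lambda>t. Hx t (Z u t) (P u t) \<bullet> dx t)" using parts(1) by simp
  note if' = f_integrable[OF u] f_integrable[OF u']
  note iG = L2_inner_integrable(1)[OF G_L2[OF u] h]
  note iW = D2H_integrable(1)[OF u W_L2(1)[OF u h] W_L2(1)[OF u h]]
  define R where "R = (\<lambda>t. (f t (Z ?u t) - f t (Z u t)) + P u t \<bullet> \<psi> t - Hx t (Z u t) (P u t) \<bullet> dx t - G u t \<bullet> h t
     - D2H t (Z u t) (P u t) (W u h t) (W u h t) / 2)"
  have iR: "integrable (leb T) R" unfolding R_def using if' iHx iG iW parts(2) by simp
  have intR: "(LINT t|leb T. R t) = (LINT t|leb T. f t (Z ?u t)) - (LINT t|leb T. f t (Z u t)) + Dg (X u T) (dx T)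
      - DJ u h - (LINT t|leb T. D2H t (Z u t) (P u t) (W u h t) (W u h t)) / 2"
    unfolding R_def DJ_def using if' iHx iG iW parts(2) P\<psi> by simp
  define k where "k = (\<lambda>t. L * ((1 + Kp) * N) * (7 * m * (m\<^sup>2 + (norm (h t))\<^sup>2) + K4 * H\<^sup>2 * (m + norm (h t))))"
  have ih: "integrable (leb T) (\<lambda>t. (norm (h t))\<^sup>2)" "integrable (leb T) (\<lambda>t. norm (h t))"
    using h L2_norm_integrable[OF h] by (auto simp: L2_iff)
  have ik: "integrable (leb T) k" using ih by (simp add: k_def)
  have Rk: "norm (R t) \<le> k t" if t: "t \<in> {0..T}" for t
  proof -
    let ?D = "D2H t (Z u t) (P u t)"
    define rb where "rb = b t (Z u t + dz t) - b t (Z u t) - Db t (Z u t) (dz t) - (1/2) *\<^sub>R D2b t (Z u t) (dz t) (dz t)"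
    define rf where "rf = f t (Z u t + dz t) - f t (Z u t) - Df t (Z u t) (dz t) - (1/2) *\<^sub>R D2f t (Z u t) (dz t) (dz t)"
    define S where "S = ?D (dz t) (dz t) - ?D (W u h t) (W u h t)"
    have "DH t (Z u t) (P u t) (dz t) = DH t (Z u t) (P u t) ((dx t, 0) + (0, h t))" by (simp add: dz_eq)
    also have "\<dots> = Hx t (Z u t) (P u t) \<bullet> dx t + G u t \<bullet> h t"
      unfolding G_def Hx_inner[OF t] Hu_inner[OF t] by (rule linear_add[OF DH_linear[OF t]])
    finally have DHe: "DH t (Z u t) (P u t) (dz t) = Hx t (Z u t) (P u t) \<bullet> dx t + G u t \<bullet> h t" .
    have Zu: "Z u t + dz t = Z ?u t" by (simp add: dz_def)
    \<comment> \<open>Two sources of error: the Taylor remainders of \<open>b\<close> and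
      \<open>f\<close>, and the exchange of the true increment \<open>dz\<close> for its
      linearization \<open>W u h\<close> in the quadratic form.\<close>
    have Re: "R t = rb \<bullet> P u t + rf + S / 2"
      using DHe unfolding R_def rb_def rf_def S_def Zu \<psi>_def
      by (simp add: DH_def D2H_def inner_diff_left inner_diff_right inner_commute[of "P u t"]
          diff_divide_distrib add_divide_distrib)
    define q where "q = L * (1 + norm (P u t))"
    have q: "0 \<le> q" "q \<le> L * ((1 + Kp) * N)" unfolding q_def using L Pq[OF t] by (auto intro: mult_left_mono)
    have rb: "norm rb \<le> 7 * L * norm (dx t) * (norm (dz t))\<^sup>2"
      unfolding rb_def using twice_deriv_block_remainder[OF b_deriv[OF t] b_block[OF t] L0, of "Z u t" "dz t"] by (simp add: dz_eq)
    have rf: "\<bar>rf\<bar> \<le> 7 * L * norm (dx t) * (norm (dz t))\<^sup>2"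
      unfolding rf_def using twice_deriv_block_remainder[OF f_deriv[OF t] f_block[OF t] L0, of "Z u t" "dz t"] by (simp add: dz_eq)
    have r: "\<bar>rb \<bullet> P u t + rf\<bar> \<le> q * (7 * norm (dx t) * (norm (dz t))\<^sup>2)"
      using inner_le[OF rb, of "P u t"] rf by (simp add: q_def algebra_simps)
    have S: "\<bar>S\<bar> \<le> q * norm (e t) * (norm (dz t) + norm (W u h t))"
      using square_difference_bound[of ?D q "dz t" "W u h t" "(e t, 0)", OF D2_linear[OF t] _ dz_W] D2H_bound[OF t]
      by (simp add: S_def q_def norm_Pair)
    have dz2: "(norm (dz t))\<^sup>2 \<le> m\<^sup>2 + (norm (h t))\<^sup>2"
      using dxm[OF t] power_mono[OF dxm[OF t], of 2] by (simp add: dz_eq norm_Pair)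
    have dzn: "norm (dz t) + norm (W u h t) \<le> 2 * (m + norm (h t))"
      using norm_Pair_le[of "dx t" "h t"] norm_Pair_le[of "Y u h t" "h t"] dxm[OF t] Ym[OF t] by (simp add: dz_eq W_def)
    have "norm (R t) \<le> q * (7 * norm (dx t) * (norm (dz t))\<^sup>2) + q * norm (e t) * (norm (dz t) + norm (W u h t)) / 2"
      unfolding Re using r S by (simp add: abs_le_iff)
    also have "\<dots> \<le> q * (7 * m * (m\<^sup>2 + (norm (h t))\<^sup>2)) + q * (K4 * H\<^sup>2) * (2 * (m + norm (h t))) / 2"
      using q(1) dz2 dzn dxm[OF t] em[OF t] pos K4_nonneg
      by (intro add_mono divide_right_mono mult_mono mult_left_mono mult_nonneg_nonneg) auto
    also have "\<dots> = q * (7 * m * (m\<^sup>2 + (norm (h t))\<^sup>2) + K4 * H\<^sup>2 * (m + norm (h t)))" by (simp add: algebra_simps)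
    also have "\<dots> \<le> k t"
      unfolding k_def using q pos K4_nonneg by (intro mult_right_mono) auto
    finally show ?thesis .
  qed
  have "\<bar>LINT t|leb T. R t\<bar> \<le> (LINT t|leb T. k t)"
    using Bochner_Integration.integral_norm_bound_integral[OF iR ik] Rk by simp
  also have "\<dots> = L * ((1 + Kp) * N) * (7 * m * (T * m\<^sup>2 + H\<^sup>2) + K4 * H\<^sup>2 * (T * m + nrm1 T h))"
    unfolding k_def H_def nrm2_square nrm1_eq using ih T0 by (simp add: measure_leb)
  also have "\<dots> \<le> L * ((1 + Kp) * N) * (7 * m * (T * m\<^sup>2 + H\<^sup>2) + K4 * H\<^sup>2 * (T * m + s * H))"
    using n1 L Kp_pos pos K4_nonneg by (intro mult_left_mono add_left_mono) auto
  also have "\<dots> = N * H ^ 3 * (L * (1 + Kp) * (7 * cE * s * (cE\<^sup>2 * (T * (s * s)) + 1) + K4 * (cE * s * T + s)))"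
    unfolding m_def by (simp add: algebra_simps power2_eq_square power3_eq_cube)
  finally have 1: "\<bar>LINT t|leb T. R t\<bar> \<le> N * H ^ 3 * (L * (1 + Kp) * (7 * cE * s * (cE\<^sup>2 * (T * (s * s)) + 1) + K4 * (cE * s * T + s)))" .
  let ?g = "D2g (X u T)"
  have g1: "\<bar>g (X u T + dx T) - g (X u T) - Dg (X u T) (dx T) - ?g (dx T) (dx T) / 2\<bar> \<le> L * m ^ 3"
  proof -
    have "norm (g (X u T + dx T) - g (X u T) - Dg (X u T) (dx T) - (1/2) *\<^sub>R ?g (dx T) (dx T)) \<le> L * m * m * m"
    proof (rule twice_deriv_second_order_remainder[OF g_deriv])
      fix r :: real assume r: "r \<in> {0..1}"
      have "norm (r *\<^sub>R dx T) \<le> m"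
        using r dxm[OF T_mem] mult_left_le_one_le[of "norm (dx T)" r] by simp
      then have "L * norm (X u T + r *\<^sub>R dx T - X u T) * norm (dx T) * norm (dx T) \<le> L * m * m * m"
        using dxm[OF T_mem] L pos by (intro mult_mono mult_nonneg_nonneg) auto
      with g_lipschitz show "norm (D2g (X u T + r *\<^sub>R dx T) (dx T) (dx T) - ?g (dx T) (dx T)) \<le> L * m * m * m"
        by (rule order_trans)
    qed
    then show ?thesis by (simp add: power3_eq_cube mult.assoc)
  qed
  have g2: "\<bar>?g (dx T) (dx T) - ?g (Y u h T) (Y u h T)\<bar> \<le> L * (K4 * H\<^sup>2) * (m + m)"
  proof -
    have "\<bar>?g (dx T) (dx T) - ?g (Y u h T) (Y u h T)\<bar> \<le> L * norm (e T) * (norm (dx T) + norm (Y u h T))"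
      by (rule square_difference_bound[OF D2g_linear]) (use twice_derivD(3)[OF g_deriv] in \<open>auto simp: e_def\<close>)
    also have "\<dots> \<le> L * (K4 * H\<^sup>2) * (m + m)"
      using em[OF T_mem] dxm[OF T_mem] Ym[OF T_mem] L K4_nonneg by (intro mult_mono add_mono mult_nonneg_nonneg mult_left_mono) auto
    finally show ?thesis .
  qed
  have XT: "X ?u T = X u T + dx T" by (simp add: dx_def)
  have JR: "J ?u - J u - DJ u h - B u h h / 2 = (LINT t|leb T. R t)
     + (g (X u T + dx T) - g (X u T) - Dg (X u T) (dx T) - ?g (dx T) (dx T) / 2)
     + (?g (dx T) (dx T) - ?g (Y u h T) (Y u h T)) / 2"
    unfolding intR by (simp add: J_def B_def XT diff_divide_distrib add_divide_distrib)
  have "\<bar>J ?u - J u - DJ u h - B u h h / 2\<bar> \<le> \<bar>LINT t|leb T. R t\<bar> + L * m ^ 3 + L * (K4 * H\<^sup>2) * (m + m) / 2"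
  proof -
    have "\<bar>y\<bar> \<le> \<bar>p\<bar> + q + r / 2" if "y = p + q' + r' / 2" "\<bar>q'\<bar> \<le> q" "\<bar>r'\<bar> \<le> r" for y p q q' r r' :: real
      using that by linarith
    from this[OF JR g1 g2] show ?thesis .
  qed
  also have "\<dots> \<le> N * H ^ 3 * (L * (1 + Kp) * (7 * cE * s * (cE\<^sup>2 * (T * (s * s)) + 1) + K4 * (cE * s * T + s)))
     + N * (L * m ^ 3 + L * (K4 * H\<^sup>2) * (m + m) / 2)"
  proof -
    have "0 \<le> L * m ^ 3 + L * (K4 * H\<^sup>2) * (m + m) / 2" using L pos K4_nonneg by auto
    from add_mono[OF 1 mult_right_mono[OF pos(1) this]] show ?thesis by (simp only: mult_1 add.assoc)
  qed
  also have "\<dots> = N * H ^ 3 * (L * (1 + Kp) * (7 * cE * s * (cE\<^sup>2 * (T * (s * s)) + 1) + K4 * (cE * s * T + s))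
     + L * cE ^ 3 * s * (s * s) + L * K4 * cE * s)"
    unfolding m_def by (simp add: algebra_simps power2_eq_square power3_eq_cube)
  also have "\<dots> = K6 * N * H ^ 3"
    unfolding K6_def s_def[symmetric] pos(4) by (simp add: power2_eq_square mult_ac)
  finally show ?thesis by (simp add: N_def H_def)
qed

lemma J_has_gradient:
  assumes u: "u \<in> L2 T" shows "has_L2_gradient T J u (G u)"
  unfolding has_L2_gradient_def
proof (intro conjI allI impI)
  show "G u \<in> L2 T" by (rule G_L2[OF u])
  fix \<epsilon> :: real assume \<epsilon>: "0 < \<epsilon>"
  obtain K where K: "0 \<le> K" "\<And>v w. v \<in> L2 T \<Longrightarrow> w \<in> L2 T \<Longrightarrow> \<bar>B u v w\<bar> \<le> K * nrm2 T v * nrm2 T w"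
    using B_bounded[OF u] by blast
  define M where "M = K + K6 * (1 + nrm1 T u)"
  have M: "0 \<le> M" unfolding M_def using K(1) K6_nonneg by (intro add_nonneg_nonneg mult_nonneg_nonneg) auto
  \<comment> \<open>The bound 1 reduces the cubic term to a quadratic one, the other makes
    \<open>M * H\<close> at most \<open>\<epsilon>\<close>; adding 1 to \<open>M\<close> avoids a
    zero denominator.\<close>
  define \<delta> where "\<delta> = min 1 (\<epsilon> / (M + 1))"
  show "\<exists>\<delta>>0. \<forall>h\<in>L2 T. nrm2 T h \<le> \<delta> \<longrightarrow>
      \<bar>J (\<lambda>t. u t + h t) - J u - (LINT t|leb T. G u t \<bullet> h t)\<bar> \<le> \<epsilon> * nrm2 T h"
  proof (intro exI[of _ \<delta>] conjI ballI impI)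
    show "0 < \<delta>" using \<epsilon> M by (simp add: \<delta>_def)
    fix h :: "real \<Rightarrow> 'u" assume h: "h \<in> L2 T" and le: "nrm2 T h \<le> \<delta>"
    define H where "H = nrm2 T h"
    have H: "0 \<le> H" "H \<le> 1" "H \<le> \<epsilon> / (M + 1)" using le by (auto simp: H_def \<delta>_def)
    have "H ^ 3 \<le> H ^ 2" using H by (intro power_decreasing) auto
    then have "K6 * (1 + nrm1 T u) * H ^ 3 \<le> K6 * (1 + nrm1 T u) * H ^ 2"
      using K6_nonneg by (intro mult_left_mono mult_nonneg_nonneg) auto
    moreover have "\<bar>B u h h / 2\<bar> \<le> K * H ^ 2"
      using K(2)[OF h h] by (simp add: H_def power2_eq_square mult.assoc)
    ultimately have "\<bar>J (\<lambda>t. u t + h t) - J u - DJ u h\<bar> \<le> K6 * (1 + nrm1 T u) * H ^ 2 + K * H ^ 2"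
      using J_expansion[OF u h] unfolding H_def[symmetric] by linarith
    also have "\<dots> = (M * H) * H" by (simp add: M_def power2_eq_square algebra_simps)
    also have "\<dots> \<le> \<epsilon> * H"
    proof (rule mult_right_mono[OF _ H(1)])
      have "M * H \<le> M * (\<epsilon> / (M + 1))" using M H by (intro mult_left_mono)
      also have "\<dots> \<le> \<epsilon>" using M \<epsilon> by (simp add: field_simps)
      finally show "M * H \<le> \<epsilon>" .
    qed
    finally show "\<bar>J (\<lambda>t. u t + h t) - J u - (LINT t|leb T. G u t \<bullet> h t)\<bar> \<le> \<epsilon> * nrm2 T h"
      by (simp add: DJ_def H_def)
  qed
qed

text \<open>The second derivative of the cost is obtained by comparing the expansions of the cost at
  \<open>u\<close> and at \<open>u + r e\<close> in the point \<open>u + r e + r w\<close>.\<close>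

lemma DJ_expansion:
  assumes u: "u \<in> L2 T" and e: "e \<in> L2 T" and w: "w \<in> L2 T"
  shows "\<exists>C. \<forall>r. \<bar>r\<bar> \<le> 1 \<longrightarrow> \<bar>DJ (\<lambda>t. u t + r *\<^sub>R e t) w - DJ u w - r * B u e w\<bar> \<le> C * r\<^sup>2"
proof -
  define ew where "ew = (\<lambda>t. e t + w t)"
  have ew: "ew \<in> L2 T" unfolding ew_def by (intro L2_add e w)
  define M where "M = 1 + nrm1 T u + nrm1 T e"
  define C where "C = K6 * M * nrm2 T w ^ 3 + K6 * M * nrm2 T ew ^ 3 + K6 * M * nrm2 T e ^ 3 + C4 * M * nrm2 T e * nrm2 T w * nrm2 T w"
  have "\<bar>DJ (\<lambda>t. u t + r *\<^sub>R e t) w - DJ u w - r * B u e w\<bar> \<le> C * r\<^sup>2" if r: "\<bar>r\<bar> \<le> 1" for r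
  proof (cases "r = 0")
    case True then show ?thesis by simp
  next
    case False
    let ?u = "\<lambda>t. u t + r *\<^sub>R e t"
    have re: "(\<lambda>t. r *\<^sub>R e t) \<in> L2 T" "nrm2 T (\<lambda>t. r *\<^sub>R e t) = \<bar>r\<bar> * nrm2 T e" using L2_scale[OF e] by auto
    have rw: "(\<lambda>t. r *\<^sub>R w t) \<in> L2 T" "nrm2 T (\<lambda>t. r *\<^sub>R w t) = \<bar>r\<bar> * nrm2 T w" using L2_scale[OF w] by auto
    have rew: "(\<lambda>t. r *\<^sub>R ew t) \<in> L2 T" "nrm2 T (\<lambda>t. r *\<^sub>R ew t) = \<bar>r\<bar> * nrm2 T ew" using L2_scale[OF ew] by auto
    have u': "?u \<in> L2 T" by (intro L2_add u re)
    have "\<bar>r\<bar> * nrm1 T e \<le> nrm1 T e" using r by (intro mult_left_le_one_le) auto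
    then have M: "1 + nrm1 T ?u \<le> M" "1 + nrm1 T u \<le> M"
      using nrm1_triangle[OF u re(1)] by (auto simp: M_def nrm1_scale)
    \<comment> \<open>One factor \<open>\<bar>r\<bar>\<close> is split off each cubic error, because
      the identity \<open>key\<close> is divided by \<open>r\<close> in the end.\<close>
    have kb: "K6 * (1 + nrm1 T v) * (\<bar>r\<bar> * x) ^ 3 \<le> \<bar>r\<bar> * (K6 * M * x ^ 3 * r\<^sup>2)" if "1 + nrm1 T v \<le> M" "0 \<le> x" for v x
    proof -
      have "K6 * (1 + nrm1 T v) * (\<bar>r\<bar> * x) ^ 3 \<le> K6 * M * (\<bar>r\<bar> * x) ^ 3"
        using that K6_nonneg by (intro mult_right_mono mult_left_mono) auto
      also have "\<dots> = \<bar>r\<bar> * (K6 * M * x ^ 3 * r\<^sup>2)"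
        by (simp add: power3_eq_cube power2_eq_square mult_ac abs_mult_self_eq)
      finally show ?thesis .
    qed
    have Bq: "B v (\<lambda>t. r *\<^sub>R q t) (\<lambda>t. r *\<^sub>R q t) = r\<^sup>2 * B v q q" if "v \<in> L2 T" "q \<in> L2 T" for v q
      using that B_symmetric[of v q "\<lambda>t. r *\<^sub>R q t"] by (simp add: B_scale L2_scale(1) power2_eq_square)
    define E1 where "E1 = J (\<lambda>t. ?u t + r *\<^sub>R w t) - J ?u - r * DJ ?u w - r\<^sup>2 * B ?u w w / 2"
    define E2 where "E2 = J (\<lambda>t. u t + r *\<^sub>R ew t) - J u - r * DJ u ew - r\<^sup>2 * B u ew ew / 2"
    define E3 where "E3 = J ?u - J u - r * DJ u e - r\<^sup>2 * B u e e / 2"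
    have E1: "\<bar>E1\<bar> \<le> \<bar>r\<bar> * (K6 * M * nrm2 T w ^ 3 * r\<^sup>2)"
      using order_trans[OF J_expansion[OF u' rw(1)] kb[OF M(1), of "nrm2 T w", folded rw(2)]]
      by (simp add: E1_def DJ_scale Bq u' w)
    have E2: "\<bar>E2\<bar> \<le> \<bar>r\<bar> * (K6 * M * nrm2 T ew ^ 3 * r\<^sup>2)"
      using order_trans[OF J_expansion[OF u rew(1)] kb[OF M(2), of "nrm2 T ew", folded rew(2)]]
      by (simp add: E2_def DJ_scale Bq u ew)
    have E3: "\<bar>E3\<bar> \<le> \<bar>r\<bar> * (K6 * M * nrm2 T e ^ 3 * r\<^sup>2)"
      using order_trans[OF J_expansion[OF u re(1)] kb[OF M(2), of "nrm2 T e", folded re(2)]]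
      by (simp add: E3_def DJ_scale Bq u e)
    have same: "(\<lambda>t. ?u t + r *\<^sub>R w t) = (\<lambda>t. u t + r *\<^sub>R ew t)" by (simp add: ew_def scaleR_add_right add.assoc)
    have Dew: "DJ u ew = DJ u e + DJ u w" using DJ_linear[OF u e w, of 1] by (simp add: ew_def)
    have "B u ew ew = B u e ew + B u w ew" unfolding ew_def using ew[unfolded ew_def] by (intro B_add u e w)
    also have "\<dots> = B u ew e + B u ew w" by (simp add: B_symmetric[of u e] B_symmetric[of u w])
    also have "\<dots> = B u e e + B u w e + (B u e w + B u w w)" unfolding ew_def by (simp add: B_add u e w)
    finally have Bew: "B u ew ew = B u e e + 2 * B u e w + B u w w" by (simp add: B_symmetric[of u w e])
    define d where "d = DJ ?u w - DJ u w - r * B u e w"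
    \<comment> \<open>Bilinearity leaves the mixed term \<open>B u e w\<close> together with the
      change of the form from \<open>u\<close> to the shifted control; by \<open>B_lipschitz\<close>
      the latter also contributes only to third order in \<open>r\<close>.\<close>
    have key: "r * d = E2 - E1 - E3 - r\<^sup>2 * (B ?u w w - B u w w) / 2"
      unfolding E1_def E2_def E3_def same Dew Bew d_def by (simp add: field_simps power2_eq_square)
    have "\<bar>B ?u w w - B u w w\<bar> \<le> C4 * (1 + nrm1 T u) * nrm2 T (\<lambda>t. ?u t - u t) * nrm2 T w * nrm2 T w"
      by (rule B_lipschitz[OF u' u w w])
    also have "nrm2 T (\<lambda>t. ?u t - u t) = \<bar>r\<bar> * nrm2 T e" by (simp add: re)
    also have "C4 * (1 + nrm1 T u) * (\<bar>r\<bar> * nrm2 T e) * nrm2 T w * nrm2 T w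
        \<le> C4 * M * (\<bar>r\<bar> * nrm2 T e) * nrm2 T w * nrm2 T w"
      using C4_pos by (intro mult_right_mono mult_left_mono M) auto
    finally have B4: "r\<^sup>2 * \<bar>B ?u w w - B u w w\<bar> \<le> r\<^sup>2 * (C4 * M * (\<bar>r\<bar> * nrm2 T e) * nrm2 T w * nrm2 T w)"
      by (intro mult_left_mono) auto
    have "\<bar>r\<bar> * \<bar>d\<bar> = \<bar>E2 - E1 - E3 - r\<^sup>2 * (B ?u w w - B u w w) / 2\<bar>" unfolding key[symmetric] by (simp add: abs_mult)
    also have "\<dots> \<le> \<bar>E2\<bar> + \<bar>E1\<bar> + \<bar>E3\<bar> + \<bar>r\<^sup>2 * (B ?u w w - B u w w)\<bar>" by linarith
    also have "\<bar>r\<^sup>2 * (B ?u w w - B u w w)\<bar> = r\<^sup>2 * \<bar>B ?u w w - B u w w\<bar>" by (simp add: abs_mult)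
    also have "\<bar>E2\<bar> + \<bar>E1\<bar> + \<bar>E3\<bar> + r\<^sup>2 * \<bar>B ?u w w - B u w w\<bar> \<le> \<bar>r\<bar> * (C * r\<^sup>2)"
      using E1 E2 E3 B4 by (simp add: C_def algebra_simps)
    finally have "\<bar>d\<bar> \<le> C * r\<^sup>2" using False by simp
    then show ?thesis by (simp add: d_def)
  qed
  then show ?thesis by blast
qed

lemma DJ_line_derivative:
  assumes u: "u \<in> L2 T" and e: "e \<in> L2 T" and w: "w \<in> L2 T"
  shows "((\<lambda>s. DJ (\<lambda>t. u t + s *\<^sub>R e t) w) has_real_derivative B (\<lambda>t. u t + s *\<^sub>R e t) e w) (at s)"
proof -
  have us: "(\<lambda>t. u t + s *\<^sub>R e t) \<in> L2 T" by (intro L2_add L2_scale u e)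
  obtain C where C: "\<And>r. \<bar>r\<bar> \<le> 1 \<Longrightarrow> \<bar>DJ (\<lambda>t. (u t + s *\<^sub>R e t) + r *\<^sub>R e t) w - DJ (\<lambda>t. u t + s *\<^sub>R e t) w
      - r * B (\<lambda>t. u t + s *\<^sub>R e t) e w\<bar> \<le> C * r\<^sup>2"
    using DJ_expansion[OF us e w] by blast
  show ?thesis
    by (rule has_real_derivative_of_quadratic_bound[where C=C]) (use C in \<open>simp add: scaleR_add_left add.assoc\<close>)
qed

text \<open>The linearization is taken at \<open>u\<close>, since Newton's equation contains
  \<open>B u\<close>. At the point \<open>ub + s e\<close> of the segment the distance to
  \<open>u\<close> is \<open>(1 - s)\<close> times the norm of \<open>e\<close>, while the
  \<open>L1\<close> norm exceeds that of \<open>ub\<close> by at most \<open>s * sqrt T\<close>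
  times it. The product \<open>s * (1 - s)\<close> is at most 1/4, the origin of this
  constant.\<close>

lemma DJ_linearization_error:
  assumes u: "u \<in> L2 T" and ub: "ub \<in> L2 T" and w: "w \<in> L2 T"
  defines "e \<equiv> \<lambda>t. u t - ub t"
  shows "\<bar>DJ u w - DJ ub w - B u e w\<bar>
    \<le> (C4 * (1 + nrm1 T ub) + C4 * sqrt T * nrm2 T e / 4) * (nrm2 T e)\<^sup>2 * nrm2 T w"
proof -
  have e: "e \<in> L2 T" unfolding e_def by (intro L2_diff u ub)
  define n where "n = nrm2 T e"
  let ?v = "\<lambda>s t. ub t + s *\<^sub>R e t"
  let ?\<phi> = "\<lambda>s. DJ (?v s) w - s * B u e w"
  define K where "K = (C4 * (1 + nrm1 T ub) + C4 * sqrt T * n / 4) * n\<^sup>2 * nrm2 T w"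
  have "norm (?\<phi> 1 - ?\<phi> 0) \<le> K"
  proof (rule norm_increment_unit_interval[where \<psi>'="\<lambda>s. B (?v s) e w - B u e w"])
    fix s :: real assume s: "s \<in> {0..1}"
    show "(?\<phi> has_vector_derivative B (?v s) e w - B u e w) (at s)"
      unfolding has_real_derivative_iff_has_vector_derivative[symmetric]
      by (auto intro!: derivative_eq_intros DJ_line_derivative ub e w)
    have v: "?v s \<in> L2 T" by (intro L2_add L2_scale ub e)
    have "(\<lambda>t. u t - ?v s t) = (\<lambda>t. (1 - s) *\<^sub>R e t)" by (simp add: e_def fun_eq_iff algebra_simps)
    then have dist: "nrm2 T (\<lambda>t. u t - ?v s t) = (1 - s) * n"
      using s by (simp add: L2_scale(2)[OF e] n_def)
    have "nrm1 T (?v s) \<le> nrm1 T ub + \<bar>s\<bar> * nrm1 T e"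
      using nrm1_triangle[OF ub L2_scale(1)[OF e, of s]] by (simp add: nrm1_scale)
    also have "\<dots> \<le> nrm1 T ub + s * (sqrt T * n)"
      using s nrm1_le_nrm2[OF e T0] by (auto simp: n_def intro!: mult_left_mono)
    finally have n1: "1 + nrm1 T (?v s) \<le> 1 + nrm1 T ub + s * (sqrt T * n)" by simp
    have "\<bar>B u e w - B (?v s) e w\<bar> \<le> C4 * (1 + nrm1 T (?v s)) * nrm2 T (\<lambda>t. u t - ?v s t) * nrm2 T e * nrm2 T w"
      by (rule B_lipschitz[OF u v e w])
    also have "\<dots> = C4 * ((1 + nrm1 T (?v s)) * (1 - s)) * n\<^sup>2 * nrm2 T w"
      unfolding dist n_def[symmetric] by (simp add: power2_eq_square mult_ac)
    also have "\<dots> \<le> C4 * ((1 + nrm1 T ub) + sqrt T * n / 4) * n\<^sup>2 * nrm2 T w"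
    proof (intro mult_right_mono mult_left_mono)
      have "(1 + nrm1 T (?v s)) * (1 - s) \<le> (1 + nrm1 T ub + s * (sqrt T * n)) * (1 - s)"
        using n1 s by (intro mult_right_mono) auto
      also have "\<dots> = (1 + nrm1 T ub) * (1 - s) + (s * (1 - s)) * (sqrt T * n)" by (simp add: algebra_simps)
      also have "\<dots> \<le> (1 + nrm1 T ub) * 1 + (1 / 4) * (sqrt T * n)"
      proof (intro add_mono mult_left_mono mult_right_mono)
        have "0 \<le> (s - 1/2)\<^sup>2" by simp
        then show "s * (1 - s) \<le> 1 / 4" by (simp add: power2_eq_square algebra_simps)
      qed (use s T in \<open>auto simp: n_def\<close>)
      finally show "(1 + nrm1 T (?v s)) * (1 - s) \<le> (1 + nrm1 T ub) + sqrt T * n / 4" by simp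
    qed (use C4_pos in auto)
    also have "\<dots> = K" by (simp add: K_def algebra_simps)
    finally show "norm (B (?v s) e w - B u e w) \<le> K" by (simp add: abs_minus_commute)
  qed
  moreover have "?v 1 = u" "?v 0 = ub" by (auto simp: e_def)
  ultimately show ?thesis by (simp add: K_def n_def algebra_simps)
qed

end

section \<open>Newton's method\<close>

text \<open>On \<open>[0, r]\<close> the quadratic recursion is dominated by the linear one with
  factor \<open>c * r\<close>. As the recursion is assumed inside this interval only, staying in it
  has to be proved first.\<close>

lemma quadratic_recursion_tendsto_zero:
  fixes E :: "nat \<Rightarrow> real"
  assumes E0: "\<And>k. 0 \<le> E k" and init: "E 0 \<le> r" and c: "0 \<le> c" "c * r < 1"
    and step: "\<And>k. E k \<le> r \<Longrightarrow> E (Suc k) \<le> c * (E k)\<^sup>2"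
  shows "E k \<le> r" "E \<longlonglongrightarrow> 0"
proof -
  have r0: "0 \<le> r" using E0[of 0] init by linarith
  define q where "q = c * r"
  have q: "0 \<le> q" "q < 1" using c r0 by (auto simp: q_def)
  have next_le: "E (Suc k) \<le> q * E k" if "E k \<le> r" for k
  proof -
    have "E (Suc k) \<le> c * (E k)\<^sup>2" by (rule step[OF that])
    also have "\<dots> = (c * E k) * E k" by (simp add: power2_eq_square)
    also have "\<dots> \<le> q * E k" unfolding q_def using that c E0 by (intro mult_right_mono mult_left_mono) auto
    finally show ?thesis .
  qed
  have le_r: "E k \<le> r" for k
  proof (induction k)
    case (Suc k)
    have "q * E k \<le> E k" using q E0[of k] by (simp add: mult_left_le_one_le)
    then show ?case using next_le[OF Suc] Suc by linarith
  qed (rule init)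
  then show "E k \<le> r" .
  have geo: "E k \<le> r * q ^ k" for k
  proof (induction k)
    case (Suc k)
    have "E (Suc k) \<le> q * E k" by (rule next_le[OF le_r])
    also have "\<dots> \<le> q * (r * q ^ k)" using Suc q by (intro mult_left_mono)
    finally show ?case by (simp add: mult_ac)
  qed (use init in simp)
  have "(\<lambda>k. r * q ^ k) \<longlonglongrightarrow> 0"
    using q by (intro tendsto_mult_right_zero LIMSEQ_power_zero) auto
  then show "E \<longlonglongrightarrow> 0"
    by (rule Lim_null_comparison[rotated]) (use geo E0 in \<open>auto intro!: always_eventually\<close>)
qed

context control
begin

section \<open>Stationarity and the quadratic subproblem\<close>

lemma stationary_of_minimal:
  assumes ub: "ub \<in> L2 T" and min: "\<And>w. w \<in> L2 T \<Longrightarrow> J ub \<le> J w" and w: "w \<in> L2 T"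
  shows "DJ ub w = 0"
proof -
  let ?F = "\<lambda>s. J (\<lambda>t. ub t + s *\<^sub>R w t)"
  define C where "C = \<bar>B ub w w\<bar> + K6 * (1 + nrm1 T ub) * nrm2 T w ^ 3"
  have "(?F has_real_derivative DJ ub w) (at 0)"
  proof (rule has_real_derivative_of_quadratic_bound[where C=C])
    fix r :: real assume r: "\<bar>r\<bar> \<le> 1"
    have rw: "(\<lambda>t. r *\<^sub>R w t) \<in> L2 T" by (intro L2_scale w)
    have "B ub (\<lambda>t. r *\<^sub>R w t) (\<lambda>t. r *\<^sub>R w t) = r\<^sup>2 * B ub w w"
      using B_symmetric[of ub w "\<lambda>t. r *\<^sub>R w t"] by (simp add: B_scale ub w rw power2_eq_square)
    then have "\<bar>?F r - J ub - r * DJ ub w - r\<^sup>2 * B ub w w / 2\<bar> \<le> K6 * (1 + nrm1 T ub) * (\<bar>r\<bar> * nrm2 T w) ^ 3"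
      using J_expansion[OF ub rw] by (simp add: DJ_scale L2_scale(2)[OF w])
    also have "\<dots> = (K6 * (1 + nrm1 T ub) * nrm2 T w ^ 3) * \<bar>r\<bar> ^ 3" by (simp add: power_mult_distrib mult_ac)
    also have "\<dots> \<le> (K6 * (1 + nrm1 T ub) * nrm2 T w ^ 3) * \<bar>r\<bar> ^ 2"
      using r K6_nonneg by (intro mult_left_mono power_decreasing mult_nonneg_nonneg) auto
    finally have 1: "\<bar>?F r - J ub - r * DJ ub w - r\<^sup>2 * B ub w w / 2\<bar> \<le> (K6 * (1 + nrm1 T ub) * nrm2 T w ^ 3) * r\<^sup>2" by simp
    have 2: "\<bar>r\<^sup>2 * B ub w w / 2\<bar> \<le> \<bar>B ub w w\<bar> * r\<^sup>2" by (simp add: abs_mult)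
    have "\<bar>?F r - J ub - r * DJ ub w\<bar> \<le> (K6 * (1 + nrm1 T ub) * nrm2 T w ^ 3) * r\<^sup>2 + \<bar>B ub w w\<bar> * r\<^sup>2"
      using 1 2 by linarith
    then show "\<bar>?F (0 + r) - ?F 0 - r * DJ ub w\<bar> \<le> C * r\<^sup>2" by (simp add: C_def distrib_right)
  qed
  then show ?thesis
  proof (rule DERIV_local_min[of _ _ _ 1])
    show "\<forall>y. \<bar>0 - y\<bar> < 1 \<longrightarrow> ?F 0 \<le> ?F y"
      using min L2_add(1)[OF ub L2_scale(1)[OF w]] by simp
  qed simp
qed

text \<open>The second order model of \<open>J\<close> at \<open>u\<close> without its constant
  term; \<open>newton_objective_eq\<close> identifies it with the objective of Newton's
  subproblem.\<close>

definition Q :: "(real \<Rightarrow> 'u) \<Rightarrow> (real \<Rightarrow> 'u) \<Rightarrow> real" where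
  "Q u v = DJ u v + B u v v / 2"

lemma Q_expansion:
  assumes u: "u \<in> L2 T" and v: "v \<in> L2 T" and w: "w \<in> L2 T"
  shows "Q u (\<lambda>t. v t + s *\<^sub>R w t) = Q u v + s * (DJ u w + B u v w) + s\<^sup>2 * (B u w w / 2)"
proof -
  let ?q = "\<lambda>t. s *\<^sub>R w t + v t"
  have q: "?q \<in> L2 T" by (intro L2_add L2_scale v w)
  have "B u ?q ?q = s * B u w ?q + B u v ?q" by (rule B_linear[OF u w v q])
  also have "B u w ?q = s * B u w w + B u v w"
    using B_linear[OF u w v w, of s] by (simp add: B_symmetric[of u w ?q])
  also have "B u v ?q = s * B u v w + B u v v"
    using B_linear[OF u w v v, of s] by (simp add: B_symmetric[of u v ?q] B_symmetric[of u w v])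
  finally have "B u ?q ?q = s\<^sup>2 * B u w w + 2 * s * B u v w + B u v v" by (simp add: power2_eq_square algebra_simps)
  then have "Q u ?q = Q u v + s * (DJ u w + B u v w) + s\<^sup>2 * (B u w w / 2)"
    unfolding Q_def DJ_linear[OF u w v] by (simp add: field_simps)
  then show ?thesis by (simp add: add.commute)
qed

lemma stationary_of_Q_minimal:
  assumes u: "u \<in> L2 T" and v: "v \<in> L2 T" and w: "w \<in> L2 T"
    and min: "\<And>w. w \<in> L2 T \<Longrightarrow> Q u v \<le> Q u w"
  shows "DJ u w + B u v w = 0"
proof (rule linear_term_zero)
  fix s
  have "Q u v \<le> Q u (\<lambda>t. v t + s *\<^sub>R w t)" by (intro min L2_add L2_scale v w)
  then show "0 \<le> s * (DJ u w + B u v w) + s\<^sup>2 * (B u w w / 2)" unfolding Q_expansion[OF u v w] by linarith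
qed

lemma Q_stationary_point:
  assumes u: "u \<in> L2 T" and c: "0 < c" and coer: "\<And>v. v \<in> L2 T \<Longrightarrow> c * (nrm2 T v)\<^sup>2 \<le> B u v v"
  shows "\<exists>v\<in>L2 T. \<forall>w\<in>L2 T. DJ u w + B u v w = 0"
proof -
  obtain K where K: "0 \<le> K" "\<And>v w. v \<in> L2 T \<Longrightarrow> w \<in> L2 T \<Longrightarrow> \<bar>B u v w\<bar> \<le> K * nrm2 T v * nrm2 T w"
    using B_bounded[OF u] by blast
  define M where "M = max K (nrm2 T (G u))"
  show ?thesis
  proof (rule coercive_quadratic_stationary_point[OF T0 c, of M])
    show "0 \<le> M" using K(1) by (simp add: M_def)
    show "\<bar>B u v w\<bar> \<le> M * nrm2 T v * nrm2 T w" if "v \<in> L2 T" "w \<in> L2 T" for v w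
    proof -
      have "\<bar>B u v w\<bar> \<le> K * nrm2 T v * nrm2 T w" by (rule K(2)[OF that])
      also have "\<dots> \<le> M * nrm2 T v * nrm2 T w" by (intro mult_right_mono) (auto simp: M_def)
      finally show ?thesis .
    qed
    show "\<bar>DJ u v\<bar> \<le> M * nrm2 T v" if v: "v \<in> L2 T" for v
    proof -
      have "\<bar>DJ u v\<bar> \<le> nrm2 T (G u) * nrm2 T v" by (rule DJ_bound[OF u v])
      also have "\<dots> \<le> M * nrm2 T v" by (intro mult_right_mono) (auto simp: M_def)
      finally show ?thesis .
    qed
    show "DJ u (\<lambda>t. v t + w t) = DJ u v + DJ u w" if "v \<in> L2 T" "w \<in> L2 T" for v w
      using DJ_linear[OF u that, of 1] by simp
  qed (auto simp: coer B_add B_scale DJ_scale u intro: B_symmetric)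
qed

end

text \<open>The radius enters through the quadratic equation \<open>radius\<close> and positivity,
  which \<open>r_4_equation\<close> supplies; this hides the square root of the closed form.\<close>

locale newton_ball = control T L b Db D2b f Df D2f g Dg D2g x0
  for T L :: real
    and b :: "real \<Rightarrow> 'x::euclidean_space \<times> 'u::euclidean_space \<Rightarrow> 'x" and Db D2b
    and f :: "real \<Rightarrow> 'x \<times> 'u \<Rightarrow> real" and Df D2f
    and g :: "'x \<Rightarrow> real" and Dg D2g and x0 :: 'x +
  fixes ub :: "real \<Rightarrow> 'u" and \<alpha> r :: real
  assumes ub: "ub \<in> L2 T" and \<alpha>: "0 < \<alpha>" and r: "0 < r"
    and radius: "2 * (C_4 T L (norm x0) * (1 + nrm1 T ub)) * r + C_4 T L (norm x0) * sqrt T * r\<^sup>2 = \<alpha>"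
    and stationary: "\<And>w. w \<in> L2 T \<Longrightarrow> DJ ub w = 0"
    and coercive: "\<And>v. v \<in> L2 T \<Longrightarrow> \<alpha> * (nrm2 T v)\<^sup>2 \<le> B ub v v"
begin

text \<open>By \<open>B_lipschitz\<close>, \<open>a * r\<close> is the coercivity that can be lost
  in the ball. Thus \<open>\<kappa>\<close> is the coercivity that remains there, and
  \<open>c\<close> is the constant of the linearization error divided by it.\<close>

definition a where "a = C4 * (1 + nrm1 T ub)"
definition d where "d = C4 * sqrt T"
definition \<kappa> where "\<kappa> = \<alpha> - a * r"
definition c where "c = (a + d * r / 4) / \<kappa>"
definition err :: "(real \<Rightarrow> 'u) \<Rightarrow> real" where "err u = nrm2 T (\<lambda>t. u t - ub t)"

lemma a_pos: "0 < a" unfolding a_def using C4_pos by (intro mult_pos_pos) (auto intro: add_pos_nonneg)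
lemma d_pos: "0 < d" unfolding d_def using C4_pos T by simp

lemma \<kappa>_eq: "\<kappa> = a * r + d * r\<^sup>2" using radius[folded a_def d_def] unfolding \<kappa>_def by linarith

lemma \<kappa>_pos: "0 < \<kappa>" unfolding \<kappa>_eq using a_pos d_pos r by (intro add_pos_pos mult_pos_pos) auto

lemma c_pos: "0 < c" unfolding c_def using a_pos d_pos r \<kappa>_pos by (intro divide_pos_pos add_pos_pos) auto

text \<open>The radius is chosen such that \<open>\<alpha> - a r = a r + d r\<^sup>2\<close>, which makes the contraction factor smaller than one.\<close>

lemma cr: "c * r < 1"
proof -
  have "c * r = (a * r + d * r\<^sup>2 / 4) / \<kappa>" by (simp add: c_def algebra_simps power2_eq_square add_divide_distrib)
  also have "\<dots> < 1" using \<kappa>_pos d_pos r by (simp add: \<kappa>_eq)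
  finally show ?thesis .
qed

lemma err_nonneg: "0 \<le> err u" by (simp add: err_def)

lemma coercive_in_ball:
  assumes u: "u \<in> L2 T" and e: "err u \<le> r" and v: "v \<in> L2 T"
  shows "\<kappa> * (nrm2 T v)\<^sup>2 \<le> B u v v"
proof -
  have "\<bar>B u v v - B ub v v\<bar> \<le> C4 * (1 + nrm1 T ub) * err u * nrm2 T v * nrm2 T v"
    unfolding err_def by (rule B_lipschitz[OF u ub v v])
  also have "\<dots> \<le> a * r * (nrm2 T v)\<^sup>2"
  proof -
    have "a * err u * (nrm2 T v)\<^sup>2 \<le> a * r * (nrm2 T v)\<^sup>2"
      using e a_pos by (intro mult_right_mono mult_left_mono) auto
    then show ?thesis by (simp add: a_def power2_eq_square mult.assoc)
  qed
  finally show ?thesis using coercive[OF v] by (simp add: \<kappa>_def left_diff_distrib)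
qed

lemma newton_step_error:
  assumes u: "u \<in> L2 T" and e: "err u \<le> r" and v: "v \<in> L2 T"
    and st: "\<And>w. w \<in> L2 T \<Longrightarrow> DJ u w + B u v w = 0"
  shows "err (\<lambda>t. u t + v t) \<le> c * (err u)\<^sup>2"
proof -
  define e0 where "e0 = (\<lambda>t. u t - ub t)"
  define e1 where "e1 = (\<lambda>t. u t + v t - ub t)"
  have e0: "e0 \<in> L2 T" unfolding e0_def by (intro L2_diff u ub)
  have e1_eq: "e1 = (\<lambda>t. e0 t + v t)" by (auto simp: e0_def e1_def)
  have e1: "e1 \<in> L2 T" unfolding e1_eq by (intro L2_add e0 v)
  define n where "n = nrm2 T e1"
  have "B u e1 e1 = B u e0 e1 + B u v e1" unfolding e1_eq using e1[unfolded e1_eq] by (intro B_add u e0 v)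
  also have "\<dots> = - (DJ u e1 - DJ ub e1 - B u e0 e1)" using st[OF e1] stationary[OF e1] by simp
  also have "\<dots> \<le> \<bar>DJ u e1 - DJ ub e1 - B u e0 e1\<bar>" by linarith
  also have "\<dots> \<le> (a + d * err u / 4) * (err u)\<^sup>2 * n"
    using DJ_linearization_error[OF u ub e1] by (simp add: a_def d_def err_def e0_def n_def)
  also have "\<dots> \<le> (a + d * r / 4) * (err u)\<^sup>2 * n"
    using e d_pos by (intro mult_right_mono add_left_mono divide_right_mono mult_left_mono) (auto simp: n_def)
  finally have "\<kappa> * n\<^sup>2 \<le> (a + d * r / 4) * (err u)\<^sup>2 * n"
    using coercive_in_ball[OF u e e1] by (simp add: n_def)
  then have le: "(\<kappa> * n) * n \<le> ((a + d * r / 4) * (err u)\<^sup>2) * n" by (simp add: power2_eq_square mult_ac)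
  have "n \<le> c * (err u)\<^sup>2"
  proof (cases "n = 0")
    case True
    then show ?thesis using c_pos by simp
  next
    case False
    then have "0 < n" by (simp add: n_def order.strict_iff_order)
    with le have "\<kappa> * n \<le> (a + d * r / 4) * (err u)\<^sup>2" by simp
    then show ?thesis using \<kappa>_pos by (simp add: c_def field_simps)
  qed
  then show ?thesis by (simp add: err_def n_def e1_def)
qed

text \<open>The functional \<open>DJ u\<close> is tested with \<open>G u\<close> itself, and
  \<open>DJ ub\<close> vanishes. \<open>B_bounded\<close> gives a constant that depends on the base
  control, so \<open>B u\<close> is first compared with \<open>B ub\<close> to get one constant for
  the whole ball.\<close>

lemma gradient_le_error: "\<exists>K\<ge>0. \<forall>u\<in>L2 T. err u \<le> r \<longrightarrow> nrm2 T (G u) \<le> K * err u"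
proof -
  obtain K where K: "0 \<le> K" "\<And>v w. v \<in> L2 T \<Longrightarrow> w \<in> L2 T \<Longrightarrow> \<bar>B ub v w\<bar> \<le> K * nrm2 T v * nrm2 T w"
    using B_bounded[OF ub] by blast
  define M where "M = K + a * r + (a + d * r / 4) * r"
  have M: "0 \<le> M" unfolding M_def using K(1) a_pos d_pos r by (intro add_nonneg_nonneg mult_nonneg_nonneg divide_nonneg_pos) auto
  have "nrm2 T (G u) \<le> M * err u" if u: "u \<in> L2 T" and e: "err u \<le> r" for u
  proof (cases "nrm2 T (G u) = 0")
    case False
    define n where "n = nrm2 T (G u)"
    define e0 where "e0 = (\<lambda>t. u t - ub t)"
    define x where "x = err u"
    have x: "0 \<le> x" "x \<le> r" using e err_nonneg by (auto simp: x_def)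
    have n: "0 < n" using False by (simp add: n_def order.strict_iff_order)
    have e0: "e0 \<in> L2 T" unfolding e0_def by (intro L2_diff u ub)
    note g = G_L2[OF u]
    have 1: "\<bar>DJ u (G u) - DJ ub (G u) - B u e0 (G u)\<bar> \<le> (a + d * x / 4) * x\<^sup>2 * n"
      using DJ_linearization_error[OF u ub g] by (simp add: a_def d_def err_def e0_def n_def x_def)
    have 2: "\<bar>B u e0 (G u) - B ub e0 (G u)\<bar> \<le> a * x * x * n"
      using B_lipschitz[OF u ub e0 g] by (simp add: a_def err_def e0_def n_def x_def)
    have 3: "\<bar>B ub e0 (G u)\<bar> \<le> K * x * n" using K(2)[OF e0 g] by (simp add: err_def e0_def n_def x_def)
    have "n\<^sup>2 = DJ u (G u)" by (simp add: n_def DJ_def nrm2_sq_inner)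
    also have "\<dots> \<le> (a + d * x / 4) * x\<^sup>2 * n + a * x * x * n + K * x * n"
      using 1 2 3 stationary[OF g] by (simp add: abs_le_iff)
    also have "\<dots> = ((a + d * x / 4) * x + a * x + K) * x * n" by (simp add: power2_eq_square algebra_simps)
    also have "\<dots> \<le> ((a + d * r / 4) * r + a * r + K) * x * n"
      using x n a_pos d_pos by (intro mult_right_mono add_mono mult_mono mult_left_mono divide_right_mono) auto
    finally have "n * n \<le> (M * x) * n" by (simp add: M_def power2_eq_square algebra_simps)
    then show ?thesis using n by (simp add: n_def x_def)
  qed (use M err_nonneg in simp)
  then show ?thesis using M by blast
qed

text \<open>Coercivity bounds the Newton direction by the gradient, and the error exceeds the length
  of the direction by at most the next error, which is at most \<open>c * r\<close> times the
  present one. With \<open>gradient_le_error\<close> this makes error and gradient comparable, so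
  quadratic convergence passes from controls to gradients.\<close>

lemma error_le_gradient:
  assumes u: "u \<in> L2 T" and e: "err u \<le> r" and v: "v \<in> L2 T"
    and st: "\<And>w. w \<in> L2 T \<Longrightarrow> DJ u w + B u v w = 0"
  shows "(1 - c * r) * \<kappa> * err u \<le> nrm2 T (G u)"
proof -
  have "\<kappa> * (nrm2 T v)\<^sup>2 \<le> B u v v" by (rule coercive_in_ball[OF u e v])
  also have "\<dots> = - DJ u v" using st[OF v] by linarith
  also have "\<dots> \<le> nrm2 T (G u) * nrm2 T v" using DJ_bound[OF u v] by (simp add: abs_le_iff)
  finally have le: "(\<kappa> * nrm2 T v) * nrm2 T v \<le> nrm2 T (G u) * nrm2 T v" by (simp add: power2_eq_square mult.assoc)
  have nv: "\<kappa> * nrm2 T v \<le> nrm2 T (G u)"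
  proof (cases "nrm2 T v = 0")
    case False
    then have "0 < nrm2 T v" by (simp add: order.strict_iff_order)
    with le show ?thesis by simp
  qed simp
  have "err u \<le> err (\<lambda>t. u t + v t) + nrm2 T v"
    using L2_diff(2)[OF L2_diff(1)[OF L2_add(1)[OF u v] ub] v] by (simp add: err_def algebra_simps)
  also have "\<dots> \<le> (c * r) * err u + nrm2 T v"
  proof -
    have "c * (err u)\<^sup>2 \<le> (c * r) * err u"
      using mult_mono[OF mult_left_mono[OF e, of c] order_refl[of "err u"]] c_pos err_nonneg[of u] r
      by (simp add: power2_eq_square mult.assoc)
    then show ?thesis using newton_step_error[OF u e v st] by linarith
  qed
  finally have "(1 - c * r) * err u \<le> nrm2 T v" by (simp add: left_diff_distrib)
  then have "\<kappa> * ((1 - c * r) * err u) \<le> \<kappa> * nrm2 T v" using \<kappa>_pos by (intro mult_left_mono) auto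
  then show ?thesis using nv by (simp add: mult_ac)
qed

text \<open>The assumption \<open>step\<close> compares errors instead of iterates: if the direction
  vanishes almost everywhere, the iterate is kept as it is and equals \<open>us k + v\<close> only
  up to a null set.\<close>

lemma newton_iteration_converges:
  fixes us vs :: "nat \<Rightarrow> real \<Rightarrow> 'u"
  assumes us: "\<And>k. us k \<in> L2 T" and init: "err (us 0) \<le> r"
    and step: "\<And>k. err (us k) \<le> r \<Longrightarrow> \<exists>v\<in>L2 T. (\<forall>w\<in>L2 T. DJ (us k) w + B (us k) v w = 0) \<and>
      err (us (Suc k)) = err (\<lambda>t. us k t + v t)"
  shows "quadratically_converges_L2 T us ub"
    and "\<exists>K\<ge>0. (\<forall>k. nrm2 T (G (us (Suc k))) \<le> K * (nrm2 T (G (us k)))\<^sup>2)"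
    and "(\<lambda>k. nrm2 T (G (us k))) \<longlonglongrightarrow> 0"
proof -
  have quad: "err (us (Suc k)) \<le> c * (err (us k))\<^sup>2" if le: "err (us k) \<le> r" for k
  proof -
    obtain v where v: "v \<in> L2 T" "\<And>w. w \<in> L2 T \<Longrightarrow> DJ (us k) w + B (us k) v w = 0"
      and e: "err (us (Suc k)) = err (\<lambda>t. us k t + v t)"
      using step[OF le] by blast
    show ?thesis unfolding e by (rule newton_step_error[OF us le v])
  qed
  note rec = quadratic_recursion_tendsto_zero[of "\<lambda>k. err (us k)", OF err_nonneg init less_imp_le[OF c_pos] cr quad]
  show "quadratically_converges_L2 T us ub"
    unfolding quadratically_converges_L2_def err_def[symmetric]
    using us ub rec(2) c_pos quad[OF rec(1)] by blast
  obtain K where K: "0 \<le> K" "\<And>u. u \<in> L2 T \<Longrightarrow> err u \<le> r \<Longrightarrow> nrm2 T (G u) \<le> K * err u"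
    using gradient_le_error by blast
  define q where "q = (1 - c * r) * \<kappa>"
  have q: "0 < q" unfolding q_def using cr \<kappa>_pos by simp
  have low: "q * err (us k) \<le> nrm2 T (G (us k))" for k
  proof -
    obtain v where v: "v \<in> L2 T" "\<And>w. w \<in> L2 T \<Longrightarrow> DJ (us k) w + B (us k) v w = 0"
      using step[OF rec(1)[of k]] by blast
    show ?thesis unfolding q_def by (rule error_le_gradient[OF us rec(1) v])
  qed
  \<comment> \<open>The constant combines the upper bound \<open>K\<close> for the gradient, the
    quadratic step \<open>c\<close> for the error, and the lower bound \<open>q\<close> for the
    gradient, which is squared with it.\<close>
  have "nrm2 T (G (us (Suc k))) \<le> K * c / q\<^sup>2 * (nrm2 T (G (us k)))\<^sup>2" for k
  proof -
    have "nrm2 T (G (us (Suc k))) \<le> K * err (us (Suc k))" by (rule K(2)[OF us rec(1)])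
    also have "\<dots> \<le> K * (c * (err (us k))\<^sup>2)" using K(1) quad[OF rec(1)] by (intro mult_left_mono) auto
    also have "\<dots> = K * c / q\<^sup>2 * (q * err (us k))\<^sup>2" using q by (simp add: power_mult_distrib)
    also have "\<dots> \<le> K * c / q\<^sup>2 * (nrm2 T (G (us k)))\<^sup>2"
      using K(1) c_pos q low[of k] err_nonneg by (intro mult_left_mono power_mono) auto
    finally show ?thesis .
  qed
  moreover have "0 \<le> K * c / q\<^sup>2" using K(1) c_pos by simp
  ultimately show "\<exists>K\<ge>0. (\<forall>k. nrm2 T (G (us (Suc k))) \<le> K * (nrm2 T (G (us k)))\<^sup>2)" by blast
  have "(\<lambda>k. K * err (us k)) \<longlonglongrightarrow> 0" using rec(2) by (rule tendsto_mult_right_zero)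
  then show "(\<lambda>k. nrm2 T (G (us k))) \<longlonglongrightarrow> 0"
    by (rule Lim_null_comparison[rotated]) (use K(2)[OF us rec(1)] in \<open>auto intro!: always_eventually\<close>)
qed

end

section \<open>Transfer to the concrete optimal control problem\<close>

lemma solves_ode_on_cong:
  assumes "\<And>t \<xi>. t \<in> {0..T} \<Longrightarrow> F t \<xi> = F' t \<xi>"
  shows "solves_ode_on T F x \<longleftrightarrow> solves_ode_on T F' x"
proof -
  have "integrable (leb T) (\<lambda>s. F s (x s)) \<longleftrightarrow> integrable (leb T) (\<lambda>s. F' s (x s))"
    by (rule Bochner_Integration.integrable_cong) (use assms in auto)
  moreover have "(LINT s|leb t. F s (x s)) = (LINT s|leb t. F' s (x s))" if "t \<in> {0..T}" for t
    by (rule Bochner_Integration.integral_cong) (use assms that in auto)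
  ultimately show ?thesis unfolding solves_ode_on_def by simp
qed

lemma riesz_add: "riesz l + riesz m = riesz (\<lambda>h. l h + m h)"
  by (simp add: riesz_def scaleR_add_left sum.distrib)

locale newton_problem =
  fixes T L :: real and x0 :: "real^'n"
    and b :: "real \<Rightarrow> real^'n \<Rightarrow> real^'m \<Rightarrow> real^'n"
    and f :: "real \<Rightarrow> real^'n \<Rightarrow> real^'m \<Rightarrow> real"
    and g :: "real^'n \<Rightarrow> real"
  assumes T_pos: "0 < T" and standing: "standing_assumptions T L b f g"
    and f_uu: "uu_derivative_independent_of_u T f" and b_uu: "uu_derivative_independent_of_u T b"
begin

abbreviation "bb t \<equiv> (\<lambda>(\<xi>, \<upsilon>). b t \<xi> \<upsilon>)"
abbreviation "ff t \<equiv> (\<lambda>(\<xi>, \<upsilon>). f t \<xi> \<upsilon>)"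
abbreviation "Dbb t z \<equiv> frechet_derivative (bb t) (at z)"
abbreviation "Dff t z \<equiv> frechet_derivative (ff t) (at z)"
abbreviation "Dgg z \<equiv> frechet_derivative g (at z)"

lemmas standing1 = standing[unfolded standing_assumptions_def]
lemmas L_pos = standing1[THEN conjunct1] and standing2 = standing1[THEN conjunct2]
lemmas b_joint_measurable = standing2[THEN conjunct1] and standing3 = standing2[THEN conjunct2]
lemmas f_joint_measurable = standing3[THEN conjunct1] and standing4 = standing3[THEN conjunct2]
lemmas standing5 = standing4[THEN conjunct2]
lemmas b_twice_differentiable = standing5[THEN conjunct1] and standing6 = standing5[THEN conjunct2]
lemmas f_twice_differentiable = standing6[THEN conjunct1] and standing7 = standing6[THEN conjunct2]
lemmas g_twice_differentiable = standing7[THEN conjunct1] and standing8 = standing7[THEN conjunct2]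
lemmas b_le = standing8[THEN conjunct1] and standing9 = standing8[THEN conjunct2]
lemmas b_jacobian_le = standing9[THEN conjunct1] and standing10 = standing9[THEN conjunct2]
lemmas b_second_deriv_le = standing10[THEN conjunct1] and standing11 = standing10[THEN conjunct2]
lemmas b_second_deriv_lipschitz = standing11[THEN conjunct1] and standing12 = standing11[THEN conjunct2]
lemmas f_le = standing12[THEN conjunct1] and standing13 = standing12[THEN conjunct2]
lemmas f_gradient_le = standing13[THEN conjunct1] and standing14 = standing13[THEN conjunct2]
lemmas f_second_deriv_le = standing14[THEN conjunct1] and standing15 = standing14[THEN conjunct2]
lemmas f_second_deriv_lipschitz = standing15[THEN conjunct1] and standing16 = standing15[THEN conjunct2]
lemmas standing17 = standing16[THEN conjunct2]
lemmas g_gradient_le = standing17[THEN conjunct1] and standing18 = standing17[THEN conjunct2]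
lemmas g_second_deriv_le = standing18[THEN conjunct1] and standing19 = standing18[THEN conjunct2]
lemmas g_second_deriv_lipschitz = standing19

text \<open>The hypothesis on the second derivative of the section in the control becomes a
  statement about the joint second derivative in purely control directions, by
  \<open>second_deriv_partial\<close>.\<close>

lemma block_of_standing:
  fixes \<phi> :: "real \<Rightarrow> real^'n \<Rightarrow> real^'m \<Rightarrow> 'y::euclidean_space"
  assumes d: "twice_deriv L (\<lambda>(\<xi>, \<upsilon>). \<phi> t \<xi> \<upsilon>) D (second_deriv (\<lambda>(\<xi>, \<upsilon>). \<phi> t \<xi> \<upsilon>))" and t: "t \<in> {0..T}"
    and lip: "\<And>x x' u u'. array_norm (\<lambda>h k. second_deriv (\<lambda>(\<xi>, \<upsilon>). \<phi> t \<xi> \<upsilon>) (x, u) h k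
      - second_deriv (\<lambda>(\<xi>, \<upsilon>). \<phi> t \<xi> \<upsilon>) (x', u') h k) \<le> L * (norm (x - x') + norm (u - u'))"
    and uu: "uu_derivative_independent_of_u T \<phi>"
  shows "lipschitz_block L (second_deriv (\<lambda>(\<xi>, \<upsilon>). \<phi> t \<xi> \<upsilon>))"
  unfolding lipschitz_block_def
proof (intro conjI allI)
  fix z z' h k
  have "array_norm (\<lambda>h k. second_deriv (\<lambda>(\<xi>, \<upsilon>). \<phi> t \<xi> \<upsilon>) z h k - second_deriv (\<lambda>(\<xi>, \<upsilon>). \<phi> t \<xi> \<upsilon>) z' h k)
      \<le> L * (norm (fst z - fst z') + norm (snd z - snd z'))"
    using lip[of "fst z" "snd z" "fst z'" "snd z'"] by simp
  from second_deriv_lipschitz[OF d this]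
  show "norm (second_deriv (\<lambda>(\<xi>, \<upsilon>). \<phi> t \<xi> \<upsilon>) z h k - second_deriv (\<lambda>(\<xi>, \<upsilon>). \<phi> t \<xi> \<upsilon>) z' h k)
    \<le> L * (norm (fst z - fst z') + norm (snd z - snd z')) * norm h * norm k" .
next
  fix x u u' h k
  have "second_deriv (\<lambda>\<upsilon>. \<phi> t x \<upsilon>) u h k = second_deriv (\<lambda>\<upsilon>. \<phi> t x \<upsilon>) u' h k"
    using uu t unfolding uu_derivative_independent_of_u_def by metis
  then show "second_deriv (\<lambda>(\<xi>, \<upsilon>). \<phi> t \<xi> \<upsilon>) (x, u) (0, h) (0, k) = second_deriv (\<lambda>(\<xi>, \<upsilon>). \<phi> t \<xi> \<upsilon>) (x, u') (0, h) (0, k)"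
    unfolding second_deriv_partial[OF d, symmetric] by simp
qed

sublocale control T L bb Dbb "\<lambda>t. second_deriv (bb t)" ff Dff "\<lambda>t. second_deriv (ff t)" g Dgg "second_deriv g" x0
proof
  show "0 < T" by (rule T_pos)
  show "0 < L" by (rule L_pos)
  have bd: "twice_deriv L (bb t) (Dbb t) (second_deriv (bb t))" if "t \<in> {0..T}" for t
  proof (rule twice_differentiable_twice_deriv)
    show "twice_differentiable (bb t)" by (rule b_twice_differentiable[rule_format, OF that])
    have "array_norm (second_deriv (bb t) (x, u)) \<le> L" for x u by (rule b_second_deriv_le[rule_format, OF that])
    then show "array_norm (second_deriv (bb t) z) \<le> L" for z by (cases z) simp
  qed
  have fd: "twice_deriv L (ff t) (Dff t) (second_deriv (ff t))" if "t \<in> {0..T}" for t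
  proof (rule twice_differentiable_twice_deriv)
    show "twice_differentiable (ff t)" by (rule f_twice_differentiable[rule_format, OF that])
    have "array_norm (second_deriv (ff t) (x, u)) \<le> L" for x u by (rule f_second_deriv_le[rule_format, OF that])
    then show "array_norm (second_deriv (ff t) z) \<le> L" for z by (cases z) simp
  qed
  have gd: "twice_deriv L g Dgg (second_deriv g)"
    by (rule twice_differentiable_twice_deriv[OF g_twice_differentiable]) (rule g_second_deriv_le[rule_format])
  show "twice_deriv L g Dgg (second_deriv g)" by (rule gd)
  show "norm (second_deriv g x h k - second_deriv g x' h k) \<le> L * norm (x - x') * norm h * norm k" for x x' h k
    by (rule second_deriv_lipschitz[OF gd]) (rule g_second_deriv_lipschitz[rule_format])
  show "(\<lambda>t. bb t z) \<in> borel_measurable (leb T)" for z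
    by (rule caratheodory_section_measurable[OF b_joint_measurable twice_deriv_continuous(1)[OF bd]])
  show "(\<lambda>t. ff t z) \<in> borel_measurable (leb T)" for z
    by (rule caratheodory_section_measurable[OF f_joint_measurable twice_deriv_continuous(1)[OF fd]])
  fix t assume t: "t \<in> {0..T}"
  show "twice_deriv L (bb t) (Dbb t) (second_deriv (bb t))" by (rule bd[OF t])
  show "twice_deriv L (ff t) (Dff t) (second_deriv (ff t))" by (rule fd[OF t])
  show "lipschitz_block L (second_deriv (bb t))"
    by (rule block_of_standing[OF bd[OF t] t _ b_uu]) (rule b_second_deriv_lipschitz[rule_format, OF t])
  show "lipschitz_block L (second_deriv (ff t))"
    by (rule block_of_standing[OF fd[OF t] t _ f_uu]) (rule f_second_deriv_lipschitz[rule_format, OF t])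
  fix z :: "(real^'n) \<times> (real^'m)"
  obtain x u where z: "z = (x, u)" by (cases z)
  from b_le[rule_format, OF t, of x u] show "norm (bb t z) \<le> L * (norm (fst z) + norm (snd z) + 1)" by (simp add: z)
  from f_le[rule_format, OF t, of x u] show "\<bar>ff t z\<bar> \<le> L * ((norm (fst z))\<^sup>2 + (norm (snd z))\<^sup>2 + 1)" by (simp add: z)
  fix h :: "(real^'n) \<times> (real^'m)"
  have db: "(bb t has_derivative Dbb t (x, u)) (at (x, u))" by (rule twice_derivD(1)[OF bd[OF t]])
  let ?jx = "jacobian (\<lambda>\<xi>. b t \<xi> u) (at x)" and ?ju = "jacobian (\<lambda>\<upsilon>. b t x \<upsilon>) (at u)"
  have jx: "?jx *v \<eta> = Dbb t (x, u) (\<eta>, 0)" for \<eta>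
    using jacobian_mult[OF has_derivative_partial(1)[OF db]] by simp
  have ju: "?ju *v \<eta> = Dbb t (x, u) (0, \<eta>)" for \<eta>
    using jacobian_mult[OF has_derivative_partial(2)[OF db]] by simp
  \<comment> \<open>A bound for the sum of the two Jacobian norms bounds each of them, and
    \<open>linear_pair_bound\<close> combines the partial estimates into one for the joint
    derivative.\<close>
  have "norm ?jx + norm ?ju \<le> L" by (rule b_jacobian_le[rule_format, OF t])
  then have jL: "norm ?jx \<le> L" "norm ?ju \<le> L"
    using norm_ge_zero[of ?jx] norm_ge_zero[of ?ju] by linarith+
  show "norm (Dbb t z h) \<le> L * (norm (fst h) + norm (snd h))"
    unfolding z
  proof (rule linear_pair_bound[OF twice_deriv_linear(1)[OF bd[OF t]] _ _ jL])
    show "norm (Dbb t (x, u) (\<eta>, 0)) \<le> norm ?jx * norm \<eta>" for \<eta>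
      unfolding jx[symmetric] by (rule norm_matrix_vector_le)
    show "norm (Dbb t (x, u) (0, \<eta>)) \<le> norm ?ju * norm \<eta>" for \<eta>
      unfolding ju[symmetric] by (rule norm_matrix_vector_le)
  qed
  have df: "(ff t has_derivative Dff t (x, u)) (at (x, u))" by (rule twice_derivD(1)[OF fd[OF t]])
  have lin: "linear (Dff t (x, u))" by (rule twice_deriv_linear(1)[OF fd[OF t]])
  let ?gx = "gradient (\<lambda>\<xi>. f t \<xi> u) x" and ?gu = "gradient (\<lambda>\<upsilon>. f t x \<upsilon>) u"
  have gx: "?gx \<bullet> \<eta> = Dff t (x, u) (\<eta>, 0)" for \<eta>
    using gradient_eq_riesz[OF has_derivative_partial(1)[OF df]]
      riesz_inner[OF has_derivative_linear[OF has_derivative_partial(1)[OF df]]] by simp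
  have gu: "?gu \<bullet> \<eta> = Dff t (x, u) (0, \<eta>)" for \<eta>
    using gradient_eq_riesz[OF has_derivative_partial(2)[OF df]]
      riesz_inner[OF has_derivative_linear[OF has_derivative_partial(2)[OF df]]] by simp
  have "norm ?gx + norm ?gu \<le> L * (norm x + norm u + 1)" by (rule f_gradient_le[rule_format, OF t])
  then have gL: "norm ?gx \<le> L * (norm x + norm u + 1)" "norm ?gu \<le> L * (norm x + norm u + 1)"
    using norm_ge_zero[of ?gx] norm_ge_zero[of ?gu] by linarith+
  have "norm (Dff t (x, u) h) \<le> L * (norm x + norm u + 1) * (norm (fst h) + norm (snd h))"
  proof (rule linear_pair_bound[OF lin _ _ gL])
    show "norm (Dff t (x, u) (\<eta>, 0)) \<le> norm ?gx * norm \<eta>" for \<eta>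
      unfolding gx[symmetric] real_norm_def by (rule Cauchy_Schwarz_ineq2)
    show "norm (Dff t (x, u) (0, \<eta>)) \<le> norm ?gu * norm \<eta>" for \<eta>
      unfolding gu[symmetric] real_norm_def by (rule Cauchy_Schwarz_ineq2)
  qed
  then show "\<bar>Dff t z h\<bar> \<le> L * (norm (fst z) + norm (snd z) + 1) * (norm (fst h) + norm (snd h))" by (simp add: z)
next
  fix x h
  have gd: "twice_deriv L g Dgg (second_deriv g)"
    by (rule twice_differentiable_twice_deriv[OF g_twice_differentiable]) (rule g_second_deriv_le[rule_format])
  have "\<bar>Dgg x h\<bar> = \<bar>gradient g x \<bullet> h\<bar>"
    unfolding gradient_eq_riesz[OF twice_derivD(1)[OF gd]] by (simp add: riesz_inner[OF twice_deriv_linear(1)[OF gd]])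
  also have "\<dots> \<le> norm (gradient g x) * norm h" by (rule Cauchy_Schwarz_ineq2)
  also have "\<dots> \<le> L * (norm x + 1) * norm h" by (intro mult_right_mono g_gradient_le[rule_format]) simp
  finally show "\<bar>Dgg x h\<bar> \<le> L * (norm x + 1) * norm h" .
qed

lemma b_has_derivative: "t \<in> {0..T} \<Longrightarrow> (bb t has_derivative Dbb t z) (at z)"
  by (rule twice_derivD(1)[OF b_deriv])

lemma f_has_derivative: "t \<in> {0..T} \<Longrightarrow> (ff t has_derivative Dff t z) (at z)"
  by (rule twice_derivD(1)[OF f_deriv])

lemma state_eq: "state T x0 b u = X u"
  unfolding state_def X_def by simp

lemma cost_eq: "cost T x0 b f g = J"
  by (simp add: fun_eq_iff cost_def J_def state_eq Z_def)

lemma jacobian_x: "t \<in> {0..T} \<Longrightarrow> jacobian (\<lambda>\<xi>. b t \<xi> (u t)) (at (X u t)) *v \<eta> = Dbb t (Z u t) (\<eta>, 0)"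
  using jacobian_mult[OF has_derivative_partial(1)[OF b_has_derivative[of t "(X u t, u t)"]]] by (simp add: Z_def)

lemma jacobian_u: "t \<in> {0..T} \<Longrightarrow> jacobian (\<lambda>\<upsilon>. b t (X u t) \<upsilon>) (at (u t)) *v \<eta> = Dbb t (Z u t) (0, \<eta>)"
  using jacobian_mult[OF has_derivative_partial(2)[OF b_has_derivative[of t "(X u t, u t)"]]] by (simp add: Z_def)

lemma adjoint_eq: "adjoint_state T x0 b f g u = P u"
proof -
  have F: "- (transpose (jacobian (\<lambda>\<xi>. b t \<xi> (u t)) (at (X u t))) *v \<pi>) - gradient (\<lambda>\<xi>. f t \<xi> (u t)) (X u t) = - Hx t (Z u t) \<pi>"
    if t: "t \<in> {0..T}" for t \<pi>
  proof -
    have "gradient (\<lambda>\<xi>. f t \<xi> (u t)) (X u t) = riesz (\<lambda>\<eta>. Dff t (Z u t) (\<eta>, 0))"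
      using gradient_eq_riesz[OF has_derivative_partial(1)[OF f_has_derivative[OF t, of "(X u t, u t)"]]] by (simp add: Z_def)
    moreover have "transpose (jacobian (\<lambda>\<xi>. b t \<xi> (u t)) (at (X u t))) *v \<pi> = riesz (\<lambda>\<eta>. Dbb t (Z u t) (\<eta>, 0) \<bullet> \<pi>)"
      unfolding transpose_mult_eq_riesz jacobian_x[OF t] ..
    ultimately show ?thesis unfolding Hx_def DH_def by (simp add: riesz_add[symmetric])
  qed
  have g: "gradient g (X u T) = riesz (Dgg (X u T))" by (rule gradient_eq_riesz[OF twice_derivD(1)[OF g_deriv]])
  have ode: "solves_ode_on T (\<lambda>t \<pi>. - (transpose (jacobian (\<lambda>\<xi>. b t \<xi> (u t)) (at (X u t))) *v \<pi>)
      - gradient (\<lambda>\<xi>. f t \<xi> (u t)) (X u t)) p \<longleftrightarrow> solves_ode_on T (\<lambda>t \<pi>. - Hx t (Z u t) \<pi>) p" for p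
    by (rule solves_ode_on_cong) (rule F)
  show ?thesis
    unfolding adjoint_state_def Let_def state_eq P_def g ode ..
qed

lemma linearized_eq: "linearized_state T x0 b u v = Y u v"
proof -
  have F: "jacobian (\<lambda>\<xi>. b t \<xi> (u t)) (at (X u t)) *v \<eta> + jacobian (\<lambda>\<upsilon>. b t (X u t) \<upsilon>) (at (u t)) *v v t = Dbb t (Z u t) (\<eta>, v t)"
    if t: "t \<in> {0..T}" for t \<eta>
    unfolding jacobian_x[OF t] jacobian_u[OF t] by (simp add: linear_add[OF Db_linear[OF t], symmetric])
  have ode: "solves_ode_on T (\<lambda>t \<eta>. jacobian (\<lambda>\<xi>. b t \<xi> (u t)) (at (X u t)) *v \<eta>
      + jacobian (\<lambda>\<upsilon>. b t (X u t) \<upsilon>) (at (u t)) *v v t) y \<longleftrightarrow> solves_ode_on T (\<lambda>t \<eta>. Dbb t (Z u t) (\<eta>, v t)) y" for y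
    by (rule solves_ode_on_cong) (rule F)
  show ?thesis
    unfolding linearized_state_def Let_def state_eq Y_def ode ..
qed

lemma hamiltonian_has_derivative:
  assumes t: "t \<in> {0..T}"
  shows "((\<lambda>(\<xi>, \<upsilon>). hamiltonian b f t \<xi> \<upsilon> \<pi>) has_derivative DH t z \<pi>) (at z)"
proof -
  have "((\<lambda>z. bb t z \<bullet> \<pi> + ff t z) has_derivative (\<lambda>h. Dbb t z h \<bullet> \<pi> + Dff t z h)) (at z)"
    by (intro has_derivative_add has_derivative_inner_left b_has_derivative f_has_derivative t)
  moreover have "(\<lambda>(\<xi>, \<upsilon>). hamiltonian b f t \<xi> \<upsilon> \<pi>) = (\<lambda>z. bb t z \<bullet> \<pi> + ff t z)"
    by (auto simp: fun_eq_iff hamiltonian_def)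
  moreover have "DH t z \<pi> = (\<lambda>h. Dbb t z h \<bullet> \<pi> + Dff t z h)" by (rule ext) (rule DH_def)
  ultimately show ?thesis by (simp only:)
qed

lemma hamiltonian_second_deriv:
  assumes t: "t \<in> {0..T}"
  shows "second_deriv (\<lambda>(\<xi>, \<upsilon>). hamiltonian b f t \<xi> \<upsilon> \<pi>) z h k = D2H t z \<pi> h k"
proof (rule second_deriv_eq[OF hamiltonian_has_derivative[OF t]])
  have "((\<lambda>w. Dbb t w k \<bullet> \<pi> + Dff t w k) has_derivative (\<lambda>h. second_deriv (bb t) z h k \<bullet> \<pi> + second_deriv (ff t) z h k)) (at z)"
    by (intro has_derivative_add has_derivative_inner_left twice_derivD(2)[OF b_deriv[OF t]] twice_derivD(2)[OF f_deriv[OF t]])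
  then show "((\<lambda>w. DH t w \<pi> k) has_derivative (\<lambda>h. D2H t z \<pi> h k)) (at z)" by (simp add: DH_def D2H_def)
qed

lemma hamiltonian_u_eq:
  assumes t: "t \<in> {0..T}" shows "hamiltonian_u T x0 b f g u t = G u t"
  using gradient_eq_riesz[OF has_derivative_partial(2)[OF hamiltonian_has_derivative[OF t, of "P u t" "(X u t, u t)"]]]
  by (simp add: hamiltonian_u_def state_eq adjoint_eq G_def Hu_def Z_def)

lemma second_order_form_eq: "second_order_form T x0 b f g u v = B u v v"
proof -
  have "(LINT t|leb T. second_deriv (\<lambda>(\<xi>, \<upsilon>). hamiltonian b f t \<xi> \<upsilon> (P u t)) (X u t, u t) (Y u v t, v t) (Y u v t, v t))
      = (LINT t|leb T. D2H t (Z u t) (P u t) (W u v t) (W u v t))"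
    by (rule Bochner_Integration.integral_cong) (auto simp: hamiltonian_second_deriv Z_def W_def)
  then show ?thesis
    by (simp add: second_order_form_def Let_def state_eq adjoint_eq linearized_eq B_def)
qed

lemma newton_objective_eq:
  assumes u: "u \<in> L2 T" and v: "v \<in> L2 T"
  shows "newton_objective T x0 b f g u v = Q u v"
proof -
  have "(LINT t|leb T. 2 * (hamiltonian_u T x0 b f g u t \<bullet> v t)
         + second_deriv (\<lambda>(\<xi>, \<upsilon>). hamiltonian b f t \<xi> \<upsilon> (P u t)) (X u t, u t) (Y u v t, v t) (Y u v t, v t))
      = (LINT t|leb T. 2 * (G u t \<bullet> v t) + D2H t (Z u t) (P u t) (W u v t) (W u v t))"
    by (rule Bochner_Integration.integral_cong) (auto simp: hamiltonian_second_deriv Z_def W_def hamiltonian_u_eq)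
  also have "\<dots> = 2 * DJ u v + (LINT t|leb T. D2H t (Z u t) (P u t) (W u v t) (W u v t))"
    unfolding DJ_def
    using L2_inner_integrable(1)[OF G_L2[OF u] v] D2H_integrable(1)[OF u W_L2(1)[OF u v] W_L2(1)[OF u v]] by simp
  finally show ?thesis
    by (simp add: newton_objective_def Let_def state_eq adjoint_eq linearized_eq Q_def B_def add_divide_distrib)
qed

lemma hamiltonian_u_AE_zero:
  "(AE t in leb T. hamiltonian_u T x0 b f g u t = 0) \<longleftrightarrow> (AE t in leb T. G u t = 0)"
  by (rule AE_cong) (auto simp: hamiltonian_u_eq)

lemma cost_gradient_props:
  assumes u: "u \<in> L2 T"
  shows "cost_gradient T x0 b f g u \<in> L2 T" "nrm2 T (cost_gradient T x0 b f g u) = nrm2 T (G u)"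
proof -
  have s: "has_L2_gradient T J u (cost_gradient T x0 b f g u)"
    unfolding cost_gradient_def cost_eq by (rule someI[of "has_L2_gradient T J u", OF J_has_gradient[OF u]])
  then show c: "cost_gradient T x0 b f g u \<in> L2 T" by (simp add: has_L2_gradient_def)
  have z: "nrm2 T (\<lambda>t. cost_gradient T x0 b f g u t - G u t) = 0"
    by (rule has_L2_gradient_unique[OF s J_has_gradient[OF u]])
  have "AE t in leb T. cost_gradient T x0 b f g u t = G u t"
    using L2_zero_norm_AE[OF L2_diff(1)[OF c G_L2[OF u]] z] by simp
  then show "nrm2 T (cost_gradient T x0 b f g u) = nrm2 T (G u)"
    by (rule nrm2_cong_AE) (auto intro: L2_measurable c G_L2 u)
qed

lemma newton_direction_stationary:
  assumes u: "u \<in> L2 T" and nd: "newton_direction T x0 b f g u v" and w: "w \<in> L2 T"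
  shows "DJ u w + B u v w = 0"
proof (rule stationary_of_Q_minimal[OF u _ w])
  show v: "v \<in> L2 T" using nd by (simp add: newton_direction_def)
  show "Q u v \<le> Q u w" if "w \<in> L2 T" for w
  proof -
    have "newton_objective T x0 b f g u v \<le> newton_objective T x0 b f g u w"
      using nd that unfolding newton_direction_def by blast
    then show ?thesis by (simp only: newton_objective_eq[OF u v] newton_objective_eq[OF u that])
  qed
qed

text \<open>At a stationary point \<open>v\<close>, coercivity makes the objective at
  \<open>w\<close> exceed that at \<open>v\<close> by \<open>c / 2\<close> times the squared
  distance. This gives minimality and the uniqueness up to null sets that
  \<open>newton_direction\<close> demands.\<close>

lemma newton_direction_exists:
  assumes u: "u \<in> L2 T" and c: "0 < c" and coer: "\<And>v. v \<in> L2 T \<Longrightarrow> c * (nrm2 T v)\<^sup>2 \<le> B u v v"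
  shows "\<exists>v. newton_direction T x0 b f g u v"
proof -
  obtain v where v: "v \<in> L2 T" and st: "\<And>w. w \<in> L2 T \<Longrightarrow> DJ u w + B u v w = 0"
    using Q_stationary_point[OF u c coer] by blast
  have *: "Q u v + c / 2 * (nrm2 T (\<lambda>t. w t - v t))\<^sup>2 \<le> Q u w" if w: "w \<in> L2 T" for w
  proof -
    have d: "(\<lambda>t. w t - v t) \<in> L2 T" by (intro L2_diff w v)
    have "Q u w = Q u (\<lambda>t. v t + 1 *\<^sub>R (w t - v t))" by simp
    also have "\<dots> = Q u v + B u (\<lambda>t. w t - v t) (\<lambda>t. w t - v t) / 2"
      unfolding Q_expansion[OF u v d] using st[OF d] by simp
    finally show ?thesis using coer[OF d] by simp
  qed
  have "newton_direction T x0 b f g u v"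
    unfolding newton_direction_def
  proof (intro conjI ballI impI v)
    fix w :: "real \<Rightarrow> real^'m" assume w: "w \<in> L2 T"
    note eq = newton_objective_eq[OF u v] newton_objective_eq[OF u w]
    have d: "(\<lambda>t. w t - v t) \<in> L2 T" by (intro L2_diff w v)
    have "0 \<le> c / 2 * (nrm2 T (\<lambda>t. w t - v t))\<^sup>2" using c by simp
    then show "newton_objective T x0 b f g u v \<le> newton_objective T x0 b f g u w"
      unfolding eq using *[OF w] by linarith
    assume "newton_objective T x0 b f g u w = newton_objective T x0 b f g u v"
    then have "c / 2 * (nrm2 T (\<lambda>t. w t - v t))\<^sup>2 \<le> 0" unfolding eq using *[OF w] by linarith
    then have "nrm2 T (\<lambda>t. w t - v t) = 0" using c by (simp add: mult_le_0_iff)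
    from L2_zero_norm_AE[OF d this] show "AE t in leb T. w t = v t" by simp
  qed
  then show ?thesis by blast
qed

text \<open>Isolating one step of \<open>newton_sequence\<close> as a relation lets the sequence be
  built by dependent choice.\<close>

definition step :: "(real \<Rightarrow> real^'m) \<Rightarrow> (real \<Rightarrow> real^'m) \<Rightarrow> bool" where
  "step u u' \<longleftrightarrow> (if AE t in leb T. hamiltonian_u T x0 b f g u t = 0 then u' = u
     else \<exists>v. newton_direction T x0 b f g u v \<and> u' = (if AE t in leb T. v t = 0 then u else (\<lambda>t. u t + v t)))"

lemma newton_sequence_iff: "newton_sequence T x0 b f g u0 us \<longleftrightarrow> us 0 = u0 \<and> (\<forall>k. step (us k) (us (Suc k)))"
  unfolding newton_sequence_def step_def ..

text \<open>If the iteration stops, then the zero control solves the equation of the Newton step.\<close>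

lemma step_stationary:
  assumes u: "u \<in> L2 T" and s: "step u u'" and ub: "ub \<in> L2 T"
  shows "u' \<in> L2 T"
    and "\<exists>v\<in>L2 T. (\<forall>w\<in>L2 T. DJ u w + B u v w = 0) \<and> nrm2 T (\<lambda>t. u' t - ub t) = nrm2 T (\<lambda>t. u t + v t - ub t)"
proof -
  have "u' \<in> L2 T \<and> (\<exists>v\<in>L2 T. (\<forall>w\<in>L2 T. DJ u w + B u v w = 0) \<and> nrm2 T (\<lambda>t. u' t - ub t) = nrm2 T (\<lambda>t. u t + v t - ub t))"
  proof (cases "AE t in leb T. hamiltonian_u T x0 b f g u t = 0")
    case True
    then have "AE t in leb T. G u t = 0" by (simp add: hamiltonian_u_AE_zero)
    then have "DJ u w = 0" for w unfolding DJ_def by (intro integral_eq_zero_AE) auto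
    moreover have "B u (\<lambda>t. 0) w = 0" if "w \<in> L2 T" for w
      using B_scale[OF u zero_L2 that, of 0] by simp
    ultimately have "\<forall>w\<in>L2 T. DJ u w + B u (\<lambda>t. 0) w = 0" by simp
    then show ?thesis using True s u zero_L2 by (intro conjI bexI[of _ "\<lambda>t. 0"]) (auto simp: step_def)
  next
    case False
    then obtain v where nd: "newton_direction T x0 b f g u v"
      and u': "u' = (if AE t in leb T. v t = 0 then u else (\<lambda>t. u t + v t))"
      using s by (auto simp: step_def)
    have v: "v \<in> L2 T" using nd by (simp add: newton_direction_def)
    have "nrm2 T (\<lambda>t. u' t - ub t) = nrm2 T (\<lambda>t. u t + v t - ub t)"
    proof (cases "AE t in leb T. v t = 0")
      case True
      then have "AE t in leb T. u t - ub t = u t + v t - ub t" by eventually_elim simp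
      then have "nrm2 T (\<lambda>t. u t - ub t) = nrm2 T (\<lambda>t. u t + v t - ub t)"
        by (rule nrm2_cong_AE) (intro L2_measurable L2_diff L2_add u v ub)+
      then show ?thesis using True u' by simp
    qed (simp add: u')
    moreover have "u' \<in> L2 T" using u v by (simp add: u' L2_add(1))
    ultimately show ?thesis using newton_direction_stationary[OF u nd] v by blast
  qed
  then show "u' \<in> L2 T"
    "\<exists>v\<in>L2 T. (\<forall>w\<in>L2 T. DJ u w + B u v w = 0) \<and> nrm2 T (\<lambda>t. u' t - ub t) = nrm2 T (\<lambda>t. u t + v t - ub t)" by blast+
qed

lemma r_4_equation:
  fixes ub :: "real \<Rightarrow> real^'m"
  assumes "0 < \<alpha>"
  defines "r \<equiv> r_4 T L (norm x0) \<alpha> ub"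
  shows "0 < r" "2 * (C4 * (1 + nrm1 T ub)) * r + C4 * sqrt T * r\<^sup>2 = \<alpha>"
proof -
  define p where "p = C4 * (1 + nrm1 T ub)"
  define q where "q = C4 * sqrt T"
  have p: "0 < p" unfolding p_def using C4_pos by (intro mult_pos_pos) (auto intro: add_pos_nonneg)
  have q: "0 < q" using C4_pos T by (simp add: q_def)
  define s where "s = sqrt (p\<^sup>2 + q * \<alpha>)"
  have r: "r = (s - p) / q" by (simp add: r_def r_4_def Let_def s_def p_def q_def power_mult_distrib)
  have s2: "s\<^sup>2 = p\<^sup>2 + q * \<alpha>" using q assms(1) by (simp add: s_def)
  have "p < s" unfolding s_def using p q assms(1) by (intro real_less_rsqrt) simp
  then show "0 < r" using q by (simp add: r)
  have "q * (2 * p * r + q * r\<^sup>2) = (s - p)\<^sup>2 + 2 * p * (s - p)"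
    unfolding r using q by (simp add: power2_eq_square field_simps)
  also have "\<dots> = q * \<alpha>" using s2 by (simp add: power2_eq_square algebra_simps)
  finally show "2 * (C4 * (1 + nrm1 T ub)) * r + C4 * sqrt T * r\<^sup>2 = \<alpha>"
    using q unfolding p_def[symmetric] q_def[symmetric] by simp
qed

theorem newton_converges:
  fixes ub :: "real \<Rightarrow> real^'m"
  assumes opt: "optimal_control T x0 b f g ub" and \<alpha>: "0 < \<alpha>"
    and coer: "second_order_coercive T x0 b f g ub \<alpha>"
    and u0: "u0 \<in> L2 T" and near: "nrm2 T (\<lambda>t. u0 t - ub t) \<le> r_4 T L (norm x0) \<alpha> ub"
  shows "\<exists>us. newton_sequence T x0 b f g u0 us"
    and "newton_sequence T x0 b f g u0 us \<Longrightarrow> quadratically_converges_L2 T us ub"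
    and "newton_sequence T x0 b f g u0 us \<Longrightarrow>
      quadratically_converges_L2 T (\<lambda>k. cost_gradient T x0 b f g (us k)) (\<lambda>t. 0)"
proof -
  let ?r = "r_4 T L (norm x0) \<alpha> ub"
  have ub: "ub \<in> L2 T" using opt by (simp add: optimal_control_def)
  interpret nb: newton_ball T L bb Dbb "\<lambda>t. second_deriv (bb t)" ff Dff "\<lambda>t. second_deriv (ff t)" g Dgg "second_deriv g" x0 ub \<alpha> ?r
  proof
    show "ub \<in> L2 T" by (rule ub)
    show "0 < \<alpha>" by (rule \<alpha>)
    show "0 < ?r" "2 * (C4 * (1 + nrm1 T ub)) * ?r + C4 * sqrt T * ?r\<^sup>2 = \<alpha>" by (rule r_4_equation[OF \<alpha>])+
    show "DJ ub w = 0" if "w \<in> L2 T" for w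
      by (rule stationary_of_minimal[OF ub _ that]) (use opt in \<open>simp add: optimal_control_def cost_eq\<close>)
    show "\<alpha> * (nrm2 T v)\<^sup>2 \<le> B ub v v" if "v \<in> L2 T" for v
      using coer that by (simp add: second_order_coercive_def second_order_form_eq)
  qed
  \<comment> \<open>Newton directions are known to exist only in the ball, so the iterates must be
    kept inside it while the sequence is being constructed.\<close>
  have contr: "nb.err u' \<le> ?r" if u: "u \<in> L2 T" and e: "nb.err u \<le> ?r" and s: "step u u'" for u u'
  proof -
    obtain v where v: "v \<in> L2 T" "\<And>w. w \<in> L2 T \<Longrightarrow> DJ u w + B u v w = 0"
      and eq: "nb.err u' = nb.err (\<lambda>t. u t + v t)"
      using step_stationary(2)[OF u s ub] by (auto simp: nb.err_def)
    have "nb.err u' \<le> nb.c * (nb.err u)\<^sup>2" unfolding eq by (rule nb.newton_step_error[OF u e v])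
    also have "\<dots> \<le> nb.c * (?r * ?r)"
      using e nb.err_nonneg[of u] nb.c_pos by (intro mult_left_mono) (auto simp: power2_eq_square intro: mult_mono)
    also have "\<dots> \<le> 1 * ?r" unfolding mult.assoc[symmetric] using nb.cr nb.r by (intro mult_right_mono) auto
    finally show ?thesis by simp
  qed
  have ex_step: "\<exists>u'. step u u'" if u: "u \<in> L2 T" and e: "nb.err u \<le> ?r" for u
    using newton_direction_exists[OF u nb.\<kappa>_pos nb.coercive_in_ball[OF u e]] unfolding step_def by metis
  \<comment> \<open>The invariant carries membership in the ball, which guarantees the next step,
    and a clause for index 0 that fixes the initial control.\<close>
  have "\<exists>us. \<forall>k. ((us k \<in> L2 T \<and> nb.err (us k) \<le> ?r) \<and> (k = 0 \<longrightarrow> us k = u0)) \<and> step (us k) (us (Suc k))"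
  proof (rule dependent_nat_choice)
    show "\<exists>u. (u \<in> L2 T \<and> nb.err u \<le> ?r) \<and> ((0::nat) = 0 \<longrightarrow> u = u0)" using u0 near by (auto simp: nb.err_def)
    fix u and n :: nat
    assume u: "(u \<in> L2 T \<and> nb.err u \<le> ?r) \<and> (n = 0 \<longrightarrow> u = u0)"
    then obtain u' where s: "step u u'" using ex_step by blast
    then show "\<exists>u'. ((u' \<in> L2 T \<and> nb.err u' \<le> ?r) \<and> (Suc n = 0 \<longrightarrow> u' = u0)) \<and> step u u'"
      using u contr[OF _ _ s] step_stationary(1)[OF _ s ub] by blast
  qed
  then show "\<exists>us. newton_sequence T x0 b f g u0 us" unfolding newton_sequence_iff by blast
  assume "newton_sequence T x0 b f g u0 us"
  then have us0: "us 0 = u0" and st: "\<And>k. step (us k) (us (Suc k))" unfolding newton_sequence_iff by auto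
  have usL: "us k \<in> L2 T" for k
  proof (induction k)
    case (Suc k) show ?case by (rule step_stationary(1)[OF Suc st ub])
  qed (simp add: us0 u0)
  have init: "nb.err (us 0) \<le> ?r" using near by (simp add: us0 nb.err_def)
  have stp: "\<exists>v\<in>L2 T. (\<forall>w\<in>L2 T. DJ (us k) w + B (us k) v w = 0) \<and> nb.err (us (Suc k)) = nb.err (\<lambda>t. us k t + v t)" for k
    unfolding nb.err_def by (rule step_stationary(2)[OF usL st ub])
  show "quadratically_converges_L2 T us ub" by (rule nb.newton_iteration_converges(1)[OF usL init stp])
  obtain K where K: "0 \<le> K" "\<And>k. nrm2 T (G (us (Suc k))) \<le> K * (nrm2 T (G (us k)))\<^sup>2"
    using nb.newton_iteration_converges(2)[OF usL init stp] by blast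
  \<comment> \<open>Quadratic convergence asks for a strictly positive constant, but
    \<open>K\<close> may be zero.\<close>
  have "nrm2 T (G (us (Suc k))) \<le> (K + 1) * (nrm2 T (G (us k)))\<^sup>2" for k
    using K(2)[of k] by (simp add: distrib_right add_increasing2)
  moreover have "0 < K + 1" using K(1) by simp
  ultimately show "quadratically_converges_L2 T (\<lambda>k. cost_gradient T x0 b f g (us k)) (\<lambda>t. 0)"
    unfolding quadratically_converges_L2_def
    using nb.newton_iteration_converges(3)[OF usL init stp] cost_gradient_props[OF usL] zero_L2 by auto
qed

end

theorem theorem5p5:
  fixes T L \<alpha> :: real
    and x0 :: "real^'n"
    and b :: "real \<Rightarrow> real^'n \<Rightarrow> real^'m \<Rightarrow> real^'n"
    and f :: "real \<Rightarrow> real^'n \<Rightarrow> real^'m \<Rightarrow> real"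
    and g :: "real^'n \<Rightarrow> real"
    and ubar :: "real \<Rightarrow> real^'m"
  assumes "T > 0"
    and "standing_assumptions T L b f g"
    and "uu_derivative_independent_of_u T f"
    and "uu_derivative_independent_of_u T b"
    and "optimal_control T x0 b f g ubar"
    and "\<alpha> > 0"
    and "second_order_coercive T x0 b f g ubar \<alpha>"
  shows
    "(\<exists>r>0. \<forall>u0\<in>Lp_space 2 T. Lp_norm 2 T (\<lambda>t. u0 t - ubar t) \<le> r \<longrightarrow>
        (\<exists>us. newton_sequence T x0 b f g u0 us) \<and>
        (\<forall>us. newton_sequence T x0 b f g u0 us \<longrightarrow>
           quadratically_converges_L2 T us ubar \<and>
           quadratically_converges_L2 T (\<lambda>k. cost_gradient T x0 b f g (us k)) (\<lambda>t. 0))) \<and>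
     0 < r_4 T L (norm x0) \<alpha> ubar \<and>
     (\<forall>u0\<in>Lp_space 2 T. Lp_norm 2 T (\<lambda>t. u0 t - ubar t) \<le> r_4 T L (norm x0) \<alpha> ubar \<longrightarrow>
        (\<exists>us. newton_sequence T x0 b f g u0 us) \<and>
        (\<forall>us. newton_sequence T x0 b f g u0 us \<longrightarrow> quadratically_converges_L2 T us ubar))"
proof -
  interpret newton_problem T L x0 b f g by unfold_locales (fact assms)+
  note converges = newton_converges[OF assms(5-7)]
  have "0 < r_4 T L (norm x0) \<alpha> ubar" by (rule r_4_equation(1)[OF assms(6)])
  \<comment> \<open>The radius \<open>r_4\<close> itself witnesses that closeness suffices in the
    first conjunct.\<close>
  with converges show ?thesis by blast
qed

end
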